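(* Let $M$ be a screen transversal Cauchy Riemann (STCR) lightlike submanifold of an indefinite Kähler manifold $\bar M$. Then: (i) The distribution $D$ is integrable if and only if $h(X,\bar JY)=h(\bar JX,Y)$ for all $X,Y\in\Gamma(D)$. (ii) The distribution $\tilde D$ is integrable if and only if $A_{\bar JZ}V=A_{\bar JV}Z$ for all $Z,V\in\Gamma(\tilde D)$.
   Context: Indefinite Kähler manifold $(\bar M,\bar J,\bar g)$: a semi-Riemannian manifold of constant index $q$, $0<q<\dim\bar M$, with an almost complex structure $\bar J$ ($\bar J^2=-I$) satisfying $\bar g(\bar JX,\bar JY)=\bar g(X,Y)$ and $\bar\nabla\bar J=0$, where $\bar\nabla$ is the Levi-Civita connection of $\bar g$. Lightlike submanifold: a submanifold $M$ of dimension $m$ of $\bar M$ (of dimension $m+n$), with induced metric $g$, such that $Rad(TM)=TM\cap TM^\perp$ has constant rank $r$, $1\le r\le m$. One fixes non-degenerate complements: a screen distribution $S(TM)$ with $TM=S(TM)\perp Rad(TM)$ and a screen transversal bundle $S(TM^\perp)$ with $TM^\perp=S(TM^\perp)\perp Rad(TM)$. The lightlike transversal bundle $ltr(TM)$ is a rank $r$ complement of $Rad(TM)$ in the orthogonal complement of $S(TM)\perp S(TM^\perp)$ in $T\bar M|_M$, locally spanned by $N_1,\dots,N_r$ with $\bar g(\xi_i,N_j)=\delta_{ij}$, $\bar g(N_i,N_j)=0$ for a local basis $\{\xi_i\}$ of $Rad(TM)$. Put $tr(TM)=ltr(TM)\perp S(TM^\perp)$; then $T\bar M|_M=TM\oplus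 tr(TM)$. STCR lightlike submanifold: a real lightlike submanifold $M$ of $\bar M$ such that (A) there are subbundles $D_1,D_2$ of $Rad(TM)$ with $Rad(TM)=D_1\oplus D_2$, $\bar J(D_1)\subset S(TM)$, $\bar J(D_2)\subset S(TM^\perp)$; (B) there are subbundles $D_0,D'$ of $S(TM)$ with $S(TM)=\{\bar JD_1\oplus D'\}\perp D_0$, $\bar J(D_0)=D_0$, $\bar J(D')=L_1\perp S$, where $D_0$ is non-degenerate and $L_1$, $S$ are vector subbundles of $ltr(TM)$ and $S(TM^\perp)$ respectively. Moreover $ltr(TM)=L_1\oplus L_2$ with $\bar J(L_1)\subset S(TM)$, $\bar J(L_2)\subset S(TM^\perp)$, and $S(TM^\perp)=\{\bar J(D_2)\oplus\bar J(L_2)\}\perp S$. Then $TM=D\oplus\tilde D$, where $D=D_0\oplus D_1\oplus\bar JD_1$ is $\bar J$-invariant and $\tilde D=D_2\oplus\bar JL_1\oplus\bar JS$ satisfies $\bar J\tilde D\subset tr(TM)$. Gauss–Weingarten formulas (for $X,Y\in\Gamma(TM)$, $V\in\Gamma(tr(TM))$): $\bar\nabla_XY=\nabla_XY+h(X,Y)$ and $\bar\nabla_XV=-A_VX+\nabla^t_XV$, with $\nabla_XY,A_VX\in\Gamma(TM)$ and $h(X,Y),\nabla^t_XV\in\Gamma(tr(TM))$. *)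

theory Defs
  imports "HOL-Analysis.Analysis" "HOL-Library.Function_Algebras" "HOL-Library.Set_Algebras"
begin

text \<open>
  Pointwise real vector space structure on functions.  Tangent vectors are functionals
  on scalar functions, so this makes \<open>subspace\<close>, \<open>span\<close>, \<open>dim\<close> available for them.
\<close>

instantiation "fun" :: (type, real_vector) real_vector
begin

definition scaleR_fun :: "real \<Rightarrow> ('a \<Rightarrow> 'b) \<Rightarrow> 'a \<Rightarrow> 'b"
  where "scaleR_fun c f = (\<lambda>x. c *\<^sub>R f x)"

instance
  by standard (auto simp: scaleR_fun_def fun_eq_iff scaleR_add_right scaleR_add_left)

end


section \<open>Smooth manifolds\<close>

text \<open>\<open>Ck_on\<close> and \<open>smooth_on\<close> are only meant for open \<open>S\<close>.\<close>

primrec Ck_on :: "nat \<Rightarrow> 'a::euclidean_space set \<Rightarrow> ('a \<Rightarrow> 'b::real_normed_vector) \<Rightarrow> bool" where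
  "Ck_on 0 S f \<longleftrightarrow> continuous_on S f"
| "Ck_on (Suc k) S f \<longleftrightarrow>
     (\<forall>x\<in>S. f differentiable (at x)) \<and>
     (\<forall>u. Ck_on k S (\<lambda>x. frechet_derivative f (at x) u))"

definition smooth_on :: "'a::euclidean_space set \<Rightarrow> ('a \<Rightarrow> 'b::real_normed_vector) \<Rightarrow> bool"
  where "smooth_on S f \<longleftrightarrow> (\<forall>k. Ck_on k S f)"

text \<open>
  A chart is a pair \<open>(U, \<phi>)\<close>; the values of \<open>\<phi>\<close> outside \<open>U\<close> are irrelevant.
  A manifold is a Hausdorff second countable type together with a maximal smooth atlas;
  its dimension is the dimension of the model space \<open>'e\<close>.
\<close>

type_synonym ('a, 'e) chart = "'a set \<times> ('a \<Rightarrow> 'e)"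

definition is_chart :: "('a::topological_space, 'e::euclidean_space) chart \<Rightarrow> bool" where
  "is_chart = (\<lambda>(U, \<phi>). open U \<and> open (\<phi> ` U) \<and> inj_on \<phi> U \<and>
     homeomorphism U (\<phi> ` U) \<phi> (inv_into U \<phi>))"

definition compatible ::
    "('a::topological_space, 'e::euclidean_space) chart \<Rightarrow> ('a, 'e) chart \<Rightarrow> bool" where
  "compatible = (\<lambda>(U, \<phi>) (V, \<psi>).
     smooth_on (\<phi> ` (U \<inter> V)) (\<psi> \<circ> inv_into U \<phi>) \<and>
     smooth_on (\<psi> ` (U \<inter> V)) (\<phi> \<circ> inv_into V \<psi>))"

definition smooth_structure ::
    "('a::{t2_space,second_countable_topology}, 'e::euclidean_space) chart set \<Rightarrow> bool" where
  "smooth_structure A \<longleftrightarrow>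
     (\<forall>c\<in>A. is_chart c) \<and> (\<Union>c\<in>A. fst c) = UNIV \<and>
     (\<forall>c\<in>A. \<forall>c'\<in>A. compatible c c') \<and>
     (\<forall>c. is_chart c \<and> (\<forall>c'\<in>A. compatible c c') \<longrightarrow> c \<in> A)"

definition smooth_fun ::
    "('a::topological_space, 'e::euclidean_space) chart set \<Rightarrow> ('a \<Rightarrow> real) set" where
  "smooth_fun A = {f. \<forall>(U, \<phi>)\<in>A. smooth_on (\<phi> ` U) (f \<circ> inv_into U \<phi>)}"

definition smooth_map ::
    "('p::topological_space, 'e::euclidean_space) chart set \<Rightarrow>
     ('a::topological_space, 'b::euclidean_space) chart set \<Rightarrow> ('p \<Rightarrow> 'a) \<Rightarrow> bool" where
  "smooth_map A B F \<longleftrightarrow> continuous_on UNIV F \<and>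
     (\<forall>(U, \<phi>)\<in>A. \<forall>(V, \<psi>)\<in>B.
        smooth_on (\<phi> ` (U \<inter> F -` V)) (\<psi> \<circ> F \<circ> inv_into U \<phi>))"


section \<open>Tangent vectors and vector fields\<close>

text \<open>
  Tangent vectors are derivations of the algebra of smooth functions, extended by \<open>0\<close> to
  non-smooth functions so that equality of tangent vectors is equality of functionals.
\<close>

type_synonym 'a tvec = "('a \<Rightarrow> real) \<Rightarrow> real"

definition tangent_space ::
    "('a::topological_space, 'e::euclidean_space) chart set \<Rightarrow> 'a \<Rightarrow> 'a tvec set" where
  "tangent_space A p = {v.
     (\<forall>f\<in>smooth_fun A. \<forall>g\<in>smooth_fun A. v (f + g) = v f + v g) \<and>
     (\<forall>c. \<forall>f\<in>smooth_fun A. v (c *\<^sub>R f) = c * v f) \<and>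
     (\<forall>f\<in>smooth_fun A. \<forall>g\<in>smooth_fun A. v (f * g) = v f * g p + f p * v g) \<and>
     (\<forall>f. f \<notin> smooth_fun A \<longrightarrow> v f = 0)}"

text \<open>The vector at \<open>p\<close> whose component vector in the chart is \<open>u\<close>.\<close>

definition coord_vec ::
    "('a::topological_space, 'e::euclidean_space) chart set \<Rightarrow> ('a, 'e) chart \<Rightarrow> 'a \<Rightarrow> 'e \<Rightarrow> 'a tvec"
  where
  "coord_vec A = (\<lambda>(U, \<phi>) p u f.
     if f \<in> smooth_fun A then frechet_derivative (f \<circ> inv_into U \<phi>) (at (\<phi> p)) u else 0)"

definition push ::
    "('p::topological_space, 'e::euclidean_space) chart set \<Rightarrow>
     ('a::topological_space, 'b::euclidean_space) chart set \<Rightarrow> ('p \<Rightarrow> 'a) \<Rightarrow> 'p tvec \<Rightarrow> 'a tvec"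
  where
  "push A B F v = (\<lambda>f. if f \<in> smooth_fun B then v (f \<circ> F) else 0)"

definition immersion ::
    "('p::topological_space, 'e::euclidean_space) chart set \<Rightarrow>
     ('a::topological_space, 'b::euclidean_space) chart set \<Rightarrow> ('p \<Rightarrow> 'a) \<Rightarrow> bool" where
  "immersion A B F \<longleftrightarrow>
     smooth_map A B F \<and> (\<forall>p. inj_on (push A B F) (tangent_space A p))"

text \<open>Smooth vector fields along a map \<open>F\<close>, i.e. smooth sections of the pulled back tangent bundle.\<close>

definition fields_along ::
    "('p::topological_space, 'e::euclidean_space) chart set \<Rightarrow>
     ('a::topological_space, 'b::euclidean_space) chart set \<Rightarrow> ('p \<Rightarrow> 'a) \<Rightarrow> ('p \<Rightarrow> 'a tvec) set"
  where
  "fields_along A B F = {V. (\<forall>p. V p \<in> tangent_space B (F p)) \<and>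
     (\<forall>f\<in>smooth_fun B. (\<lambda>p. V p f) \<in> smooth_fun A)}"

abbreviation vector_fields ::
    "('a::topological_space, 'b::euclidean_space) chart set \<Rightarrow> ('a \<Rightarrow> 'a tvec) set" where
  "vector_fields B \<equiv> fields_along B B (\<lambda>p. p)"

definition lie_bracket :: "('a \<Rightarrow> 'a tvec) \<Rightarrow> ('a \<Rightarrow> 'a tvec) \<Rightarrow> 'a \<Rightarrow> 'a tvec" where
  "lie_bracket X Y p = (\<lambda>f. X p (\<lambda>q. Y q f) - Y p (\<lambda>q. X q f))"


section \<open>Distributions and integrability\<close>

text \<open>
  \<open>S\<close> is an (embedded) integral manifold of the distribution \<open>\<Delta>\<close>: around each of its points it
  is a linear slice in some chart \<open>c\<close> of the maximal atlas, and its tangent space, which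
  in that chart is spanned by the coordinate vectors in the direction of the slice, is given
  by \<open>\<Delta>\<close>.
\<close>

definition integral_manifold ::
    "('p::topological_space, 'e::euclidean_space) chart set \<Rightarrow> ('p \<Rightarrow> 'p tvec set) \<Rightarrow> 'p set \<Rightarrow> bool"
  where
  "integral_manifold A \<Delta> S \<longleftrightarrow>
     (\<forall>q\<in>S. \<exists>c\<in>A. \<exists>E. q \<in> fst c \<and> subspace E \<and>
        snd c ` (fst c \<inter> S) = snd c ` fst c \<inter> E \<and>
        (\<forall>s\<in>fst c \<inter> S. \<Delta> s = coord_vec A c s ` E))"

definition integrable_distribution ::
    "('p::topological_space, 'e::euclidean_space) chart set \<Rightarrow> ('p \<Rightarrow> 'p tvec set) \<Rightarrow> bool" where
  "integrable_distribution A \<Delta> \<longleftrightarrow> (\<forall>p. \<exists>S. p \<in> S \<and> integral_manifold A \<Delta> S)"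


section \<open>Indefinite Kaehler manifolds\<close>

definition linear_map_on :: "'v::real_vector set \<Rightarrow> 'w::real_vector set \<Rightarrow> ('v \<Rightarrow> 'w) \<Rightarrow> bool" where
  "linear_map_on V W L \<longleftrightarrow> L ` V \<subseteq> W \<and>
     (\<forall>x\<in>V. \<forall>y\<in>V. L (x + y) = L x + L y) \<and> (\<forall>c. \<forall>x\<in>V. L (c *\<^sub>R x) = c *\<^sub>R L x)"

definition symmetric_bilinear_on :: "'v::real_vector set \<Rightarrow> ('v \<Rightarrow> 'v \<Rightarrow> real) \<Rightarrow> bool" where
  "symmetric_bilinear_on V b \<longleftrightarrow>
     (\<forall>x\<in>V. linear_map_on V UNIV (b x)) \<and> (\<forall>x\<in>V. \<forall>y\<in>V. b x y = b y x)"

definition nondegenerate_on :: "'v::real_vector set \<Rightarrow> ('v \<Rightarrow> 'v \<Rightarrow> real) \<Rightarrow> bool" where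
  "nondegenerate_on V b \<longleftrightarrow> (\<forall>x\<in>V. (\<forall>y\<in>V. b x y = 0) \<longrightarrow> x = 0)"

definition negative_definite_on :: "'v::real_vector set \<Rightarrow> ('v \<Rightarrow> 'v \<Rightarrow> real) \<Rightarrow> bool" where
  "negative_definite_on V b \<longleftrightarrow> (\<forall>x\<in>V. x \<noteq> 0 \<longrightarrow> b x x < 0)"

definition has_index :: "'v::real_vector set \<Rightarrow> ('v \<Rightarrow> 'v \<Rightarrow> real) \<Rightarrow> nat \<Rightarrow> bool" where
  "has_index V b q \<longleftrightarrow>
     (\<exists>W\<subseteq>V. subspace W \<and> negative_definite_on W b \<and> dim W = q) \<and>
     (\<forall>W\<subseteq>V. subspace W \<and> negative_definite_on W b \<longrightarrow> dim W \<le> q)"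

definition direct_sum :: "'v::real_vector set \<Rightarrow> 'v set \<Rightarrow> 'v set \<Rightarrow> bool" where
  "direct_sum V W1 W2 \<longleftrightarrow> V = W1 + W2 \<and> W1 \<inter> W2 = {0}"

definition orthogonal_sum ::
    "('v::real_vector \<Rightarrow> 'v \<Rightarrow> real) \<Rightarrow> 'v set \<Rightarrow> 'v set \<Rightarrow> 'v set \<Rightarrow> bool" where
  "orthogonal_sum b V W1 W2 \<longleftrightarrow> direct_sum V W1 W2 \<and> (\<forall>x\<in>W1. \<forall>y\<in>W2. b x y = 0)"

definition semi_riemannian_metric ::
    "('a::topological_space, 'b::euclidean_space) chart set \<Rightarrow> nat \<Rightarrow>
     ('a \<Rightarrow> 'a tvec \<Rightarrow> 'a tvec \<Rightarrow> real) \<Rightarrow> bool" where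
  "semi_riemannian_metric B q g \<longleftrightarrow>
     (\<forall>p. symmetric_bilinear_on (tangent_space B p) (g p) \<and>
          nondegenerate_on (tangent_space B p) (g p) \<and>
          has_index (tangent_space B p) (g p) q) \<and>
     (\<forall>X\<in>vector_fields B. \<forall>Y\<in>vector_fields B. (\<lambda>p. g p (X p) (Y p)) \<in> smooth_fun B)"

text \<open>
  A connection is given as \<open>nab p v Y\<close>, the covariant derivative at \<open>p\<close> of the vector field \<open>Y\<close>
  in the direction of the tangent vector \<open>v\<close>.
\<close>

definition affine_connection ::
    "('a::topological_space, 'b::euclidean_space) chart set \<Rightarrow>
     ('a \<Rightarrow> 'a tvec \<Rightarrow> ('a \<Rightarrow> 'a tvec) \<Rightarrow> 'a tvec) \<Rightarrow> bool" where
  "affine_connection B nab \<longleftrightarrow>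
     (\<forall>p. \<forall>Y\<in>vector_fields B.
        linear_map_on (tangent_space B p) (tangent_space B p) (\<lambda>v. nab p v Y)) \<and>
     (\<forall>p. \<forall>v\<in>tangent_space B p. \<forall>Y\<in>vector_fields B. \<forall>Z\<in>vector_fields B.
        nab p v (Y + Z) = nab p v Y + nab p v Z) \<and>
     (\<forall>p. \<forall>v\<in>tangent_space B p. \<forall>f\<in>smooth_fun B. \<forall>Y\<in>vector_fields B.
        nab p v (\<lambda>q. f q *\<^sub>R Y q) = v f *\<^sub>R Y p + f p *\<^sub>R nab p v Y) \<and>
     (\<forall>X\<in>vector_fields B. \<forall>Y\<in>vector_fields B. (\<lambda>p. nab p (X p) Y) \<in> vector_fields B)"

definition levi_civita ::
    "('a::topological_space, 'b::euclidean_space) chart set \<Rightarrow>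
     ('a \<Rightarrow> 'a tvec \<Rightarrow> 'a tvec \<Rightarrow> real) \<Rightarrow>
     ('a \<Rightarrow> 'a tvec \<Rightarrow> ('a \<Rightarrow> 'a tvec) \<Rightarrow> 'a tvec) \<Rightarrow> bool" where
  "levi_civita B g nab \<longleftrightarrow> affine_connection B nab \<and>
     (\<forall>X\<in>vector_fields B. \<forall>Y\<in>vector_fields B. \<forall>p.
        nab p (X p) Y - nab p (Y p) X = lie_bracket X Y p) \<and>
     (\<forall>p. \<forall>v\<in>tangent_space B p. \<forall>Y\<in>vector_fields B. \<forall>Z\<in>vector_fields B.
        v (\<lambda>q. g q (Y q) (Z q)) = g p (nab p v Y) (Z p) + g p (Y p) (nab p v Z))"

definition almost_complex_structure ::
    "('a::topological_space, 'b::euclidean_space) chart set \<Rightarrow> ('a \<Rightarrow> 'a tvec \<Rightarrow> 'a tvec) \<Rightarrow> bool"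
  where
  "almost_complex_structure B J \<longleftrightarrow>
     (\<forall>p. linear_map_on (tangent_space B p) (tangent_space B p) (J p) \<and>
          (\<forall>x\<in>tangent_space B p. J p (J p x) = - x)) \<and>
     (\<forall>X\<in>vector_fields B. (\<lambda>p. J p (X p)) \<in> vector_fields B)"

definition indefinite_kaehler ::
    "('a::{t2_space,second_countable_topology}, 'b::euclidean_space) chart set \<Rightarrow> nat \<Rightarrow>
     ('a \<Rightarrow> 'a tvec \<Rightarrow> 'a tvec \<Rightarrow> real) \<Rightarrow> ('a \<Rightarrow> 'a tvec \<Rightarrow> 'a tvec) \<Rightarrow>
     ('a \<Rightarrow> 'a tvec \<Rightarrow> ('a \<Rightarrow> 'a tvec) \<Rightarrow> 'a tvec) \<Rightarrow> bool" where
  "indefinite_kaehler B q g J nab \<longleftrightarrow>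
     smooth_structure B \<and>
     semi_riemannian_metric B q g \<and> 0 < q \<and> q < DIM('b) \<and>
     almost_complex_structure B J \<and>
     (\<forall>p. \<forall>x\<in>tangent_space B p. \<forall>y\<in>tangent_space B p. g p (J p x) (J p y) = g p x y) \<and>
     levi_civita B g nab \<and>
     (\<forall>p. \<forall>v\<in>tangent_space B p. \<forall>Y\<in>vector_fields B.
        nab p v (\<lambda>q. J q (Y q)) = J p (nab p v Y))"


section \<open>Vector bundles along an immersion\<close>

text \<open>
  All bundles over \<open>M\<close> are subbundles of the pullback along the immersion \<open>F : M \<rightarrow> N\<close> of the
  tangent bundle of \<open>N\<close>; in particular \<open>TM\<close> is identified with its image under the differential.
\<close>

definition tan_bundle ::
    "('p::topological_space, 'e::euclidean_space) chart set \<Rightarrow>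
     ('a::topological_space, 'b::euclidean_space) chart set \<Rightarrow> ('p \<Rightarrow> 'a) \<Rightarrow> 'p \<Rightarrow> 'a tvec set" where
  "tan_bundle A B F p = push A B F ` tangent_space A p"

definition normal_bundle ::
    "('p::topological_space, 'e::euclidean_space) chart set \<Rightarrow>
     ('a::topological_space, 'b::euclidean_space) chart set \<Rightarrow>
     ('a \<Rightarrow> 'a tvec \<Rightarrow> 'a tvec \<Rightarrow> real) \<Rightarrow> ('p \<Rightarrow> 'a) \<Rightarrow> 'p \<Rightarrow> 'a tvec set" where
  "normal_bundle A B g F p =
     {w \<in> tangent_space B (F p). \<forall>x\<in>tan_bundle A B F p. g (F p) w x = 0}"

definition rad_bundle ::
    "('p::topological_space, 'e::euclidean_space) chart set \<Rightarrow>
     ('a::topological_space, 'b::euclidean_space) chart set \<Rightarrow>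
     ('a \<Rightarrow> 'a tvec \<Rightarrow> 'a tvec \<Rightarrow> real) \<Rightarrow> ('p \<Rightarrow> 'a) \<Rightarrow> 'p \<Rightarrow> 'a tvec set" where
  "rad_bundle A B g F p = tan_bundle A B F p \<inter> normal_bundle A B g F p"

text \<open>
  A local frame of \<open>E\<close> on \<open>U\<close>, given as the restriction of globally defined smooth fields along \<open>F\<close>
  (which need not lie in \<open>E\<close> outside \<open>U\<close>).  After shrinking \<open>U\<close>, every smooth
  local frame has this form.
\<close>

definition local_frame ::
    "('p::topological_space, 'e::euclidean_space) chart set \<Rightarrow>
     ('a::topological_space, 'b::euclidean_space) chart set \<Rightarrow> ('p \<Rightarrow> 'a) \<Rightarrow>
     nat \<Rightarrow> ('p \<Rightarrow> 'a tvec set) \<Rightarrow> 'p set \<Rightarrow> (nat \<Rightarrow> 'p \<Rightarrow> 'a tvec) \<Rightarrow> bool" where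
  "local_frame A B F k E U s \<longleftrightarrow> open U \<and> (\<forall>i<k. s i \<in> fields_along A B F) \<and>
     (\<forall>p\<in>U. inj_on (\<lambda>i. s i p) {..<k} \<and> independent ((\<lambda>i. s i p) ` {..<k}) \<and>
        span ((\<lambda>i. s i p) ` {..<k}) = E p)"

definition vector_subbundle ::
    "('p::topological_space, 'e::euclidean_space) chart set \<Rightarrow>
     ('a::topological_space, 'b::euclidean_space) chart set \<Rightarrow> ('p \<Rightarrow> 'a) \<Rightarrow>
     ('p \<Rightarrow> 'a tvec set) \<Rightarrow> bool" where
  "vector_subbundle A B F E \<longleftrightarrow> (\<exists>k. \<forall>p. \<exists>U s. p \<in> U \<and> local_frame A B F k E U s)"

definition sections ::
    "('p::topological_space, 'e::euclidean_space) chart set \<Rightarrow>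
     ('a::topological_space, 'b::euclidean_space) chart set \<Rightarrow> ('p \<Rightarrow> 'a) \<Rightarrow>
     ('p \<Rightarrow> 'a tvec set) \<Rightarrow> ('p \<Rightarrow> 'a tvec) set" where
  "sections A B F E = {V \<in> fields_along A B F. \<forall>p. V p \<in> E p}"

text \<open>
  The connection \<open>D\<close> on the pulled back tangent bundle induced by \<open>nab\<close>, by which one
  differentiates fields along \<open>M\<close> in directions tangent to \<open>M\<close>.
\<close>

definition induced_connection ::
    "('p::topological_space, 'e::euclidean_space) chart set \<Rightarrow>
     ('a::topological_space, 'b::euclidean_space) chart set \<Rightarrow> ('p \<Rightarrow> 'a) \<Rightarrow>
     ('a \<Rightarrow> 'a tvec \<Rightarrow> ('a \<Rightarrow> 'a tvec) \<Rightarrow> 'a tvec) \<Rightarrow>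
     ('p \<Rightarrow> 'a tvec \<Rightarrow> ('p \<Rightarrow> 'a tvec) \<Rightarrow> 'a tvec) \<Rightarrow> bool" where
  "induced_connection A B F nab D \<longleftrightarrow>
     (\<forall>p. \<forall>V\<in>fields_along A B F.
        linear_map_on (tan_bundle A B F p) (tangent_space B (F p)) (\<lambda>v. D p v V)) \<and>
     (\<forall>p. \<forall>v\<in>tan_bundle A B F p. \<forall>V\<in>fields_along A B F. \<forall>W\<in>fields_along A B F.
        D p v (V + W) = D p v V + D p v W) \<and>
     (\<forall>p. \<forall>x\<in>tangent_space A p. \<forall>f\<in>smooth_fun A. \<forall>V\<in>fields_along A B F.
        D p (push A B F x) (\<lambda>q. f q *\<^sub>R V q) = x f *\<^sub>R V p + f p *\<^sub>R D p (push A B F x) V) \<and>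
     (\<forall>p. \<forall>v\<in>tan_bundle A B F p. \<forall>Y\<in>vector_fields B. D p v (Y \<circ> F) = nab (F p) v Y) \<and>
     (\<forall>X\<in>sections A B F (tan_bundle A B F). \<forall>V\<in>fields_along A B F.
        (\<lambda>p. D p (X p) V) \<in> fields_along A B F)"


section \<open>Lightlike submanifolds\<close>

definition lightlike_submanifold ::
    "('p::{t2_space,second_countable_topology}, 'e::euclidean_space) chart set \<Rightarrow>
     ('a::topological_space, 'b::euclidean_space) chart set \<Rightarrow>
     ('a \<Rightarrow> 'a tvec \<Rightarrow> 'a tvec \<Rightarrow> real) \<Rightarrow> ('p \<Rightarrow> 'a) \<Rightarrow> nat \<Rightarrow> bool" where
  "lightlike_submanifold A B g F r \<longleftrightarrow> smooth_structure A \<and> immersion A B F \<and>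
     (\<forall>p. dim (rad_bundle A B g F p) = r) \<and> 1 \<le> r \<and> r \<le> DIM('e)"

definition screen_distribution ::
    "('p::topological_space, 'e::euclidean_space) chart set \<Rightarrow>
     ('a::topological_space, 'b::euclidean_space) chart set \<Rightarrow>
     ('a \<Rightarrow> 'a tvec \<Rightarrow> 'a tvec \<Rightarrow> real) \<Rightarrow> ('p \<Rightarrow> 'a) \<Rightarrow> ('p \<Rightarrow> 'a tvec set) \<Rightarrow> bool" where
  "screen_distribution A B g F ST \<longleftrightarrow> vector_subbundle A B F ST \<and>
     (\<forall>p. nondegenerate_on (ST p) (g (F p)) \<and>
          orthogonal_sum (g (F p)) (tan_bundle A B F p) (ST p) (rad_bundle A B g F p))"

definition screen_transversal_bundle ::
    "('p::topological_space, 'e::euclidean_space) chart set \<Rightarrow>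
     ('a::topological_space, 'b::euclidean_space) chart set \<Rightarrow>
     ('a \<Rightarrow> 'a tvec \<Rightarrow> 'a tvec \<Rightarrow> real) \<Rightarrow> ('p \<Rightarrow> 'a) \<Rightarrow> ('p \<Rightarrow> 'a tvec set) \<Rightarrow> bool" where
  "screen_transversal_bundle A B g F SN \<longleftrightarrow> vector_subbundle A B F SN \<and>
     (\<forall>p. nondegenerate_on (SN p) (g (F p)) \<and>
          orthogonal_sum (g (F p)) (normal_bundle A B g F p) (SN p) (rad_bundle A B g F p))"

definition lightlike_transversal_bundle ::
    "('p::topological_space, 'e::euclidean_space) chart set \<Rightarrow>
     ('a::topological_space, 'b::euclidean_space) chart set \<Rightarrow>
     ('a \<Rightarrow> 'a tvec \<Rightarrow> 'a tvec \<Rightarrow> real) \<Rightarrow> ('p \<Rightarrow> 'a) \<Rightarrow> nat \<Rightarrow>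
     ('p \<Rightarrow> 'a tvec set) \<Rightarrow> ('p \<Rightarrow> 'a tvec set) \<Rightarrow> ('p \<Rightarrow> 'a tvec set) \<Rightarrow> bool" where
  "lightlike_transversal_bundle A B g F r ST SN ltr \<longleftrightarrow>
     (\<forall>p. direct_sum {w \<in> tangent_space B (F p). \<forall>x\<in>ST p + SN p. g (F p) w x = 0}
            (rad_bundle A B g F p) (ltr p)) \<and>
     (\<forall>p. \<exists>U \<xi> N. p \<in> U \<and>
        local_frame A B F r (rad_bundle A B g F) U \<xi> \<and> local_frame A B F r ltr U N \<and>
        (\<forall>x\<in>U. \<forall>i<r. \<forall>j<r.
           g (F x) (\<xi> i x) (N j x) = (if i = j then 1 else 0) \<and> g (F x) (N i x) (N j x) = 0))"

definition tr_bundle :: "('p \<Rightarrow> 'a tvec set) \<Rightarrow> ('p \<Rightarrow> 'a tvec set) \<Rightarrow> 'p \<Rightarrow> 'a tvec set" where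
  "tr_bundle ltr SN p = ltr p + SN p"

text \<open>
  The parts of the Gauss and Weingarten formulas that are used: \<open>second_ff\<close> is \<open>h(X,Y)\<close> and
  \<open>shape\<close> is \<open>A\<^sub>V X\<close>.  Both are read off from the splitting of the pulled back tangent bundle into
  the tangent bundle \<open>TM\<close> and the transversal bundle \<open>tr\<close>.
\<close>

definition component :: "'v::real_vector set \<Rightarrow> 'v set \<Rightarrow> 'v \<Rightarrow> 'v" where
  "component W1 W2 v = (THE w. w \<in> W1 \<and> v - w \<in> W2)"

definition second_ff ::
    "('p \<Rightarrow> 'a tvec set) \<Rightarrow> ('p \<Rightarrow> 'a tvec set) \<Rightarrow>
     ('p \<Rightarrow> 'a tvec \<Rightarrow> ('p \<Rightarrow> 'a tvec) \<Rightarrow> 'a tvec) \<Rightarrow>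
     ('p \<Rightarrow> 'a tvec) \<Rightarrow> ('p \<Rightarrow> 'a tvec) \<Rightarrow> 'p \<Rightarrow> 'a tvec" where
  "second_ff TM tr D X Y p = component (tr p) (TM p) (D p (X p) Y)"

definition shape ::
    "('p \<Rightarrow> 'a tvec set) \<Rightarrow> ('p \<Rightarrow> 'a tvec set) \<Rightarrow>
     ('p \<Rightarrow> 'a tvec \<Rightarrow> ('p \<Rightarrow> 'a tvec) \<Rightarrow> 'a tvec) \<Rightarrow>
     ('p \<Rightarrow> 'a tvec) \<Rightarrow> ('p \<Rightarrow> 'a tvec) \<Rightarrow> 'p \<Rightarrow> 'a tvec" where
  "shape TM tr D V X p = - component (TM p) (tr p) (D p (X p) V)"


section \<open>STCR lightlike submanifolds\<close>

text \<open>
  \<open>ST\<close>, \<open>SN\<close>, \<open>ltr\<close> are \<open>S(TM)\<close>, \<open>S(TM\<^sup>\<bottom>)\<close>, \<open>ltr(TM)\<close>.  An orthogonal sum \<open>{E\<^sub>1 \<oplus> E\<^sub>2} \<bottom> E\<^sub>3\<close> is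
  expressed by an orthogonal sum of \<open>E\<^sub>1 + E\<^sub>2\<close> and \<open>E\<^sub>3\<close>, together with \<open>E\<^sub>1 \<inter> E\<^sub>2 = {0}\<close>.
\<close>

definition stcr ::
    "('p::topological_space, 'e::euclidean_space) chart set \<Rightarrow>
     ('a::topological_space, 'b::euclidean_space) chart set \<Rightarrow>
     ('a \<Rightarrow> 'a tvec \<Rightarrow> 'a tvec \<Rightarrow> real) \<Rightarrow> ('a \<Rightarrow> 'a tvec \<Rightarrow> 'a tvec) \<Rightarrow> ('p \<Rightarrow> 'a) \<Rightarrow>
     ('p \<Rightarrow> 'a tvec set) \<Rightarrow> ('p \<Rightarrow> 'a tvec set) \<Rightarrow> ('p \<Rightarrow> 'a tvec set) \<Rightarrow>
     ('p \<Rightarrow> 'a tvec set) \<Rightarrow> ('p \<Rightarrow> 'a tvec set) \<Rightarrow> ('p \<Rightarrow> 'a tvec set) \<Rightarrow> ('p \<Rightarrow> 'a tvec set) \<Rightarrow>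
     ('p \<Rightarrow> 'a tvec set) \<Rightarrow> ('p \<Rightarrow> 'a tvec set) \<Rightarrow> ('p \<Rightarrow> 'a tvec set) \<Rightarrow> bool" where
  "stcr A B g J F ST SN ltr D0 D1 D2 D' L1 L2 S \<longleftrightarrow>
     (\<forall>E\<in>{D0, D1, D2, D', L1, L2, S}. vector_subbundle A B F E) \<and>
     (\<forall>p. direct_sum (rad_bundle A B g F p) (D1 p) (D2 p) \<and>
          J (F p) ` D1 p \<subseteq> ST p \<and> J (F p) ` D2 p \<subseteq> SN p) \<and>
     (\<forall>p. orthogonal_sum (g (F p)) (ST p) (J (F p) ` D1 p + D' p) (D0 p) \<and>
          J (F p) ` D1 p \<inter> D' p = {0} \<and>
          J (F p) ` D0 p = D0 p \<and> nondegenerate_on (D0 p) (g (F p)) \<and>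
          orthogonal_sum (g (F p)) (J (F p) ` D' p) (L1 p) (S p) \<and>
          L1 p \<subseteq> ltr p \<and> S p \<subseteq> SN p) \<and>
     (\<forall>p. direct_sum (ltr p) (L1 p) (L2 p) \<and>
          J (F p) ` L1 p \<subseteq> ST p \<and> J (F p) ` L2 p \<subseteq> SN p \<and>
          orthogonal_sum (g (F p)) (SN p) (J (F p) ` D2 p + J (F p) ` L2 p) (S p) \<and>
          J (F p) ` D2 p \<inter> J (F p) ` L2 p = {0})"

definition D_dist ::
    "('a \<Rightarrow> 'a tvec \<Rightarrow> 'a tvec) \<Rightarrow> ('p \<Rightarrow> 'a) \<Rightarrow>
     ('p \<Rightarrow> 'a tvec set) \<Rightarrow> ('p \<Rightarrow> 'a tvec set) \<Rightarrow> 'p \<Rightarrow> 'a tvec set" where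
  "D_dist J F D0 D1 p = D0 p + D1 p + J (F p) ` D1 p"

definition Dt_dist ::
    "('a \<Rightarrow> 'a tvec \<Rightarrow> 'a tvec) \<Rightarrow> ('p \<Rightarrow> 'a) \<Rightarrow>
     ('p \<Rightarrow> 'a tvec set) \<Rightarrow> ('p \<Rightarrow> 'a tvec set) \<Rightarrow> ('p \<Rightarrow> 'a tvec set) \<Rightarrow> 'p \<Rightarrow> 'a tvec set" where
  "Dt_dist J F D2 L1 S p = D2 p + J (F p) ` L1 p + J (F p) ` S p"

text \<open>A subbundle \<open>E\<close> of the image of \<open>TM\<close>, as a distribution on the manifold \<open>M\<close> itself.\<close>

definition on_source ::
    "('p::topological_space, 'e::euclidean_space) chart set \<Rightarrow>
     ('a::topological_space, 'b::euclidean_space) chart set \<Rightarrow> ('p \<Rightarrow> 'a) \<Rightarrow>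
     ('p \<Rightarrow> 'a tvec set) \<Rightarrow> 'p \<Rightarrow> 'p tvec set" where
  "on_source A B F E p = {x \<in> tangent_space A p. push A B F x \<in> E p}"

end

theory Submission
  imports Defs
begin

text \<open>
  The pulled back connection is torsion-free and commutes with \<open>J\<close>, so for \<open>X, Y\<close> tangent to \<open>M\<close>
  the difference of the two sides of either condition is a component of \<open>J [X, Y]\<close>: the
  transversal one in (i), the tangential one in (ii).  Since \<open>D = {v \<in> TM. J v \<in> TM}\<close> and
  \<open>D\<^sub>t = {v \<in> TM. J v \<in> tr}\<close>, the conditions say that \<open>D\<close> and \<open>D\<^sub>t\<close> are involutive, and the
  Frobenius theorem turns this into integrability.
\<close>

section \<open>Calculus of \<open>C\<^sup>k\<close> functions\<close>

text \<open>The descriptions of \<open>D\<close> and \<open>Dt\<close> rest on two direct sums in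
  each fibre: \<open>TM\<close> is \<open>D\<close> plus \<open>Dt\<close>, and the ambient tangent
  space is \<open>TM\<close> plus \<open>tr\<close>. The second is not assumed; it follows from
  non-degeneracy of the two screens and from the duality of \<open>ltr\<close> with the radical. In
  (i), \<open>J X\<close> is again tangent to \<open>M\<close> for \<open>X\<close> in
  \<open>D\<close>, so symmetry of \<open>h\<close> gives access to \<open>h (J X, Y)\<close>; in
  (ii) no such symmetry enters, because \<open>A\<close> already differentiates \<open>J Z\<close>
  along \<open>V\<close>.

  The main obstacle is that \<open>nabF\<close> is given by axioms that fix it only on restrictions
  \<open>Y \<circ> F\<close> of ambient fields, while fields tangent to \<open>M\<close> are not of
  this form. Torsion-freeness and parallelism of \<open>J\<close> are therefore transported through
  local expansions in ambient coordinate fields. Vectors are derivations of global functions and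
  fields are global, so every local argument passes through cut-off functions.

  Frobenius is derived from a total differential equation instead of flows: the equation is solved
  along all rays at once by one contraction, and smoothness of the solution is read off from the
  equation itself.\<close>

lemma Ck_on_cong:
  assumes "open S" "\<And>x. x \<in> S \<Longrightarrow> f x = g x"
  shows "Ck_on k S f \<longleftrightarrow> Ck_on k S g"
  using assms(2)
proof (induction k arbitrary: f g)
  case 0
  then show ?case by (auto cong: continuous_on_cong)
next
  case (Suc k)
  have d: "(f has_derivative f') (at x) \<longleftrightarrow> (g has_derivative f') (at x)" if "x \<in> S" for x f'
    using has_derivative_transform_within_open[OF _ assms(1) that, of f f' UNIV g]
      has_derivative_transform_within_open[OF _ assms(1) that, of g f' UNIV f] Suc.prems by auto
  have "f differentiable (at x) \<longleftrightarrow> g differentiable (at x)" if "x \<in> S" for x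
    using d[OF that] by (auto simp: differentiable_def)
  moreover have "frechet_derivative f (at x) = frechet_derivative g (at x)" if "x \<in> S" for x
    using d[OF that] by (simp add: frechet_derivative_def)
  then have "Ck_on k S (\<lambda>x. frechet_derivative f (at x) u) =
      Ck_on k S (\<lambda>x. frechet_derivative g (at x) u)" for u
    by (intro Suc.IH) simp
  ultimately show ?case by simp
qed

lemma Ck_on_subset: "Ck_on k S f \<Longrightarrow> T \<subseteq> S \<Longrightarrow> Ck_on k T f"
  by (induction k arbitrary: f) (auto intro: continuous_on_subset)

text \<open>The recursion of \<open>Ck_on\<close> mentions the chosen
  \<open>frechet_derivative\<close>. Uniqueness of derivatives lets any explicit formula replace it,
  and in this form the inductions on \<open>k\<close> below are carried out.\<close>

lemma Ck_on_SucI: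
  assumes "open S" "\<And>x. x \<in> S \<Longrightarrow> (f has_derivative f' x) (at x)"
    "\<And>u. Ck_on k S (\<lambda>x. f' x u)"
  shows "Ck_on (Suc k) S f"
proof -
  have "Ck_on k S (\<lambda>x. frechet_derivative f (at x) u)" for u
    using assms Ck_on_cong[OF assms(1), of "\<lambda>x. frechet_derivative f (at x) u" "\<lambda>x. f' x u"]
      frechet_derivative_at by metis
  then show ?thesis using assms(2) by (auto simp: differentiable_def)
qed

lemma Ck_on_SucD: "Ck_on (Suc k) S f \<Longrightarrow> Ck_on k S f"
proof (induction k arbitrary: f)
  case 0
  then show ?case
    by (auto intro!: continuous_at_imp_continuous_on dest: differentiable_imp_continuous_within)
next
  case (Suc k)
  then show ?case by (metis Ck_on.simps(2))
qed

lemma Ck_on_has_derivative: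
  "Ck_on (Suc k) S f \<Longrightarrow> x \<in> S \<Longrightarrow> (f has_derivative frechet_derivative f (at x)) (at x)"
  by (simp flip: frechet_derivative_works)

text \<open>Continuity on an open set and differentiability are conditions at single points, so
  smoothness may be checked on neighbourhoods, which is how charts enter later.\<close>

lemma Ck_on_local:
  assumes "\<And>x. x \<in> S \<Longrightarrow> \<exists>T. open T \<and> x \<in> T \<and> Ck_on k T f"
  shows "Ck_on k S f"
  using assms
proof (induction k arbitrary: f)
  case 0
  then have "isCont f x" if "x \<in> S" for x
    using that by (metis Ck_on.simps(1) continuous_on_eq_continuous_at)
  then show ?case by (simp add: continuous_at_imp_continuous_on)
next
  case (Suc k)
  then show ?case by (simp; metis)
qed

lemma Ck_on_const: "open S \<Longrightarrow> Ck_on k S (\<lambda>_. c)"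
proof (induction k arbitrary: c)
  case (Suc k)
  then show ?case by (intro Ck_on_SucI[where f' = "\<lambda>_ _. 0"]) auto
qed simp

lemma Ck_on_bounded_linear:
  assumes L: "bounded_linear L" and S: "open S"
  shows "Ck_on k S f \<Longrightarrow> Ck_on k S (\<lambda>x. L (f x))"
proof (induction k arbitrary: f)
  case 0
  then show ?case by (simp add: bounded_linear.continuous_on[OF L])
next
  case (Suc k)
  show ?case
    by (rule Ck_on_SucI[OF S bounded_linear.has_derivative[OF L Ck_on_has_derivative[OF Suc.prems]]])
      (use Suc in auto)
qed

lemma Ck_on_linear: "bounded_linear L \<Longrightarrow> open S \<Longrightarrow> Ck_on k S L"
proof (induction k)
  case 0
  then show ?case by (simp add: linear_continuous_on)
next
  case (Suc k)
  show ?case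
    by (rule Ck_on_SucI[OF _ bounded_linear_imp_has_derivative]) (use Suc Ck_on_const in auto)
qed

lemma Ck_on_add:
  assumes "open S"
  shows "Ck_on k S f \<Longrightarrow> Ck_on k S g \<Longrightarrow> Ck_on k S (\<lambda>x. f x + g x)"
proof (induction k arbitrary: f g)
  case 0
  then show ?case by (simp add: continuous_on_add)
next
  case (Suc k)
  show ?case
    by (rule Ck_on_SucI[OF assms has_derivative_add[OF Ck_on_has_derivative[OF Suc.prems(1)]
            Ck_on_has_derivative[OF Suc.prems(2)]]]) (use Suc in auto)
qed

lemma Ck_on_sum:
  assumes "open S" "\<And>i. i \<in> I \<Longrightarrow> Ck_on k S (f i)"
  shows "Ck_on k S (\<lambda>x. \<Sum>i\<in>I. f i x)"
  using assms(2)
  by (induction I rule: infinite_finite_induct) (auto intro!: Ck_on_add Ck_on_const assms(1))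

lemma Ck_on_bilinear:
  assumes b: "bounded_bilinear b" and S: "open S"
  shows "Ck_on k S f \<Longrightarrow> Ck_on k S g \<Longrightarrow> Ck_on k S (\<lambda>x. b (f x) (g x))"
proof (induction k arbitrary: f g)
  case 0
  then show ?case by (simp add: bounded_bilinear.continuous_on[OF b])
next
  case (Suc k)
  show ?case
    by (rule Ck_on_SucI[OF S bounded_bilinear.FDERIV[OF b Ck_on_has_derivative[OF Suc.prems(1)]
            Ck_on_has_derivative[OF Suc.prems(2)]]], assumption, assumption)
      (intro Ck_on_add[OF S] Suc.IH Ck_on_SucD[OF Suc.prems(1)] Ck_on_SucD[OF Suc.prems(2)];
        use Suc.prems in auto)
qed

text \<open>\<open>Ck_on\<close> controls derivatives in a fixed direction only, but the chain rule
  yields \<open>?g' (f x)\<close> in the moving direction \<open>?f' x u\<close>. Expanding that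
  direction in \<open>Basis\<close> leaves a finite sum of products in which each factor falls under
  the induction hypothesis or an assumption.\<close>

lemma Ck_on_compose:
  fixes f :: "'a::euclidean_space \<Rightarrow> 'b::euclidean_space"
  assumes S: "open S" and T: "open T"
  shows "Ck_on k S f \<Longrightarrow> Ck_on k T g \<Longrightarrow> f ` S \<subseteq> T \<Longrightarrow> Ck_on k S (\<lambda>x. g (f x))"
proof (induction k arbitrary: f g)
  case 0
  then show ?case by (auto intro: continuous_on_compose2)
next
  case (Suc k)
  let ?f' = "\<lambda>x. frechet_derivative f (at x)" and ?g' = "\<lambda>y. frechet_derivative g (at y)"
  have "((\<lambda>x. g (f x)) has_derivative (\<lambda>u. \<Sum>b\<in>Basis. (?f' x u \<bullet> b) *\<^sub>R ?g' (f x) b)) (at x)"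
    if x: "x \<in> S" for x
  proof -
    have f: "(f has_derivative ?f' x) (at x)" by (rule Ck_on_has_derivative[OF Suc.prems(1) x])
    have g: "(g has_derivative ?g' (f x)) (at (f x))"
      by (rule Ck_on_has_derivative[OF Suc.prems(2)]) (use x Suc.prems(3) in auto)
    have lin: "linear (?g' (f x))" using g has_derivative_linear by blast
    have "?g' (f x) (?f' x u) = (\<Sum>b\<in>Basis. (?f' x u \<bullet> b) *\<^sub>R ?g' (f x) b)" for u
      using linear_sum[OF lin, of "\<lambda>b. (?f' x u \<bullet> b) *\<^sub>R b" Basis]
      by (simp add: euclidean_representation linear_cmul[OF lin])
    with has_derivative_compose[OF f g] show ?thesis by (simp add: o_def)
  qed
  then show ?case
  proof (rule Ck_on_SucI[OF S])
    fix u
    have "Ck_on k S (\<lambda>x. ?g' (f x) b)" for b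
      by (rule Suc.IH[OF Ck_on_SucD]) (use Suc.prems in auto)
    moreover have "Ck_on k S (\<lambda>x. ?f' x u)" using Suc.prems by simp
    then have "Ck_on k S (\<lambda>x. ?f' x u \<bullet> b)" for b
      by (rule Ck_on_bounded_linear[OF bounded_linear_inner_left S])
    ultimately show "Ck_on k S (\<lambda>x. \<Sum>b\<in>Basis. (?f' x u \<bullet> b) *\<^sub>R ?g' (f x) b)"
      by (intro Ck_on_sum[OF S] Ck_on_bilinear[OF bounded_bilinear_scaleR S])
  qed
qed

text \<open>The derivative is a polynomial in \<open>inverse x\<close>, so the claim for
  \<open>k\<close> yields the claim for \<open>Suc k\<close>.\<close>

lemma Ck_on_inverse: "Ck_on k (- {0}) (inverse :: real \<Rightarrow> real)"
proof (induction k)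
  case 0
  then show ?case by (auto intro!: continuous_intros)
next
  case (Suc k)
  have o: "open (- {0::real})" by auto
  show ?case
  proof (rule Ck_on_SucI[OF o])
    show "(inverse has_derivative (\<lambda>h. - (inverse x * h * inverse x))) (at x)" if "x \<in> - {0}" for x::real
      using that by (intro has_derivative_inverse') auto
    have "Ck_on k (- {0}) (\<lambda>x::real. inverse x * inverse x)"
      by (rule Ck_on_bilinear[OF bounded_bilinear_mult o Suc Suc])
    then have "Ck_on k (- {0}) (\<lambda>x. (inverse x * inverse x) * (- u))" for u :: real
      by (rule Ck_on_bounded_linear[OF bounded_linear_mult_left o])
    then show "Ck_on k (- {0}) (\<lambda>x. - (inverse x * u * inverse x))" for u :: real
      by (simp add: mult_ac)
  qed
qed

section \<open>Closure properties of smooth functions on open sets\<close>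

lemma smooth_on_cong:
  "open S \<Longrightarrow> (\<And>x. x \<in> S \<Longrightarrow> f x = g x) \<Longrightarrow> smooth_on S f \<longleftrightarrow> smooth_on S g"
  unfolding smooth_on_def using Ck_on_cong by blast

lemma smooth_on_subset: "smooth_on S f \<Longrightarrow> T \<subseteq> S \<Longrightarrow> smooth_on T f"
  unfolding smooth_on_def using Ck_on_subset by blast

lemma smooth_on_local:
  "(\<And>x. x \<in> S \<Longrightarrow> \<exists>T. open T \<and> x \<in> T \<and> smooth_on T f) \<Longrightarrow> smooth_on S f"
  unfolding smooth_on_def by (metis Ck_on_local)

lemma smooth_on_const: "open S \<Longrightarrow> smooth_on S (\<lambda>_. c)"
  unfolding smooth_on_def by (simp add: Ck_on_const)

lemma smooth_on_linear: "bounded_linear L \<Longrightarrow> open S \<Longrightarrow> smooth_on S L"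
  unfolding smooth_on_def by (simp add: Ck_on_linear)

lemma smooth_on_bounded_linear:
  "bounded_linear L \<Longrightarrow> open S \<Longrightarrow> smooth_on S f \<Longrightarrow> smooth_on S (\<lambda>x. L (f x))"
  unfolding smooth_on_def by (simp add: Ck_on_bounded_linear)

lemma smooth_on_id: "open S \<Longrightarrow> smooth_on S (\<lambda>x. x)"
  using smooth_on_linear[OF bounded_linear_ident] .

lemma smooth_on_add:
  "open S \<Longrightarrow> smooth_on S f \<Longrightarrow> smooth_on S g \<Longrightarrow> smooth_on S (\<lambda>x. f x + g x)"
  unfolding smooth_on_def by (simp add: Ck_on_add)

lemma smooth_on_sum:
  "open S \<Longrightarrow> (\<And>i. i \<in> I \<Longrightarrow> smooth_on S (f i)) \<Longrightarrow> smooth_on S (\<lambda>x. \<Sum>i\<in>I. f i x)"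
  unfolding smooth_on_def by (simp add: Ck_on_sum)

lemma smooth_on_bilinear:
  "bounded_bilinear b \<Longrightarrow> open S \<Longrightarrow> smooth_on S f \<Longrightarrow> smooth_on S g \<Longrightarrow>
    smooth_on S (\<lambda>x. b (f x) (g x))"
  unfolding smooth_on_def by (simp add: Ck_on_bilinear)

lemmas smooth_on_scaleR = smooth_on_bilinear[OF bounded_bilinear_scaleR]
lemmas smooth_on_mult = smooth_on_bilinear[OF bounded_bilinear_mult]
lemmas smooth_on_inner = smooth_on_bilinear[OF bounded_bilinear_inner]

lemma smooth_on_minus: "open S \<Longrightarrow> smooth_on S f \<Longrightarrow> smooth_on S (\<lambda>x. - f x)"
  using smooth_on_bounded_linear[OF bounded_linear_minus[OF bounded_linear_ident]] .

lemma smooth_on_diff: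
  "open S \<Longrightarrow> smooth_on S f \<Longrightarrow> smooth_on S g \<Longrightarrow> smooth_on S (\<lambda>x. f x - g x)"
  using smooth_on_add[of S f "\<lambda>x. - g x"] smooth_on_minus[of S g] by simp

lemma smooth_on_compose:
  fixes f :: "'a::euclidean_space \<Rightarrow> 'b::euclidean_space"
  shows "open S \<Longrightarrow> open T \<Longrightarrow> smooth_on S f \<Longrightarrow> smooth_on T g \<Longrightarrow> f ` S \<subseteq> T \<Longrightarrow>
    smooth_on S (\<lambda>x. g (f x))"
  unfolding smooth_on_def by (simp add: Ck_on_compose)

lemma smooth_on_continuous: "smooth_on S f \<Longrightarrow> continuous_on S f"
  unfolding smooth_on_def by (metis Ck_on.simps(1))

lemma smooth_on_has_derivative:
  "smooth_on S f \<Longrightarrow> x \<in> S \<Longrightarrow> (f has_derivative frechet_derivative f (at x)) (at x)"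
  unfolding smooth_on_def using Ck_on_has_derivative by blast

lemma smooth_on_derivative: "smooth_on S f \<Longrightarrow> smooth_on S (\<lambda>x. frechet_derivative f (at x) u)"
  unfolding smooth_on_def by (metis Ck_on.simps(2))

lemma smooth_on_componentwise:
  fixes f :: "'a::euclidean_space \<Rightarrow> 'b::euclidean_space"
  assumes "open S" "\<And>b. b \<in> Basis \<Longrightarrow> smooth_on S (\<lambda>x. f x \<bullet> b)"
  shows "smooth_on S f"
proof -
  have "smooth_on S (\<lambda>x. \<Sum>b\<in>Basis. (f x \<bullet> b) *\<^sub>R b)"
    by (intro smooth_on_sum smooth_on_scaleR smooth_on_const assms)
  then show ?thesis by (simp add: euclidean_representation)
qed

lemma smooth_on_inverse:
  fixes f :: "'a::euclidean_space \<Rightarrow> real"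
  assumes "open S" "smooth_on S f" "\<And>x. x \<in> S \<Longrightarrow> f x \<noteq> 0"
  shows "smooth_on S (\<lambda>x. inverse (f x))"
  by (rule smooth_on_compose[OF assms(1) _ assms(2), of "- {0}"])
    (use assms(3) Ck_on_inverse in \<open>auto simp: smooth_on_def\<close>)

lemma smooth_on_divide:
  fixes f :: "'a::euclidean_space \<Rightarrow> real"
  assumes "open S" "smooth_on S f" "smooth_on S g" "\<And>x. x \<in> S \<Longrightarrow> g x \<noteq> 0"
  shows "smooth_on S (\<lambda>x. f x / g x)"
  unfolding divide_inverse
  by (intro smooth_on_mult smooth_on_inverse assms)

text \<open>The factor \<open>1/x\<^sup>n\<close> makes the family closed under differentiation.\<close>

definition flat_exp :: "nat \<Rightarrow> real \<Rightarrow> real" where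
  "flat_exp n x = (if x \<le> 0 then 0 else exp (- inverse x) * inverse x ^ n)"

lemma exp_power_tendsto_0: "((\<lambda>x::real. exp (- inverse x) * inverse x ^ n) \<longlongrightarrow> 0) (at_right 0)"
proof -
  have "((\<lambda>y::real. y ^ n / exp y) \<longlongrightarrow> 0) at_top"
    by (rule tendsto_power_div_exp_0)
  then have "((\<lambda>x::real. (inverse x) ^ n / exp (inverse x)) \<longlongrightarrow> 0) (at_right 0)"
    by (rule filterlim_compose[OF _ filterlim_inverse_at_top_right])
  then show ?thesis by (simp add: exp_minus divide_inverse mult.commute)
qed

text \<open>For \<open>x > 0\<close> this is the product rule applied to \<open>exp (-1/x)\<close>
  times a power of \<open>1/x\<close>. The delicate point is 0, where every member of the family
  must have derivative 0.\<close>

lemma flat_exp_has_derivative: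
  "(flat_exp n has_real_derivative (flat_exp (n+2) x - n * flat_exp (n+1) x)) (at x)"
proof -
  consider "x < 0" | "x > 0" | "x = 0" by linarith
  then show ?thesis
  proof cases
    case 1
    have "((\<lambda>_. 0) has_real_derivative 0) (at x)" by simp
    then have "(flat_exp n has_real_derivative 0) (at x)"
      by (rule has_field_derivative_transform_within_open[where S = "{..<0}"])
        (use 1 in \<open>auto simp: flat_exp_def\<close>)
    then show ?thesis using 1 by (simp add: flat_exp_def)
  next
    case 2
    let ?y = "inverse x"
    have "((\<lambda>x. exp (- inverse x) * inverse x ^ n) has_real_derivative
        (exp (- ?y) * (?y * ?y) * ?y ^ n + exp (- ?y) * (n * ?y ^ (n - 1) * - (?y * ?y)))) (at x)"
      using 2 by (auto intro!: derivative_eq_intros)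
    \<comment> \<open>The factor \<open>n\<close> absorbs the truncated exponent
      \<open>n - 1\<close> in the case \<open>n = 0\<close>.\<close>
    moreover have n: "n * ?y ^ (n - 1) * (?y * ?y) = n * ?y ^ (n + 1)"
      by (cases n) (auto simp: power_add)
    have "exp (- ?y) * (?y * ?y) * ?y ^ n + exp (- ?y) * (n * ?y ^ (n - 1) * - (?y * ?y)) =
        exp (- ?y) * ?y ^ (n + 2) - n * (exp (- ?y) * ?y ^ (n + 1))"
    proof -
      have "exp (- ?y) * (n * ?y ^ (n - 1) * - (?y * ?y)) = - exp (- ?y) * (n * ?y ^ (n - 1) * (?y * ?y))"
        by (simp only: mult_minus_left mult_minus_right)
      also note n
      finally show ?thesis
        by (simp only: power_add power2_eq_square power_one_right algebra_simps)
    qed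
    ultimately have "((\<lambda>x. exp (- inverse x) * inverse x ^ n) has_real_derivative
        (exp (- ?y) * ?y ^ (n + 2) - n * (exp (- ?y) * ?y ^ (n + 1)))) (at x)"
      by (simp only:)
    then have "(flat_exp n has_real_derivative
        (exp (- ?y) * ?y ^ (n + 2) - n * (exp (- ?y) * ?y ^ (n + 1)))) (at x)"
      by (rule has_field_derivative_transform_within_open[where S = "{0<..}"])
        (use 2 in \<open>auto simp: flat_exp_def\<close>)
    then show ?thesis using 2 by (simp add: flat_exp_def)
  next
    case 3
    \<comment> \<open>The difference quotient from the right at 0 is the family member with index
      \<open>n + 1\<close>, so the same limit settles it.\<close>
    have r: "((\<lambda>h. flat_exp n h / h) \<longlongrightarrow> 0) (at_right 0)"
    proof (rule Lim_transform_eventually[OF exp_power_tendsto_0[of "n+1"]])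
      show "\<forall>\<^sub>F h in at_right 0. exp (- inverse h) * inverse h ^ (n + 1) = flat_exp n h / h"
        using eventually_at_right_less[of 0]
        by eventually_elim (simp add: flat_exp_def mult_ac divide_inverse)
    qed
    have l: "((\<lambda>h. flat_exp n h / h) \<longlongrightarrow> 0) (at_left 0)"
    proof (rule Lim_transform_eventually[OF tendsto_const])
      show "\<forall>\<^sub>F h in at_left 0. 0 = flat_exp n h / h"
        by (auto simp: eventually_at_filter flat_exp_def)
    qed
    have "((\<lambda>h. (flat_exp n (0 + h) - flat_exp n 0) / h) \<longlongrightarrow> 0) (at 0)"
      using filterlim_split_at[OF l r] by (simp add: flat_exp_def)
    then have "(flat_exp n has_real_derivative 0) (at 0)"
      by (simp add: DERIV_def)
    then show ?thesis using 3 by (simp add: flat_exp_def)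
  qed
qed

lemma smooth_on_flat_exp: "smooth_on UNIV (flat_exp n)"
  unfolding smooth_on_def
proof
  show "Ck_on k UNIV (flat_exp n)" for k
  proof (induction k arbitrary: n)
    case 0
    have "isCont (flat_exp n) x" for x
      using flat_exp_has_derivative by (rule DERIV_isCont)
    then show ?case by (auto intro!: continuous_at_imp_continuous_on)
  next
    case (Suc k)
    show ?case
    proof (rule Ck_on_SucI[OF open_UNIV])
      show "(flat_exp n has_derivative (*) (flat_exp (n+2) x - n * flat_exp (n+1) x)) (at x)" for x
        using flat_exp_has_derivative unfolding has_field_derivative_def .
      have "Ck_on k UNIV (\<lambda>x. flat_exp (n+2) x + (- real n) * flat_exp (n+1) x)"
        by (intro Ck_on_add Ck_on_bounded_linear[OF bounded_linear_mult_right] Suc open_UNIV)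
      then have "Ck_on k UNIV (\<lambda>x. (flat_exp (n+2) x + (- real n) * flat_exp (n+1) x) * u)" for u
        by (rule Ck_on_bounded_linear[OF bounded_linear_mult_left open_UNIV])
      then show "Ck_on k UNIV (\<lambda>x. (flat_exp (n+2) x - n * flat_exp (n+1) x) * u)" for u
        by simp
    qed
  qed
qed

text \<open>The quotient \<open>a / (a + b)\<close>: \<open>a\<close> vanishes outside radius
  \<open>2 * e\<close>, \<open>b\<close> inside radius \<open>e\<close>, and they never vanish
  together. The squared distance \<open>s\<close> is used because the distance itself is not smooth
  at \<open>x0\<close>.\<close>

lemma smooth_bump:
  fixes x0 :: "'a::euclidean_space"
  assumes "0 < e"
  obtains \<rho> :: "'a \<Rightarrow> real" where "smooth_on UNIV \<rho>" "\<And>x. dist x0 x < e \<Longrightarrow> \<rho> x = 1"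
    "\<And>x. dist x0 x \<ge> 2 * e \<Longrightarrow> \<rho> x = 0"
proof -
  define s where "s x = (x - x0) \<bullet> (x - x0)" for x
  define a where "a x = flat_exp 0 (4 * e\<^sup>2 - s x)" for x
  define b where "b x = flat_exp 0 (s x - e\<^sup>2)" for x
  have s: "smooth_on UNIV s"
    unfolding s_def by (intro smooth_on_inner smooth_on_diff smooth_on_const smooth_on_id open_UNIV)
  have a: "smooth_on UNIV a" unfolding a_def
    by (rule smooth_on_compose[OF _ _ _ smooth_on_flat_exp])
      (auto intro!: smooth_on_diff smooth_on_const s)
  have b: "smooth_on UNIV b" unfolding b_def
    by (rule smooth_on_compose[OF _ _ _ smooth_on_flat_exp])
      (auto intro!: smooth_on_diff smooth_on_const s)
  have s_eq: "s x = (dist x0 x)\<^sup>2" for x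
    unfolding s_def dist_norm norm_minus_commute[of x0 x] by (simp add: power2_norm_eq_inner)
  have ab: "a x + b x \<noteq> 0" for x
  proof -
    have "a x \<ge> 0" "b x \<ge> 0" by (auto simp: a_def b_def flat_exp_def)
    moreover have "s x < 4 * e\<^sup>2 \<or> s x > e\<^sup>2" using assms by (smt (verit) zero_less_power2)
    then have "a x > 0 \<or> b x > 0" by (auto simp: a_def b_def flat_exp_def)
    ultimately show ?thesis by linarith
  qed
  show thesis
  proof
    show "smooth_on UNIV (\<lambda>x. a x / (a x + b x))"
      by (rule smooth_on_divide) (auto intro: a b smooth_on_add simp: ab)
    show "a x / (a x + b x) = 1" if "dist x0 x < e" for x
    proof -
      have "s x < e\<^sup>2" using that assms by (simp add: s_eq power_strict_mono)
      then have "b x = 0" by (simp add: b_def flat_exp_def)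
      then show ?thesis using ab[of x] by simp
    qed
    show "a x / (a x + b x) = 0" if "dist x0 x \<ge> 2 * e" for x
    proof -
      have "s x \<ge> (2 * e)\<^sup>2" unfolding s_eq using that assms by (intro power_mono) auto
      then show ?thesis by (simp add: a_def flat_exp_def power2_eq_square)
    qed
  qed
qed

section \<open>Derivatives as bounded operators, and integrals depending on a parameter\<close>

text \<open>In finite dimension, continuity of all directional derivatives is continuity in operator
  norm. Differentiation under the integral and the mean value estimates need this operator-valued
  form.\<close>

lemma Ck_on_blinfun_derivative:
  fixes f :: "'a::euclidean_space \<Rightarrow> 'b::real_normed_vector"
  assumes "Ck_on (Suc k) S f"
  obtains D where "\<And>x. x \<in> S \<Longrightarrow> (f has_derivative blinfun_apply (D x)) (at x)"
    "\<And>x. x \<in> S \<Longrightarrow> blinfun_apply (D x) = frechet_derivative f (at x)" "continuous_on S D"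
proof -
  define D where "D x = Blinfun (frechet_derivative f (at x))" for x
  have D: "blinfun_apply (D x) = frechet_derivative f (at x)" if "x \<in> S" for x
    unfolding D_def using Ck_on_has_derivative[OF assms that]
    by (simp add: bounded_linear_Blinfun_apply has_derivative_bounded_linear)
  have "Ck_on k S (\<lambda>x. frechet_derivative f (at x) u)" for u using assms by simp
  then have "Ck_on 0 S (\<lambda>x. frechet_derivative f (at x) u)" for u
    by (induction k) (auto intro: Ck_on_SucD simp del: Ck_on.simps)
  then have "continuous_on S (\<lambda>x. blinfun_apply (D x) u)" for u
    using continuous_on_cong[OF refl, of S] D by (metis (no_types, lifting) Ck_on.simps(1))
  then have "continuous_on S D" by (rule continuous_on_blinfun_componentwise)
  with that D Ck_on_has_derivative[OF assms] show thesis by metis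
qed

text \<open>Differentiating under the integral brings out a factor \<open>t\<close> by the chain
  rule. The weight \<open>w\<close> is carried along so that the derivative is an integral of the
  same shape, with weight \<open>w t * t\<close>, and the induction closes.\<close>

lemma Ck_on_integral:
  fixes h :: "'a::euclidean_space \<Rightarrow> 'b::euclidean_space"
  assumes S: "open S" "convex S" "x0 \<in> S"
  shows "Ck_on k S h \<Longrightarrow> continuous_on {0..1} w \<Longrightarrow>
    Ck_on k S (\<lambda>x. integral {0..1::real} (\<lambda>t. w t *\<^sub>R h (x0 + t *\<^sub>R (x - x0))))"
proof (induction k arbitrary: h w)
  case 0
  have seg: "x0 + t *\<^sub>R (x - x0) \<in> S" if "x \<in> S" "t \<in> {0..1}" for x t
    using convexD_alt[OF S(2,3) that(1), of t] that(2) by (simp add: algebra_simps)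
  have "continuous_on (S \<times> cbox 0 1) (\<lambda>(x, t). w t *\<^sub>R h (x0 + t *\<^sub>R (x - x0)))"
    using 0 seg unfolding split_beta
    by (auto intro!: continuous_intros intro: continuous_on_compose2)
  from integral_continuous_on_param[OF this] show ?case by simp
next
  case (Suc k)
  have seg: "x0 + t *\<^sub>R (x - x0) \<in> S" if "x \<in> S" "t \<in> {0..1}" for x t
    using convexD_alt[OF S(2,3) that(1), of t] that(2) by (simp add: algebra_simps)
  have conth: "continuous_on S h"
    using Suc.prems(1) by (auto intro!: continuous_at_imp_continuous_on dest: differentiable_imp_continuous_within)
  obtain D where D: "\<And>x. x \<in> S \<Longrightarrow> (h has_derivative blinfun_apply (D x)) (at x)"
    "\<And>x. x \<in> S \<Longrightarrow> blinfun_apply (D x) = frechet_derivative h (at x)" "continuous_on S D"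
    using Ck_on_blinfun_derivative[OF Suc.prems(1)] by blast
  let ?f = "\<lambda>x t. w t *\<^sub>R h (x0 + t *\<^sub>R (x - x0))"
  let ?F = "\<lambda>x t. (w t * t) *\<^sub>R D (x0 + t *\<^sub>R (x - x0))"
  have contF: "continuous_on (S \<times> cbox 0 1) (\<lambda>(x, t). ?F x t)"
    using Suc.prems(2) D(3) seg unfolding split_beta
    by (auto intro!: continuous_intros intro: continuous_on_compose2)
  have d: "((\<lambda>x. integral (cbox 0 1) (?f x)) has_derivative
      blinfun_apply (integral (cbox 0 1) (?F x))) (at x within S)" if x: "x \<in> S" for x
  proof (rule leibniz_rule[OF _ _ contF x S(2)])
    fix x t assume xt: "x \<in> S" "t \<in> cbox (0::real) 1"
    have "(h has_derivative blinfun_apply (D (x0 + t *\<^sub>R (x - x0)))) (at (x0 + t *\<^sub>R (x - x0)))"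
      using D(1) seg xt by simp
    moreover have "((\<lambda>x. x0 + t *\<^sub>R (x - x0)) has_derivative (\<lambda>u. t *\<^sub>R u)) (at x within S)"
      by (auto intro!: derivative_eq_intros)
    ultimately have "((\<lambda>x. h (x0 + t *\<^sub>R (x - x0))) has_derivative
        (\<lambda>u. D (x0 + t *\<^sub>R (x - x0)) (t *\<^sub>R u))) (at x within S)"
      by (rule has_derivative_compose[rotated])
    from has_derivative_scaleR_right[OF this, of "w t"] show "((\<lambda>x. ?f x t) has_derivative blinfun_apply (?F x t)) (at x within S)"
      by (simp add: blinfun.scaleR_right scaleR_blinfun.rep_eq)
  next
    fix x assume "x \<in> S"
    then show "?f x integrable_on cbox 0 1"
      using Suc.prems(2) conth seg
      by (intro integrable_continuous) (auto intro!: continuous_intros intro: continuous_on_compose2)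
  qed
  show ?case
  proof (rule Ck_on_SucI[OF S(1)])
    show "((\<lambda>x. integral {0..1} (?f x)) has_derivative blinfun_apply (integral (cbox 0 1) (?F x))) (at x)"
      if "x \<in> S" for x
      using d[OF that] unfolding at_within_open[OF that S(1)] by (simp only: cbox_interval)
    fix u
    have "blinfun_apply (integral (cbox 0 1) (?F x)) u =
        integral {0..1} (\<lambda>t. (w t * t) *\<^sub>R frechet_derivative h (at (x0 + t *\<^sub>R (x - x0))) u)"
      if x: "x \<in> S" for x
    proof -
      have "continuous_on (cbox 0 1) (\<lambda>t. (case (x, t) of (x, t) \<Rightarrow> ?F x t))"
        by (rule continuous_on_compose2[OF contF]) (use x in \<open>auto intro!: continuous_intros\<close>)
      then have "continuous_on (cbox 0 1) (?F x)" by simp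
      then have "blinfun_apply (integral (cbox 0 1) (?F x)) u = integral (cbox 0 1) (\<lambda>t. ?F x t u)"
        by (intro blinfun_apply_integral integrable_continuous)
      also have "\<dots> = integral {0..1}
          (\<lambda>t. (w t * t) *\<^sub>R frechet_derivative h (at (x0 + t *\<^sub>R (x - x0))) u)"
        unfolding cbox_interval
        using D(2) seg x by (intro integral_cong) (auto simp: blinfun.scaleR_left)
      finally show ?thesis .
    qed
    moreover have "Ck_on k S (\<lambda>x. integral {0..1}
        (\<lambda>t. (w t * t) *\<^sub>R frechet_derivative h (at (x0 + t *\<^sub>R (x - x0))) u))"
      using Suc.prems by (intro Suc.IH continuous_on_mult continuous_on_id) auto
    ultimately show "Ck_on k S (\<lambda>x. blinfun_apply (integral (cbox 0 1) (?F x)) u)"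
      by (subst Ck_on_cong[OF S(1)])
  qed
qed

text \<open>Hadamard's lemma: \<open>g b\<close> is the mean of the partial derivative along the segment from \<open>x0\<close>.\<close>

lemma smooth_on_Hadamard:
  fixes f :: "'a::euclidean_space \<Rightarrow> real"
  assumes S: "open S" "convex S" "x0 \<in> S" and f: "smooth_on S f"
  obtains g where "\<And>b. smooth_on S (g b)" "\<And>b. g b x0 = frechet_derivative f (at x0) b"
    "\<And>x. x \<in> S \<Longrightarrow> f x = f x0 + (\<Sum>b\<in>Basis. ((x - x0) \<bullet> b) * g b x)"
proof -
  let ?f' = "\<lambda>x. frechet_derivative f (at x)"
  define g where "g b x = integral {0..1::real} (\<lambda>t. ?f' (x0 + t *\<^sub>R (x - x0)) b)" for b x
  show thesis
  proof
    show "smooth_on S (g b)" for b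
      using Ck_on_integral[OF S, of _ "\<lambda>x. ?f' x b" "\<lambda>_. 1"] smooth_on_derivative[OF f]
      unfolding smooth_on_def g_def by (auto intro: continuous_intros)
    show "g b x0 = ?f' x0 b" for b by (simp add: g_def)
    fix x assume x: "x \<in> S"
    have seg: "x0 + t *\<^sub>R (x - x0) \<in> S" if "t \<in> {0..1}" for t
      using convexD_alt[OF S(2,3) x, of t] that by (simp add: algebra_simps)
    have d: "(f has_derivative ?f' y) (at y)" if "y \<in> S" for y
      using f that by (rule smooth_on_has_derivative)
    have "((\<lambda>t. f (x0 + t *\<^sub>R (x - x0))) has_vector_derivative ?f' (x0 + t *\<^sub>R (x - x0)) (x - x0))
        (at t within {0..1})" if "t \<in> {0..1}" for t
    proof -
      have "((\<lambda>t. x0 + t *\<^sub>R (x - x0)) has_derivative (\<lambda>s. s *\<^sub>R (x - x0))) (at t within {0..1})"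
        by (auto intro!: derivative_eq_intros)
      from has_derivative_compose[OF this d[OF seg[OF that]]] show ?thesis
        using linear_cmul[OF has_derivative_linear[OF d[OF seg[OF that]]]]
        by (simp add: has_vector_derivative_def)
    qed
    from fundamental_theorem_of_calculus[OF _ this]
    have "((\<lambda>t. ?f' (x0 + t *\<^sub>R (x - x0)) (x - x0)) has_integral f x - f x0) {0..1}" by simp
    then have "f x - f x0 = integral {0..1} (\<lambda>t. ?f' (x0 + t *\<^sub>R (x - x0)) (x - x0))"
      by (simp add: integral_unique)
    also have "\<dots> = integral {0..1} (\<lambda>t. \<Sum>b\<in>Basis. ((x - x0) \<bullet> b) * ?f' (x0 + t *\<^sub>R (x - x0)) b)"
    proof (rule integral_cong)
      fix t :: real assume "t \<in> {0..1}"
      then have lin: "linear (?f' (x0 + t *\<^sub>R (x - x0)))"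
        using d seg has_derivative_linear by blast
      show "?f' (x0 + t *\<^sub>R (x - x0)) (x - x0) =
          (\<Sum>b\<in>Basis. ((x - x0) \<bullet> b) * ?f' (x0 + t *\<^sub>R (x - x0)) b)"
        using linear_sum[OF lin, of "\<lambda>b. ((x - x0) \<bullet> b) *\<^sub>R b" Basis]
        by (simp add: euclidean_representation linear_cmul[OF lin])
    qed
    also have "\<dots> = (\<Sum>b\<in>Basis. integral {0..1} (\<lambda>t. ((x - x0) \<bullet> b) * ?f' (x0 + t *\<^sub>R (x - x0)) b))"
    proof (rule integral_sum)
      fix b :: 'a
      have "continuous_on {0..1} (\<lambda>t. ?f' (x0 + t *\<^sub>R (x - x0)) b)"
        by (rule continuous_on_compose2[OF smooth_on_continuous[OF smooth_on_derivative[OF f]]])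
          (use seg in \<open>auto intro!: continuous_intros\<close>)
      then show "(\<lambda>t. ((x - x0) \<bullet> b) * ?f' (x0 + t *\<^sub>R (x - x0)) b) integrable_on {0..1}"
        by (intro integrable_continuous_real continuous_intros)
    qed simp
    finally show "f x = f x0 + (\<Sum>b\<in>Basis. ((x - x0) \<bullet> b) * g b x)"
      by (simp add: g_def)
  qed
qed

section \<open>Total differential equations\<close>

text \<open>The fixed point equation is the integrated form of \<open>dy = A (x, y) dx\<close> along
  the ray from 0 to \<open>x\<close>. Treating all rays as one contraction gives continuity in
  \<open>x\<close> at once. \<open>\<delta> * M \<le> \<eta> / 2\<close> bounds the values and
  \<open>\<delta> * L \<le> 1 / 2\<close> gives the contraction factor; stopping at half of
  \<open>\<eta>\<close> leaves room for a comparison curve later.\<close>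

lemma picard_fixed_point:
  fixes A :: "'e::euclidean_space \<times> 'f::euclidean_space \<Rightarrow> ('e \<Rightarrow>\<^sub>L 'f)"
  assumes cont: "continuous_on (cball 0 \<eta> \<times> cball 0 \<eta>) A"
    and M: "\<And>p. p \<in> cball 0 \<eta> \<times> cball 0 \<eta> \<Longrightarrow> norm (A p) \<le> M"
    and L: "\<And>p q. p \<in> cball 0 \<eta> \<times> cball 0 \<eta> \<Longrightarrow> q \<in> cball 0 \<eta> \<times> cball 0 \<eta> \<Longrightarrow>
        norm (A p - A q) \<le> L * norm (p - q)"
    and pos: "0 < \<delta>" "\<delta> \<le> \<eta>" "0 \<le> L" "\<delta> * M \<le> \<eta> / 2" "\<delta> * L \<le> 1 / 2"
  obtains y where "continuous_on UNIV y" "\<And>x. norm (y x) \<le> \<eta> / 2"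
    "\<And>x. x \<in> cball 0 \<delta> \<Longrightarrow> y x = integral {0..1} (\<lambda>t. A (t *\<^sub>R x, y (t *\<^sub>R x)) x)"
proof -
  \<comment> \<open>Bounded continuous functions live on the whole type, so the argument is first
    retracted onto the ball of radius \<open>\<delta>\<close>. Inside that ball \<open>c\<close> is
    the identity and the retraction disappears.\<close>
  define c where "c = closest_point (cball (0::'e) \<delta>)"
  define B where "B = cball (0::'f) \<eta>"
  define \<Phi> where "\<Phi> y x = integral (cbox 0 1) (\<lambda>t. A (t *\<^sub>R c x, y (t *\<^sub>R c x)) (c x))" for y :: "'e \<Rightarrow> 'f" and x
  have cin: "norm (c x) \<le> \<delta>" for x
    using closest_point_in_set[of "cball (0::'e) \<delta>" x] pos by (auto simp: c_def)
  have cc: "continuous_on T c" for T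
    unfolding c_def using pos by (intro continuous_on_closest_point) auto
  have tc: "norm (t *\<^sub>R c x) \<le> \<delta>" if "t \<in> {0..1}" for t x
    using cin[of x] that mult_mono[of t 1 "norm (c x)" \<delta>] by auto
  have Bin: "(t *\<^sub>R c x, y (t *\<^sub>R c x)) \<in> cball 0 \<eta> \<times> cball 0 \<eta>"
    if "y \<in> UNIV \<rightarrow> B" "t \<in> {0..1}" for t x and y :: "'e \<Rightarrow> 'f"
    using tc[OF that(2), of x] that(1) pos(2) by (auto simp: B_def)
  have contI: "continuous_on (UNIV \<times> cbox 0 1) (\<lambda>(x, t). A (t *\<^sub>R c x, y (t *\<^sub>R c x)) (c x))"
    if "continuous_on UNIV y" "y \<in> UNIV \<rightarrow> B" for y
  proof -
    have cp: "continuous_on (UNIV \<times> cbox 0 1) (\<lambda>p::'e \<times> real. c (fst p))"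
      by (rule continuous_on_compose2[OF cc[of UNIV] continuous_on_fst[OF continuous_on_id] subset_UNIV])
    have "continuous_on (UNIV \<times> cbox 0 1) (\<lambda>p::'e \<times> real. y (snd p *\<^sub>R c (fst p)))"
      by (rule continuous_on_compose2[OF that(1)]) (intro continuous_intros cp, simp)
    then have "continuous_on (UNIV \<times> cbox 0 1)
        (\<lambda>p::'e \<times> real. A (snd p *\<^sub>R c (fst p), y (snd p *\<^sub>R c (fst p))))"
      by (intro continuous_on_compose2[OF cont] continuous_intros cp) (use Bin[OF that(2)] in auto)
    then show ?thesis unfolding split_beta by (intro continuous_intros cp)
  qed
  have contt: "continuous_on (cbox 0 1) (\<lambda>t. A (t *\<^sub>R c x, y (t *\<^sub>R c x)) (c x))"
    if "continuous_on UNIV y" "y \<in> UNIV \<rightarrow> B" for y x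
  proof -
    have "continuous_on (cbox 0 1) (\<lambda>t. case (x, t) of (x, t) \<Rightarrow> A (t *\<^sub>R c x, y (t *\<^sub>R c x)) (c x))"
      by (rule continuous_on_compose2[OF contI[OF that]]) (auto intro!: continuous_intros)
    then show ?thesis by simp
  qed
  have bd: "norm (\<Phi> y x) \<le> \<eta> / 2" if y: "continuous_on UNIV y" "y \<in> UNIV \<rightarrow> B" for y x
  proof -
    have "norm (A (t *\<^sub>R c x, y (t *\<^sub>R c x)) (c x)) \<le> \<delta> * M" if t: "t \<in> cbox 0 1" for t
    proof -
      have "norm (A (t *\<^sub>R c x, y (t *\<^sub>R c x)) (c x)) \<le> norm (A (t *\<^sub>R c x, y (t *\<^sub>R c x))) * norm (c x)"
        by (rule norm_blinfun)
      also have "\<dots> \<le> M * \<delta>"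
      proof (rule mult_mono)
        show M1: "norm (A (t *\<^sub>R c x, y (t *\<^sub>R c x))) \<le> M" using t y by (intro M Bin) auto
        show "0 \<le> M" using M1 norm_ge_zero order_trans by blast
      qed (use cin in auto)
      finally show ?thesis by (simp add: mult.commute)
    qed
    then have "norm (\<Phi> y x) \<le> (\<delta> * M) * (1 - 0)"
      unfolding \<Phi>_def cbox_interval
      by (intro integral_bound contt[OF y, unfolded cbox_interval]) auto
    then show ?thesis using pos(4) by simp
  qed
  have eta: "\<eta> / 2 \<le> \<eta>" "0 < \<eta>" using pos by auto
  have cPhi: "\<Phi> y \<in> bcontfun" if "continuous_on UNIV y" "y \<in> UNIV \<rightarrow> B" for y
    by (rule bcontfun_normI[of _ "\<eta> / 2"])
      (use integral_continuous_on_param[OF contI[OF that]] bd[OF that] in \<open>auto simp: \<Phi>_def[abs_def]\<close>)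
  \<comment> \<open>The complete space for the contraction: bounded continuous functions with values
    in the closed ball \<open>B\<close>.\<close>
  define S where "S = PiC (UNIV :: 'e set) (\<lambda>_. B)"
  define F where "F y = Bcontfun (\<Phi> (apply_bcontfun y))" for y
  have FS: "apply_bcontfun (F y) = \<Phi> (apply_bcontfun y)" if "y \<in> S" for y
    unfolding F_def using cPhi mem_PiCD[OF that[unfolded S_def]]
    by (intro Bcontfun_inverse) auto
  have "\<exists>!y\<in>S. F y = y"
  proof (rule Banach_fix[of S "1/2"])
    show "complete S"
      unfolding S_def complete_eq_closed B_def by (rule closed_PiC) auto
    have "const_bcontfun 0 \<in> S" using eta by (auto simp: S_def mem_PiC_iff B_def)
    then show "S \<noteq> {}" by auto
    show "F ` S \<subseteq> S"
    proof safe
      fix y assume y: "y \<in> S"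
      have "\<Phi> y x \<in> B" for x
        using bd[of y x] mem_PiCD[OF y[unfolded S_def]] eta unfolding B_def by auto
      then show "F y \<in> S" unfolding S_def mem_PiC_iff FS[OF y] by auto
    qed
    fix y1 y2 assume y: "y1 \<in> S" "y2 \<in> S"
    have y': "apply_bcontfun y1 \<in> UNIV \<rightarrow> B" "apply_bcontfun y2 \<in> UNIV \<rightarrow> B"
      using y mem_PiCD unfolding S_def by auto
    have "dist (\<Phi> y1 x) (\<Phi> y2 x) \<le> 1/2 * dist y1 y2" for x
    proof -
      have "\<Phi> y1 x - \<Phi> y2 x = integral (cbox 0 1)
          (\<lambda>t. A (t *\<^sub>R c x, y1 (t *\<^sub>R c x)) (c x) - A (t *\<^sub>R c x, y2 (t *\<^sub>R c x)) (c x))"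
        unfolding \<Phi>_def using y'
        by (intro integral_diff[symmetric] integrable_continuous contt) auto
      moreover have "norm (integral (cbox 0 1)
          (\<lambda>t. A (t *\<^sub>R c x, y1 (t *\<^sub>R c x)) (c x) - A (t *\<^sub>R c x, y2 (t *\<^sub>R c x)) (c x)))
          \<le> (1/2 * dist y1 y2) * (1 - 0)"
        unfolding cbox_interval
      proof (rule integral_bound)
        show "continuous_on {0..1} (\<lambda>t. A (t *\<^sub>R c x, y1 (t *\<^sub>R c x)) (c x) - A (t *\<^sub>R c x, y2 (t *\<^sub>R c x)) (c x))"
          using y' by (intro continuous_intros contt[unfolded cbox_interval]) auto
        fix t :: real assume t: "t \<in> {0..1}"
        let ?p = "(t *\<^sub>R c x, y1 (t *\<^sub>R c x))" and ?q = "(t *\<^sub>R c x, y2 (t *\<^sub>R c x))"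
        have "norm (A ?p (c x) - A ?q (c x)) = norm ((A ?p - A ?q) (c x))"
          by (simp add: blinfun.diff_left)
        also have "\<dots> \<le> norm (A ?p - A ?q) * norm (c x)" by (rule norm_blinfun)
        also have "\<dots> \<le> (L * norm (?p - ?q)) * \<delta>"
          using cin pos(3) by (intro mult_mono L Bin y' t) auto
        also have "norm (?p - ?q) = dist (y1 (t *\<^sub>R c x)) (y2 (t *\<^sub>R c x))"
          by (simp add: dist_norm)
        also have "L * dist (y1 (t *\<^sub>R c x)) (y2 (t *\<^sub>R c x)) * \<delta> \<le> L * dist y1 y2 * \<delta>"
          using pos by (intro mult_right_mono mult_left_mono dist_bounded) auto
        also have "\<dots> = (\<delta> * L) * dist y1 y2" by simp
        also have "\<dots> \<le> 1/2 * dist y1 y2" using pos(5) by (intro mult_right_mono) auto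
        finally show "norm (A ?p (c x) - A ?q (c x)) \<le> 1/2 * dist y1 y2" .
      qed simp
      ultimately show ?thesis by (simp add: dist_norm)
    qed
    then show "dist (F y1) (F y2) \<le> 1/2 * dist y1 y2"
      by (intro dist_bound) (simp add: FS y)
  qed auto
  then obtain y where y: "y \<in> S" "F y = y" by auto
  have y': "apply_bcontfun y \<in> UNIV \<rightarrow> B" using y mem_PiCD unfolding S_def by auto
  have y_eq: "apply_bcontfun y = \<Phi> y" using FS[OF y(1)] y(2) by simp
  show thesis
  proof (rule that[of "apply_bcontfun y"])
    show "norm (y x) \<le> \<eta> / 2" for x using bd[of y x] y' y_eq by simp
    show "y x = integral {0..1} (\<lambda>t. A (t *\<^sub>R x, y (t *\<^sub>R x)) x)" if "x \<in> cball 0 \<delta>" for x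
    proof -
      have "c x = x" unfolding c_def using that by (rule closest_point_self)
      then have "\<Phi> y x = integral {0..1} (\<lambda>t. A (t *\<^sub>R x, y (t *\<^sub>R x)) x)"
        by (simp add: \<Phi>_def)
      then show ?thesis using fun_cong[OF y_eq, of x] by (rule trans[rotated])
    qed
  qed simp
qed

text \<open>Substituting \<open>t * s\<close> turns the integral into that of \<open>g\<close> over
  \<open>{0..s}\<close>. The substitution is done by the fundamental theorem applied to
  \<open>t \<mapsto> \<Phi> (t * s)\<close>, which involves no division and so includes
  \<open>s = 0\<close>.\<close>

lemma integral_ray_has_vector_derivative:
  fixes g :: "real \<Rightarrow> 'b::euclidean_space"
  assumes g: "continuous_on {0..1} g"
    and z: "\<And>s. s \<in> {0..1} \<Longrightarrow> z s = integral {0..1} (\<lambda>t. s *\<^sub>R g (t * s))"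
    and s: "s \<in> {0..1}"
  shows "(z has_vector_derivative g s) (at s within {0..1})"
proof -
  define \<Phi> where "\<Phi> s = integral {0..s} g" for s
  have d\<Phi>: "(\<Phi> has_vector_derivative g s) (at s within {0..1})" if "s \<in> {0..1}" for s
    unfolding \<Phi>_def by (rule integral_has_vector_derivative[OF g that])
  have "\<Phi> s = z s" if s: "s \<in> {0..1}" for s
  proof -
    have img: "(\<lambda>t. t * s) ` {0..1} \<subseteq> {0..1}"
      using s by (auto intro: mult_le_one)
    have "((\<lambda>t. \<Phi> (t * s)) has_vector_derivative s *\<^sub>R g (t * s)) (at t within {0..1})"
      if t: "t \<in> {0..1}" for t
    proof -
      have "((\<lambda>t. t * s) has_vector_derivative s) (at t within {0..1})"
        by (auto intro!: derivative_eq_intros)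
      moreover have "(\<Phi> has_vector_derivative g (t * s)) (at (t * s) within (\<lambda>t. t * s) ` {0..1})"
        by (rule has_vector_derivative_within_subset[OF d\<Phi> img]) (use img t in blast)
      ultimately show ?thesis
        using vector_diff_chain_within[of "\<lambda>t. t * s" s t "{0..1}" \<Phi> "g (t * s)"] by (simp add: o_def)
    qed
    from fundamental_theorem_of_calculus[OF _ this]
    have "((\<lambda>t. s *\<^sub>R g (t * s)) has_integral \<Phi> (1 * s) - \<Phi> (0 * s)) {0..1}" by simp
    then have "z s = \<Phi> (1 * s) - \<Phi> (0 * s)" unfolding z[OF s] by (rule integral_unique)
    then show ?thesis by (simp add: \<Phi>_def)
  qed
  then show ?thesis
    using has_vector_derivative_transform[OF s _ d\<Phi>[OF s], of z] by auto
qed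

text \<open>Comparison with the approximate solution \<open>y (t x) + t A (t x, y (t x)) h\<close> along the ray
  through \<open>x + h\<close>: the symmetry condition makes its defect \<open>o (h)\<close>.\<close>

theorem total_differential_equation:
  fixes A :: "'e::euclidean_space \<times> 'f::euclidean_space \<Rightarrow> ('e \<Rightarrow>\<^sub>L 'f)"
  assumes W: "open W" "(0, 0) \<in> W"
    and A: "\<And>p. p \<in> W \<Longrightarrow> (A has_derivative blinfun_apply (A' p)) (at p)"
    and contA': "continuous_on W A'"
    and sym: "\<And>p u v. p \<in> W \<Longrightarrow> A' p (u, A p u) v = A' p (v, A p v) u"
  obtains \<delta> y where "0 < \<delta>" "y 0 = 0" "\<And>x. x \<in> ball 0 \<delta> \<Longrightarrow> (x, y x) \<in> W"
    "\<And>x. x \<in> ball 0 \<delta> \<Longrightarrow> (y has_derivative A (x, y x)) (at x)"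
proof -
  obtain e0 where e0: "e0 > 0" "cball (0, 0) e0 \<subseteq> W"
    using open_contains_cball W by blast
  \<comment> \<open>Half of \<open>e0\<close>, since the norm of a pair is at most the sum of the
    norms; thus the product of the two balls stays inside the ball of radius
    \<open>e0\<close>.\<close>
  define \<eta> where "\<eta> = e0 / 2"
  define K where "K = cball (0::'e) \<eta> \<times> cball (0::'f) \<eta>"
  have "\<eta> > 0" using e0 by (simp add: \<eta>_def)
  have KW: "K \<subseteq> W"
  proof
    fix p assume p: "p \<in> K"
    have "norm p \<le> norm (fst p) + norm (snd p)" by (metis norm_Pair_le prod.collapse)
    then have "norm p \<le> e0" using p by (auto simp: K_def \<eta>_def)
    then have "p \<in> cball (0, 0) e0" by (simp add: dist_norm flip: zero_prod_def)
    then show "p \<in> W" using e0 by auto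
  qed
  have K: "compact K" "convex K"
    unfolding K_def by (intro compact_Times compact_cball convex_Times convex_cball)+
  have contA: "continuous_on W A"
    using A by (auto intro!: continuous_at_imp_continuous_on dest: has_derivative_continuous)
  obtain M where M: "0 < M" "\<And>p. p \<in> K \<Longrightarrow> norm (A p) \<le> M"
  proof -
    have "bounded (A ` K)"
      by (intro compact_imp_bounded compact_continuous_image continuous_on_subset[OF contA KW] K)
    then show thesis using that by (auto simp: bounded_pos)
  qed
  obtain L where L: "0 < L" "\<And>p. p \<in> K \<Longrightarrow> norm (A' p) \<le> L"
  proof -
    have "bounded (A' ` K)"
      by (intro compact_imp_bounded compact_continuous_image continuous_on_subset[OF contA' KW] K)
    then show thesis using that by (auto simp: bounded_pos)
  qed
  have dA: "(A has_derivative blinfun_apply (A' p)) (at p within T)" if "p \<in> K" for p T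
    using A KW that has_derivative_at_withinI by blast
  have lip: "norm (A p - A q) \<le> L * norm (p - q)" if "p \<in> K" "q \<in> K" for p q
    by (rule differentiable_bound[OF K(2) dA]) (use L(2) that in \<open>auto simp flip: norm_blinfun.rep_eq\<close>)
  \<comment> \<open>The three entries give the three smallness conditions of the Picard
    iteration.\<close>
  define \<delta> where "\<delta> = Min {\<eta>, \<eta> / (2 * M), 1 / (2 * L)}"
  have \<delta>: "0 < \<delta>" "\<delta> \<le> \<eta>" "\<delta> * M \<le> \<eta> / 2" "\<delta> * L \<le> 1 / 2"
  proof -
    show "0 < \<delta>" "\<delta> \<le> \<eta>" using \<open>\<eta> > 0\<close> M L by (auto simp: \<delta>_def)
    have "\<delta> \<le> \<eta> / (2 * M)" "\<delta> \<le> 1 / (2 * L)" by (auto simp: \<delta>_def)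
    then show "\<delta> * M \<le> \<eta> / 2" "\<delta> * L \<le> 1 / 2" using M(1) L(1) by (auto simp: field_simps)
  qed
  obtain y where y: "continuous_on UNIV y" "\<And>x. norm (y x) \<le> \<eta> / 2"
    "\<And>x. x \<in> cball 0 \<delta> \<Longrightarrow> y x = integral {0..1} (\<lambda>t. A (t *\<^sub>R x, y (t *\<^sub>R x)) x)"
    by (rule picard_fixed_point[of \<eta> A M L \<delta>])
      (use continuous_on_subset[OF contA KW] M L lip \<delta> in \<open>auto simp: K_def\<close>)
  have tK: "(t *\<^sub>R x, y (t *\<^sub>R x)) \<in> K" if "t \<in> {0..1}" "norm x \<le> \<delta>" for t x
  proof -
    have "norm (t *\<^sub>R x) \<le> 1 * \<delta>" using that mult_mono[of t 1 "norm x" \<delta>] by auto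
    moreover have "norm (y (t *\<^sub>R x)) \<le> \<eta>" using y(2)[of "t *\<^sub>R x"] \<open>\<eta> > 0\<close> by linarith
    ultimately show ?thesis using \<delta> by (simp add: K_def)
  qed
  have ray: "((\<lambda>s. y (s *\<^sub>R x)) has_vector_derivative A (s *\<^sub>R x, y (s *\<^sub>R x)) x) (at s within {0..1})"
    if x: "norm x \<le> \<delta>" and s: "s \<in> {0..1}" for x s
  proof (rule integral_ray_has_vector_derivative[OF _ _ s])
    have "continuous_on {0..1} (\<lambda>s. (s *\<^sub>R x, y (s *\<^sub>R x)))"
      by (intro continuous_intros continuous_on_compose2[OF y(1)]) auto
    then have "continuous_on {0..1} (\<lambda>s. A (s *\<^sub>R x, y (s *\<^sub>R x)))"
      by (rule continuous_on_compose2[OF contA]) (use KW tK x in auto)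
    then show "continuous_on {0..1} (\<lambda>s. A (s *\<^sub>R x, y (s *\<^sub>R x)) x)"
      by (intro continuous_intros)
    fix s :: real assume s: "s \<in> {0..1}"
    then have "norm (s *\<^sub>R x) \<le> 1 * \<delta>" using x mult_mono[of s 1 "norm x" \<delta>] by auto
    then show "y (s *\<^sub>R x) = integral {0..1} (\<lambda>t. s *\<^sub>R A ((t * s) *\<^sub>R x, y ((t * s) *\<^sub>R x)) x)"
      using y(3)[of "s *\<^sub>R x"] by (simp add: blinfun.scaleR_right)
  qed
  have y0: "y 0 = 0" using y(3)[of 0] \<delta>(1) by (simp add: blinfun.zero_right)
  have deriv: "(y has_derivative A (x, y x)) (at x)" if x: "x \<in> ball 0 \<delta>" for x
    unfolding has_derivative_at_alt
  proof (intro conjI allI impI)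
    show "bounded_linear (blinfun_apply (A (x, y x)))" by (rule blinfun.bounded_linear_right)
    fix e :: real assume "e > 0"
    \<comment> \<open>Chosen so that \<open>\<epsilon> * (1 + M) * \<delta> = e / 4\<close>, the
      share of the linearisation error in the final bound.\<close>
    define \<epsilon> where "\<epsilon> = e / (4 * (1 + M) * \<delta>)"
    have "\<epsilon> > 0" using \<open>e > 0\<close> M \<delta> by (simp add: \<epsilon>_def)
    have "uniformly_continuous_on K A'"
      by (intro compact_uniformly_continuous continuous_on_subset[OF contA' KW] K)
    then obtain d1 where d1: "d1 > 0"
      "\<And>p q. p \<in> K \<Longrightarrow> q \<in> K \<Longrightarrow> norm (p - q) < d1 \<Longrightarrow> norm (A' p - A' q) < \<epsilon>"
      using \<open>\<epsilon> > 0\<close> unfolding uniformly_continuous_on_def dist_norm by metis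
    \<comment> \<open>In order, the entries keep \<open>x + h\<close> in the ball, keep the
      comparison curve \<open>q\<close> in \<open>K\<close>, make the segment from
      \<open>p t\<close> to \<open>q t\<close> shorter than \<open>d1\<close>, and bound the
      quadratic term by \<open>e / 4\<close>.\<close>
    define d where "d = Min {\<delta> - norm x, \<eta> / (2 * M), d1 / (1 + M), e / (4 * L * (1 + M))}"
    have d: "d > 0" "d \<le> \<delta> - norm x" "d \<le> \<eta> / (2 * M)" "d \<le> d1 / (1 + M)" "d \<le> e / (4 * L * (1 + M))"
      using x M L \<open>\<eta> > 0\<close> d1 \<open>e > 0\<close> by (auto simp: d_def)
    have "norm (y x' - y x - A (x, y x) (x' - x)) \<le> e * norm (x' - x)" if x': "norm (x' - x) < d" for x'
    proof -
      define h where "h = x' - x"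
      have h: "norm h < d" "x' = x + h" using x' by (auto simp: h_def)
      have nx: "norm x \<le> \<delta>" and nxh: "norm (x + h) \<le> \<delta>"
        using x d h(1) norm_triangle_ineq[of x h] by auto
      define p where "p t = (t *\<^sub>R x, y (t *\<^sub>R x))" for t
      \<comment> \<open>\<open>p\<close> is the solution over the ray through \<open>x\<close>.
        \<open>q\<close> is its first-order guess over the ray through \<open>x + h\<close>, and
        \<open>w\<close> is the error of that guess; at \<open>t = 1\<close> it is exactly the
        remainder to be bounded.\<close>
      define q where "q t = p t + t *\<^sub>R (h, A (p t) h)" for t
      define w where "w t = y (t *\<^sub>R (x + h)) - snd (q t)" for t
      define w' where "w' t = A (t *\<^sub>R (x + h), y (t *\<^sub>R (x + h))) (x + h) -
          (A (p t) x + (t *\<^sub>R A' (p t) (x, A (p t) x) h + A (p t) h))" for t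
      have pK: "p t \<in> K" if "t \<in> {0..1}" for t using tK[OF that nx] by (simp add: p_def)
      have Ah: "norm (A (p t) h) \<le> M * norm h" if "t \<in> {0..1}" for t
        using norm_blinfun[of "A (p t)" h] M(2)[OF pK[OF that]]
        by (meson mult_right_mono norm_ge_zero order_trans)
      have qp: "norm (q t - p t) \<le> (1 + M) * norm h" if t: "t \<in> {0..1}" for t
      proof -
        have "norm (q t - p t) \<le> 1 * norm (h, A (p t) h)"
          unfolding q_def using t mult_right_mono[of t 1 "norm (h, A (p t) h)"] by (simp del: scaleR_Pair)
        also have "\<dots> \<le> norm h + norm (A (p t) h)" using norm_Pair_le[of h] by simp
        finally show ?thesis using Ah[OF t] by (simp add: distrib_right)
      qed
      have qK: "q t \<in> K" if t: "t \<in> {0..1}" for t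
      proof -
        have "norm (fst (q t)) \<le> 1 * \<delta>"
          using t nxh mult_mono[of t 1 "norm (x + h)" \<delta>] by (auto simp: q_def p_def simp flip: scaleR_add_right)
        moreover have "norm (snd (q t)) \<le> \<eta>"
        proof -
          have "norm (snd (q t)) \<le> norm (y (t *\<^sub>R x)) + norm (t *\<^sub>R A (p t) h)"
            by (simp add: q_def p_def norm_triangle_ineq del: norm_scaleR)
          also have "norm (t *\<^sub>R A (p t) h) \<le> 1 * (M * norm h)"
            using t Ah[OF t] mult_mono[of t 1 "norm (A (p t) h)" "M * norm h"] by auto
          also have "M * norm h \<le> M * (\<eta> / (2 * M))"
            using h d(3) M(1) by (intro mult_left_mono) auto
          also have "\<dots> = \<eta> / 2" using M(1) by simp
          finally show ?thesis using y(2)[of "t *\<^sub>R x"] by linarith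
        qed
        ultimately show ?thesis using \<delta>(2) by (simp add: K_def mem_Times_iff)
      qed
      have dw: "(w has_vector_derivative w' t) (at t within {0..1})" if t: "t \<in> {0..1}" for t
      proof -
        have y1: "((\<lambda>s. y (s *\<^sub>R x)) has_derivative (\<lambda>s. s *\<^sub>R A (p t) x)) (at t within {0..1})"
          using ray[OF nx t] by (simp add: p_def has_vector_derivative_def)
        have y2: "((\<lambda>s. y (s *\<^sub>R (x + h))) has_derivative
            (\<lambda>s. s *\<^sub>R A (t *\<^sub>R (x + h), y (t *\<^sub>R (x + h))) (x + h))) (at t within {0..1})"
          using ray[OF nxh t] by (simp add: has_vector_derivative_def)
        have "(p has_derivative (\<lambda>s. (s *\<^sub>R x, s *\<^sub>R A (p t) x))) (at t within {0..1})"
          unfolding p_def[abs_def]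
          by (intro has_derivative_Pair y1[unfolded p_def]) (auto intro!: derivative_eq_intros)
        from has_derivative_compose[OF this dA[OF pK[OF t], of UNIV]]
        have "((\<lambda>s. A (p s)) has_derivative (\<lambda>s. s *\<^sub>R A' (p t) (x, A (p t) x))) (at t within {0..1})"
          by (simp add: blinfun.scaleR_right flip: scaleR_Pair)
        then have Aph: "((\<lambda>s. A (p s) h) has_derivative (\<lambda>s. s *\<^sub>R A' (p t) (x, A (p t) x) h)) (at t within {0..1})"
          by (auto intro!: derivative_eq_intros simp: blinfun.scaleR_left)
        have "w = (\<lambda>s. y (s *\<^sub>R (x + h)) - (y (s *\<^sub>R x) + s *\<^sub>R A (p s) h))"
          by (simp add: fun_eq_iff w_def q_def p_def)
        with has_derivative_diff[OF y2 has_derivative_add[OF y1 has_derivative_scaleR[OF has_derivative_ident Aph]]]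
        show ?thesis
          unfolding has_vector_derivative_def w'_def
          by (simp add: scaleR_add_right scaleR_diff_right scaleR_scaleR mult.commute)
      qed
      define \<kappa> where "\<kappa> = \<epsilon> * (1 + M) * \<delta> + L * (1 + M) * norm h"
      have "\<kappa> \<ge> 0" using \<open>\<epsilon> > 0\<close> M L \<delta> by (simp add: \<kappa>_def)
      have bw': "norm (w' t) \<le> L * \<delta> * norm (w t) + \<kappa> * norm h" if t: "t \<in> {0..1}" for t
      proof -
        let ?P = "(t *\<^sub>R (x + h), y (t *\<^sub>R (x + h)))"
        have PK: "?P \<in> K" using tK[OF t nxh] .
        have Pq: "?P - q t = (0, w t)"
          by (simp add: w_def q_def p_def algebra_simps)
        \<comment> \<open>By the symmetry condition \<open>A' (h, A h) x = A' (x, A x) h\<close>,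
          the only term linear in \<open>h\<close> without a small factor cancels. What remains is a
          Lipschitz term in \<open>w\<close>, a linearisation error and a term quadratic in
          \<open>h\<close>.\<close>
        have w'_eq: "w' t = (A ?P - A (q t)) (x + h) + (A (q t) - A (p t) - A' (p t) (q t - p t)) (x + h)
            + t *\<^sub>R A' (p t) (h, A (p t) h) h"
        proof -
          have "A' (p t) (q t - p t) (x + h) = t *\<^sub>R A' (p t) (h, A (p t) h) (x + h)"
            unfolding q_def by (simp add: blinfun.scaleR_right blinfun.scaleR_left del: scaleR_Pair)
          also have "\<dots> = t *\<^sub>R A' (p t) (x, A (p t) x) h + t *\<^sub>R A' (p t) (h, A (p t) h) h"
            using sym[of "p t" h x] pK[OF t] KW by (auto simp: blinfun.add_right scaleR_add_right)
          finally have e: "A' (p t) (q t - p t) (x + h) = \<dots>" .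
          show ?thesis
            unfolding w'_def blinfun.diff_left e by (simp add: blinfun.add_right)
        qed
        have b1: "norm ((A ?P - A (q t)) (x + h)) \<le> (L * norm (w t)) * \<delta>"
        proof -
          have "norm ((A ?P - A (q t)) (x + h)) \<le> norm (A ?P - A (q t)) * norm (x + h)"
            by (rule norm_blinfun)
          also have "\<dots> \<le> (L * norm (?P - q t)) * \<delta>"
            using lip[OF PK qK[OF t]] nxh L(1) by (intro mult_mono) auto
          finally show ?thesis unfolding Pq by simp
        qed
        have b2: "norm ((A (q t) - A (p t) - A' (p t) (q t - p t)) (x + h)) \<le> ((1 + M) * norm h * \<epsilon>) * \<delta>"
        proof -
          have seg: "closed_segment (p t) (q t) \<subseteq> K"
            by (rule closed_segment_subset[OF pK[OF t] qK[OF t] K(2)])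
          have "norm h < d1 / (1 + M)" using h(1) d(4) by linarith
          then have "(1 + M) * norm h < d1"
            using M(1) by (simp add: pos_less_divide_eq mult.commute)
          then have near: "norm (r - p t) < d1" if "r \<in> closed_segment (p t) (q t)" for r
            using segment_bound(1)[OF that] qp[OF t] by linarith
          have "norm (A (q t) - A (p t) - A' (p t) (q t - p t)) \<le> norm (q t - p t) * \<epsilon>"
          proof (rule differentiable_bound_linearization[where S = "closed_segment (p t) (q t)"])
            show "p t + s *\<^sub>R (q t - p t) \<in> closed_segment (p t) (q t)" if "s \<in> {0..1}" for s
              unfolding closed_segment_def using that
              by (auto intro!: exI[of _ s] simp: algebra_simps)
            show "(A has_derivative blinfun_apply (A' r)) (at r within closed_segment (p t) (q t))"
              if "r \<in> closed_segment (p t) (q t)" for r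
              using dA seg that by blast
            show "onorm (blinfun_apply (A' r) - blinfun_apply (A' (p t))) \<le> \<epsilon>"
              if "r \<in> closed_segment (p t) (q t)" for r
            proof -
              have "norm (A' r - A' (p t)) < \<epsilon>" using near[OF that] seg that pK[OF t] by (intro d1) auto
              then show ?thesis by (simp add: norm_blinfun.rep_eq minus_blinfun.rep_eq fun_diff_def)
            qed
          qed auto
          also have "\<dots> \<le> (1 + M) * norm h * \<epsilon>"
            using qp[OF t] \<open>\<epsilon> > 0\<close> by (intro mult_right_mono) auto
          finally have "norm (A (q t) - A (p t) - A' (p t) (q t - p t)) * norm (x + h) \<le>
              ((1 + M) * norm h * \<epsilon>) * \<delta>"
            using nxh \<open>\<epsilon> > 0\<close> M(1) by (intro mult_mono) auto
          then show ?thesis using norm_blinfun order_trans by blast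
        qed
        have b3: "norm (t *\<^sub>R A' (p t) (h, A (p t) h) h) \<le> L * ((1 + M) * norm h) * norm h"
        proof -
          have "norm (t *\<^sub>R A' (p t) (h, A (p t) h) h) \<le> 1 * norm (A' (p t) (h, A (p t) h) h)"
            unfolding norm_scaleR using t by (intro mult_right_mono) auto
          also have "\<dots> \<le> norm (A' (p t) (h, A (p t) h)) * norm h" using norm_blinfun by simp
          also have "norm (A' (p t) (h, A (p t) h)) \<le> norm (A' (p t)) * norm (h, A (p t) h)"
            by (rule norm_blinfun)
          also have "\<dots> \<le> L * (norm h + M * norm h)"
            using L(2)[OF pK[OF t]] norm_Pair_le[of h "A (p t) h"] Ah[OF t] L(1)
            by (intro mult_mono) auto
          finally show ?thesis by (simp add: distrib_right mult_right_mono)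
        qed
        have "norm (w' t) \<le> (L * norm (w t)) * \<delta> + ((1 + M) * norm h * \<epsilon>) * \<delta> + L * ((1 + M) * norm h) * norm h"
          unfolding w'_eq using b1 b2 b3
          by (intro norm_triangle_le add_mono)
        then show ?thesis by (simp add: \<kappa>_def algebra_simps)
      qed
      have contw: "continuous_on {0..1} w"
        using has_vector_derivative_continuous[OF dw] by (auto simp: continuous_on_eq_continuous_within)
      \<comment> \<open>At a maximum of \<open>norm (w t)\<close> the mean value inequality bounds
        the maximum by half of itself plus \<open>\<kappa> * norm h\<close>, because
        \<open>L * \<delta> \<le> 1/2\<close>. Absorbing the half does the work of a Gronwall
        estimate.\<close>
      obtain t0 where t0: "t0 \<in> {0..1}" "\<And>t. t \<in> {0..1} \<Longrightarrow> norm (w t) \<le> norm (w t0)"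
        using continuous_attains_sup[of "{0..1::real}" "\<lambda>t. norm (w t)", OF _ _ continuous_on_norm[OF contw]]
        by auto
      have "norm (w t0 - w 0) \<le> (1/2 * norm (w t0) + \<kappa> * norm h) * norm (t0 - 0)"
      proof (rule differentiable_bound[of "{0..1}" w "\<lambda>t s. s *\<^sub>R w' t"])
        show "(w has_derivative (\<lambda>s. s *\<^sub>R w' t)) (at t within {0..1})" if "t \<in> {0..1}" for t
          using dw[OF that] by (simp add: has_vector_derivative_def)
        show "onorm (\<lambda>s. s *\<^sub>R w' t) \<le> 1/2 * norm (w t0) + \<kappa> * norm h" if t: "t \<in> {0..1}" for t
        proof (rule onorm_le)
          have "L * \<delta> * norm (w t) \<le> 1/2 * norm (w t0)"
            using \<delta>(4) t0(2)[OF t] by (intro mult_mono) (auto simp: mult.commute)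
          then have "norm (w' t) \<le> 1/2 * norm (w t0) + \<kappa> * norm h" using bw'[OF t] by linarith
          then show "norm (s *\<^sub>R w' t) \<le> (1/2 * norm (w t0) + \<kappa> * norm h) * norm s" for s
            unfolding norm_scaleR real_norm_def
            by (subst mult.commute) (intro mult_right_mono abs_ge_zero)
        qed
      qed (use t0 in auto)
      also have "\<dots> \<le> (1/2 * norm (w t0) + \<kappa> * norm h) * 1"
        using t0(1) \<open>\<kappa> \<ge> 0\<close> by (intro mult_left_mono) auto
      finally have "norm (w t0) \<le> 2 * \<kappa> * norm h"
        using y0 by (simp add: w_def q_def p_def)
      then have "norm (w 1) \<le> 2 * \<kappa> * norm h" using t0(2)[of 1] by simp
      also have "2 * \<kappa> \<le> e"
      proof -
        have "\<epsilon> * (4 * (1 + M) * \<delta>) = e"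
          using M(1) \<delta>(1) iffD1[OF nonzero_eq_divide_eq \<epsilon>_def] by simp
        then have "\<epsilon> * (1 + M) * \<delta> = e / 4" by (simp add: algebra_simps)
        moreover have "L * (1 + M) * norm h \<le> L * (1 + M) * (e / (4 * L * (1 + M)))"
          using h(1) d(5) L(1) M(1) by (intro mult_left_mono) auto
        moreover have "L * (1 + M) * (e / (4 * L * (1 + M))) = e / 4"
        proof -
          have "L * (1 + M) \<noteq> 0" using L(1) M(1) by simp
          moreover have "a * (e / (4 * a)) = e / 4" if "a \<noteq> 0" for a :: real
            using that by simp
          ultimately have "L * (1 + M) * (e / (4 * (L * (1 + M)))) = e / 4" by blast
          then show ?thesis by (simp only: mult.assoc)
        qed
        ultimately show ?thesis by (simp add: \<kappa>_def)
      qed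
      finally show ?thesis
        by (simp add: w_def q_def p_def h(2) mult_right_mono algebra_simps)
    qed
    then show "\<exists>d>0. \<forall>x'. norm (x' - x) < d \<longrightarrow>
        norm (y x' - y x - A (x, y x) (x' - x)) \<le> e * norm (x' - x)"
      using d(1) by blast
  qed
  show thesis
  proof (rule that[OF \<delta>(1) y0 _ deriv])
    show "(x, y x) \<in> W" if "x \<in> ball 0 \<delta>" for x
      using tK[of 1 x] KW that by auto
  qed
qed

text \<open>An operator on a Euclidean space is a finite sum of fixed bounded linear images of its
  values on \<open>Basis\<close>, so smoothness of those values suffices.\<close>

lemma smooth_on_blinfun:
  fixes A :: "'p::euclidean_space \<Rightarrow> ('a::euclidean_space \<Rightarrow>\<^sub>L 'b::real_normed_vector)"
  assumes W: "open W" and A: "\<And>b. smooth_on W (\<lambda>x. A x b)"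
  shows "smooth_on W A"
proof -
  have A_eq: "A = (\<lambda>x. \<Sum>b\<in>Basis. blinfun_scaleR_left (A x b) o\<^sub>L blinfun_inner_left b)"
  proof (rule ext, rule blinfun_eqI)
    fix x u
    have "A x u = A x (\<Sum>b\<in>Basis. (u \<bullet> b) *\<^sub>R b)" by (simp add: euclidean_representation)
    also have "\<dots> = (\<Sum>b\<in>Basis. blinfun_scaleR_left (A x b) o\<^sub>L blinfun_inner_left b) u"
      by (simp add: blinfun.sum_right blinfun.sum_left blinfun.scaleR_right)
    finally show "A x u = \<dots>" .
  qed
  have "bounded_linear (\<lambda>w. blinfun_scaleR_left w o\<^sub>L blinfun_inner_left b)" for b :: 'a
    by (intro bounded_linear_compose[OF bounded_bilinear.bounded_linear_left[OF bounded_bilinear_blinfun_compose]]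
        bounded_linear_blinfun_scaleR_left)
  then show ?thesis
    by (subst A_eq) (intro smooth_on_sum W, rule smooth_on_bounded_linear[OF _ W A])
qed

text \<open>Here \<open>a x\<close>, restricted to the range of \<open>P\<close>, describes a
  distribution by the graphs \<open>u + a x u\<close>, and \<open>inv\<close> says that the fields
  \<open>x \<mapsto> u + a x u\<close> commute; this is the symmetry condition of the total
  differential equation. The range of \<open>P\<close> is not a type, so the equation is posed on
  the whole space with \<open>a\<close> and the base point factored through
  \<open>P\<close>.\<close>

lemma involutive_graph:
  fixes a :: "'e::euclidean_space \<Rightarrow> 'e \<Rightarrow> 'e"
  assumes W: "open W" "0 \<in> W"
    and P: "linear P" "\<And>u. P (P u) = P u"
    and lin: "\<And>x. x \<in> W \<Longrightarrow> linear (a x)"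
    and smooth: "\<And>u. smooth_on W (\<lambda>x. a x u)"
    and aP: "\<And>x u. x \<in> W \<Longrightarrow> a x (P u) = a x u" "\<And>x u. x \<in> W \<Longrightarrow> P (a x u) = 0"
    and inv: "\<And>x u v. x \<in> W \<Longrightarrow> P u = u \<Longrightarrow> P v = v \<Longrightarrow>
      frechet_derivative (\<lambda>z. a z v) (at x) (u + a x u) = frechet_derivative (\<lambda>z. a z u) (at x) (v + a x v)"
  obtains \<delta> y where "0 < \<delta>" "y 0 = 0" "smooth_on (ball 0 \<delta>) y"
    "\<And>x. x \<in> ball 0 \<delta> \<Longrightarrow> P (y x) = 0" "\<And>x. x \<in> ball 0 \<delta> \<Longrightarrow> P x + y x \<in> W"
    "\<And>x. x \<in> ball 0 \<delta> \<Longrightarrow> (y has_derivative a (P x + y x)) (at x)"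
proof -
  \<comment> \<open>Recombines base and fibre coordinates, both taken in the full space, into the
    ambient point.\<close>
  let ?s = "\<lambda>p. P (fst p) + snd p"
  define W' where "W' = ?s -` W"
  have Pb: "bounded_linear P" using P(1) by (simp add: linear_conv_bounded_linear)
  have sb: "bounded_linear ?s"
    by (intro bounded_linear_add bounded_linear_compose[OF Pb] bounded_linear_fst bounded_linear_snd)
  have W': "open W'" "(0, 0) \<in> W'"
    using W linear_0[OF P(1)] linear_continuous_on[OF sb, of UNIV]
    by (auto simp: W'_def intro: open_vimage)
  define A where "A p = Blinfun (a (?s p))" for p :: "'e \<times> 'e"
  have A: "blinfun_apply (A p) = a (?s p)" if "p \<in> W'" for p
    unfolding A_def using lin that
    by (intro bounded_linear_Blinfun_apply) (auto simp: W'_def linear_conv_bounded_linear)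
  have "smooth_on W' (\<lambda>p. a (?s p) u)" for u
    by (rule smooth_on_compose[OF W'(1) W(1) smooth_on_linear[OF sb W'(1)] smooth]) (auto simp: W'_def)
  then have "smooth_on W' (\<lambda>p. A p u)" for u
    by (subst smooth_on_cong[OF W'(1)]) (simp add: A)
  then have "smooth_on W' A" by (rule smooth_on_blinfun[OF W'(1)])
  then obtain A' where A': "\<And>p. p \<in> W' \<Longrightarrow> (A has_derivative blinfun_apply (A' p)) (at p)"
    "continuous_on W' A'"
    using Ck_on_blinfun_derivative unfolding smooth_on_def by blast
  have A'_eq: "A' p w v = frechet_derivative (\<lambda>z. a z v) (at (?s p)) (?s w)" if p: "p \<in> W'" for p w v
  proof -
    have "((\<lambda>p. A p v) has_derivative (\<lambda>w. A' p w v)) (at p)"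
      using A'(1)[OF p] by (auto intro!: derivative_eq_intros)
    moreover have "((\<lambda>p. a (?s p) v) has_derivative (\<lambda>w. frechet_derivative (\<lambda>z. a z v) (at (?s p)) (?s w))) (at p)"
      by (rule has_derivative_compose[OF bounded_linear_imp_has_derivative[OF sb]
            smooth_on_has_derivative[OF smooth]]) (use p in \<open>auto simp: W'_def\<close>)
    then have "((\<lambda>p. A p v) has_derivative (\<lambda>w. frechet_derivative (\<lambda>z. a z v) (at (?s p)) (?s w))) (at p)"
      by (rule has_derivative_transform_within_open[OF _ W'(1) p]) (simp add: A)
    ultimately have "(\<lambda>w. A' p w v) = (\<lambda>w. frechet_derivative (\<lambda>z. a z v) (at (?s p)) (?s w))"
      by (rule has_derivative_unique)
    then show ?thesis by (rule fun_cong)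
  qed
  have sym: "A' p (u, A p u) v = A' p (v, A p v) u" if p: "p \<in> W'" for p u v
  proof -
    have z: "?s p \<in> W" using p by (simp add: W'_def)
    \<comment> \<open>Near the point \<open>a z (P v) = a z v\<close>, so the derivatives agree and
      \<open>inv\<close> may be applied to the projected vectors.\<close>
    have Pd: "frechet_derivative (\<lambda>z. a z (P v)) (at (?s p)) = frechet_derivative (\<lambda>z. a z v) (at (?s p))" for v
      by (rule frechet_derivative_transform_within_open[OF _ W(1) z])
        (use smooth_on_has_derivative[OF smooth z] aP in \<open>auto simp: differentiable_def\<close>)
    have "A' p (u, A p u) v = frechet_derivative (\<lambda>z. a z (P v)) (at (?s p)) (P u + a (?s p) (P u))"
      unfolding A'_eq[OF p] Pd by (simp add: A p aP[OF z])
    also have "\<dots> = frechet_derivative (\<lambda>z. a z (P u)) (at (?s p)) (P v + a (?s p) (P v))"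
      by (rule inv[OF z]) (simp_all add: P)
    also have "\<dots> = A' p (v, A p v) u"
      unfolding A'_eq[OF p] Pd by (simp add: A p aP[OF z])
    finally show ?thesis .
  qed
  from total_differential_equation[OF W' A' sym] obtain \<delta> y
    where \<delta>: "0 < \<delta>" "y 0 = 0" "\<And>x. x \<in> ball 0 \<delta> \<Longrightarrow> (x, y x) \<in> W'"
      and y: "\<And>x. x \<in> ball 0 \<delta> \<Longrightarrow> (y has_derivative A (x, y x)) (at x)" by blast
  have dy: "(y has_derivative a (P x + y x)) (at x)" if "x \<in> ball 0 \<delta>" for x
    using y[OF that] A[OF \<delta>(3)[OF that]] by simp
  have inW: "P x + y x \<in> W" if "x \<in> ball 0 \<delta>" for x
    using \<delta>(3)[OF that] by (simp add: W'_def)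
  \<comment> \<open>Bootstrapping: if \<open>y\<close> is \<open>Ck_on k\<close>, so is its
    derivative \<open>a (P x + y x)\<close> in each direction, hence \<open>y\<close> gains one
    order.\<close>
  have "Ck_on k (ball 0 \<delta>) y" for k
  proof (induction k)
    case 0
    then show ?case
      using has_derivative_continuous[OF dy] by (auto intro!: continuous_at_imp_continuous_on)
  next
    case (Suc k)
    show ?case
    proof (rule Ck_on_SucI[OF open_ball dy])
      have "Ck_on k (ball 0 \<delta>) (\<lambda>x. P x + y x)"
        by (intro Ck_on_add Ck_on_linear Suc Pb open_ball)
      then show "Ck_on k (ball 0 \<delta>) (\<lambda>x. a (P x + y x) u)" for u
        by (rule Ck_on_compose[OF open_ball W(1)]) (use smooth inW in \<open>auto simp: smooth_on_def\<close>)
    qed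
  qed
  then have sy: "smooth_on (ball 0 \<delta>) y" by (simp add: smooth_on_def)
  \<comment> \<open>The derivative of \<open>y\<close> takes values in the kernel of
    \<open>P\<close>, so \<open>P (y x)\<close> is constant on the ball, and it vanishes at
    0.\<close>
  have "P (y x) = 0" if "x \<in> ball 0 \<delta>" for x
  proof -
    have "\<exists>c. \<forall>x\<in>ball 0 \<delta>. P (y x) = c"
    proof (rule has_derivative_zero_constant[OF convex_ball])
      show "((\<lambda>x. P (y x)) has_derivative (\<lambda>h. 0)) (at x within ball 0 \<delta>)" if "x \<in> ball 0 \<delta>" for x
        using bounded_linear.has_derivative[OF Pb dy[OF that]] aP(2)[OF inW[OF that]]
        by (simp add: has_derivative_at_withinI)
    qed
    then have "P (y x) = P (y 0)" using that \<delta>(1) by (metis centre_in_ball)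
    then show ?thesis using \<delta>(2) linear_0[OF P(1)] by simp
  qed
  with that[OF \<delta>(1,2) sy _ inW dy] show thesis by blast
qed

section \<open>Smooth left inverses\<close>

text \<open>Gram-Schmidt orthogonalisation of the images \<open>T x (s i x)\<close>.\<close>

lemma smooth_orthogonal_frame:
  fixes s :: "nat \<Rightarrow> 'p::euclidean_space \<Rightarrow> 'b::euclidean_space" and T :: "'p \<Rightarrow> 'b \<Rightarrow> 'c::euclidean_space"
  assumes W: "open W" "x0 \<in> W"
    and lin: "\<And>x. x \<in> W \<Longrightarrow> linear (T x)"
  shows "(\<And>i. i < k \<Longrightarrow> smooth_on W (s i)) \<Longrightarrow> (\<And>i. i < k \<Longrightarrow> smooth_on W (\<lambda>x. T x (s i x))) \<Longrightarrow>
    (\<And>i. i < k \<Longrightarrow> T x0 (s i x0) \<notin> span ((\<lambda>j. T x0 (s j x0)) ` {..<i})) \<Longrightarrow>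
    \<exists>U t. open U \<and> x0 \<in> U \<and> U \<subseteq> W \<and> (\<forall>i<k. smooth_on U (t i)) \<and>
      (\<forall>i<k. smooth_on U (\<lambda>x. T x (t i x))) \<and>
      (\<forall>x\<in>U. span ((\<lambda>i. t i x) ` {..<k}) = span ((\<lambda>i. s i x) ` {..<k}) \<and>
        (\<forall>i<k. T x (t i x) \<noteq> 0 \<and> (\<forall>j<k. i \<noteq> j \<longrightarrow> T x (t i x) \<bullet> T x (t j x) = 0)))"
proof (induction k)
  case 0
  then show ?case using W by auto
next
  case (Suc k)
  note IH = Suc.IH[OF Suc.prems[OF less_SucI]]
  obtain U t where U: "open U" "x0 \<in> U" "U \<subseteq> W"
    and t': "\<forall>i<k. smooth_on U (t i)" "\<forall>i<k. smooth_on U (\<lambda>x. T x (t i x))"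
    and st: "\<forall>x\<in>U. span ((\<lambda>i. t i x) ` {..<k}) = span ((\<lambda>i. s i x) ` {..<k}) \<and>
        (\<forall>i<k. T x (t i x) \<noteq> 0 \<and> (\<forall>j<k. i \<noteq> j \<longrightarrow> T x (t i x) \<bullet> T x (t j x) = 0))"
    by (rule exE[OF IH], assumption, assumption, assumption, elim exE conjE, rule that)
  have t: "\<And>i. i < k \<Longrightarrow> smooth_on U (t i)" "\<And>i. i < k \<Longrightarrow> smooth_on U (\<lambda>x. T x (t i x))"
    and sp: "\<And>x. x \<in> U \<Longrightarrow> span ((\<lambda>i. t i x) ` {..<k}) = span ((\<lambda>i. s i x) ` {..<k})"
    and nz: "\<And>x i. x \<in> U \<Longrightarrow> i < k \<Longrightarrow> T x (t i x) \<noteq> 0"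
    and orth: "\<And>x i j. x \<in> U \<Longrightarrow> i < k \<Longrightarrow> j < k \<Longrightarrow> i \<noteq> j \<Longrightarrow> T x (t i x) \<bullet> T x (t j x) = 0"
    using t' st by simp_all
  \<comment> \<open>The coefficients are computed from the images under \<open>T\<close> but applied
    to the vectors \<open>t j x\<close> themselves. So the images become orthogonal while the span
    of the original vectors is preserved.\<close>
  define c where "c j x = (T x (s k x) \<bullet> T x (t j x)) / (T x (t j x) \<bullet> T x (t j x))" for j x
  define p where "p x = (\<Sum>j<k. c j x *\<^sub>R t j x)" for x
  define r where "r x = s k x - p x" for x
  have s: "smooth_on U (s k)" "smooth_on U (\<lambda>x. T x (s k x))"
    using smooth_on_subset[OF Suc.prems(1) U(3)] smooth_on_subset[OF Suc.prems(2) U(3)] by auto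
  have c: "smooth_on U (c j)" if "j < k" for j
    unfolding c_def using that nz by (intro smooth_on_divide smooth_on_inner U s t) auto
  have Tr: "T x (r x) = T x (s k x) - (\<Sum>j<k. c j x *\<^sub>R T x (t j x))" if "x \<in> U" for x
    using lin[of x] that U(3)
    by (auto simp: r_def p_def linear_diff linear_sum linear_cmul o_def)
  have sr: "smooth_on U r"
    unfolding r_def p_def by (intro smooth_on_diff smooth_on_sum smooth_on_scaleR U s c t) auto
  have "smooth_on U (\<lambda>x. T x (s k x) - (\<Sum>j<k. c j x *\<^sub>R T x (t j x)))"
    by (intro smooth_on_diff smooth_on_sum smooth_on_scaleR U s c t) auto
  then have sTr: "smooth_on U (\<lambda>x. T x (r x))"
    by (subst smooth_on_cong[OF U(1) Tr])
  have pin: "p x \<in> span ((\<lambda>i. t i x) ` {..<k})" for x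
    unfolding p_def by (intro span_sum span_scale span_base) auto
  have r0: "T x0 (r x0) \<noteq> 0"
  proof
    assume "T x0 (r x0) = 0"
    then have "T x0 (s k x0) = T x0 (p x0)"
      using lin[of x0] W by (simp add: r_def linear_diff)
    also have "p x0 \<in> span ((\<lambda>i. s i x0) ` {..<k})" using pin sp U by blast
    then have "T x0 (p x0) \<in> span (T x0 ` (\<lambda>i. s i x0) ` {..<k})"
      using linear_span_image[OF lin[OF W(2)]] by blast
    finally show False using Suc.prems(3)[of k] by (simp add: image_image)
  qed
  \<comment> \<open>The new image vector is nonzero at \<open>x0\<close> by independence; by
    continuity it stays nonzero nearby, and the domain is shrunk to that set.\<close>
  define U' where "U' = U \<inter> (\<lambda>x. T x (r x)) -` (- {0})"
  have "open U'"
    unfolding U'_def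
    by (rule continuous_open_preimage[OF smooth_on_continuous[OF sTr] U(1)]) auto
  have orthr: "T x (r x) \<bullet> T x (t i x) = 0" if x: "x \<in> U" and i: "i < k" for x i
  proof -
    have "(\<Sum>j<k. c j x *\<^sub>R T x (t j x)) \<bullet> T x (t i x) = (\<Sum>j<k. c j x * (T x (t j x) \<bullet> T x (t i x)))"
      by (simp add: inner_sum_left)
    also have "\<dots> = (\<Sum>j<k. if j = i then T x (s k x) \<bullet> T x (t i x) else 0)"
      by (rule sum.cong) (use orth[OF x _ i] nz[OF x i] in \<open>auto simp: c_def\<close>)
    also have "\<dots> = T x (s k x) \<bullet> T x (t i x)" using i by simp
    finally show ?thesis by (simp add: Tr[OF x] inner_diff_left)
  qed
  define t' where "t' = t(k := r)"
  have sp': "span ((\<lambda>i. t' i x) ` {..<Suc k}) = span ((\<lambda>i. s i x) ` {..<Suc k})" if x: "x \<in> U" for x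
  proof -
    have e1: "(\<lambda>i. t' i x) ` {..<Suc k} = insert (r x) ((\<lambda>i. t i x) ` {..<k})"
      by (auto simp: t'_def lessThan_Suc)
    have e2: "(\<lambda>i. s i x) ` {..<Suc k} = insert (s k x) ((\<lambda>i. s i x) ` {..<k})"
      by (auto simp: lessThan_Suc)
    have "v - a *\<^sub>R r x \<in> span ((\<lambda>i. t i x) ` {..<k}) \<longleftrightarrow>
        v - a *\<^sub>R s k x \<in> span ((\<lambda>i. s i x) ` {..<k})" for v a
    proof -
      have eq: "v - a *\<^sub>R r x = a *\<^sub>R p x + (v - a *\<^sub>R s k x)" by (simp add: r_def algebra_simps)
      show ?thesis
        unfolding sp[OF x, symmetric] eq by (rule span_add_eq[OF span_scale[OF pin[of x]]])
    qed
    then show ?thesis unfolding e1 e2 span_insert by auto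
  qed
  have sm: "smooth_on U' (t' i)" "smooth_on U' (\<lambda>x. T x (t' i x))" if "i < Suc k" for i
    using that t sr sTr smooth_on_subset[of U _ U'] by (auto simp: t'_def U'_def less_Suc_eq)
  have nz': "T x (t' i x) \<noteq> 0" if "x \<in> U'" "i < Suc k" for x i
    using that nz by (auto simp: t'_def U'_def less_Suc_eq)
  have orth': "T x (t' i x) \<bullet> T x (t' j x) = 0" if "x \<in> U" "i < Suc k" "j < Suc k" "i \<noteq> j" for x i j
    using that orth orthr by (auto simp: t'_def less_Suc_eq inner_commute)
  have x0: "x0 \<in> U'" using U r0 by (auto simp: U'_def)
  have "U' \<subseteq> U" by (auto simp: U'_def)
  then show ?case
    using \<open>open U'\<close> U(3)
    by (intro exI[of _ U'] exI[of _ t'] conjI allI ballI impI x0 sm nz' orth' sp') (assumption | blast)+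
qed

text \<open>With the images of a frame orthogonal, a left inverse is an explicit sum of quotients of
  inner products, hence smooth in the base point. It serves twice: for the derivative of an
  immersion, and for a constant projection restricted to a varying plane.\<close>

lemma smooth_left_inverse:
  fixes s :: "nat \<Rightarrow> 'p::euclidean_space \<Rightarrow> 'b::euclidean_space" and T :: "'p \<Rightarrow> 'b \<Rightarrow> 'c::euclidean_space"
  assumes W: "open W" "x0 \<in> W"
    and lin: "\<And>x. x \<in> W \<Longrightarrow> linear (T x)"
    and s: "\<And>i. i < k \<Longrightarrow> smooth_on W (s i)" "\<And>i. i < k \<Longrightarrow> smooth_on W (\<lambda>x. T x (s i x))"
    and ind: "\<And>i. i < k \<Longrightarrow> T x0 (s i x0) \<notin> span ((\<lambda>j. T x0 (s j x0)) ` {..<i})"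
  obtains U R where "open U" "x0 \<in> U" "U \<subseteq> W" "\<And>x. x \<in> U \<Longrightarrow> linear (R x)"
    "\<And>x w. x \<in> U \<Longrightarrow> R x w \<in> span ((\<lambda>i. s i x) ` {..<k})"
    "\<And>x v. x \<in> U \<Longrightarrow> v \<in> span ((\<lambda>i. s i x) ` {..<k}) \<Longrightarrow> R x (T x v) = v"
    "\<And>x. x \<in> U \<Longrightarrow> dim (T x ` span ((\<lambda>i. s i x) ` {..<k})) = k"
    "\<And>Y w. open Y \<Longrightarrow> Y \<subseteq> U \<Longrightarrow> smooth_on Y w \<Longrightarrow> smooth_on Y (\<lambda>x. R x (w x))"
proof -
  note frame = smooth_orthogonal_frame[where W = W and T = T and k = k and s = s, OF W lin s ind]
  obtain U t where U: "open U" "x0 \<in> U" "U \<subseteq> W"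
    and t': "\<forall>i<k. smooth_on U (t i)" "\<forall>i<k. smooth_on U (\<lambda>x. T x (t i x))"
    and st: "\<forall>x\<in>U. span ((\<lambda>i. t i x) ` {..<k}) = span ((\<lambda>i. s i x) ` {..<k}) \<and>
        (\<forall>i<k. T x (t i x) \<noteq> 0 \<and> (\<forall>j<k. i \<noteq> j \<longrightarrow> T x (t i x) \<bullet> T x (t j x) = 0))"
    by (rule exE[OF frame], assumption, assumption, assumption, assumption, elim exE conjE, rule that)
  have t: "\<And>i. i < k \<Longrightarrow> smooth_on U (t i)" "\<And>i. i < k \<Longrightarrow> smooth_on U (\<lambda>x. T x (t i x))"
    and sp: "\<And>x. x \<in> U \<Longrightarrow> span ((\<lambda>i. t i x) ` {..<k}) = span ((\<lambda>i. s i x) ` {..<k})"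
    and nz: "\<And>x i. x \<in> U \<Longrightarrow> i < k \<Longrightarrow> T x (t i x) \<noteq> 0"
    and orth: "\<And>x i j. x \<in> U \<Longrightarrow> i < k \<Longrightarrow> j < k \<Longrightarrow> i \<noteq> j \<Longrightarrow> T x (t i x) \<bullet> T x (t j x) = 0"
    using t' st by simp_all
  \<comment> \<open>Orthogonal projection onto the image plane, followed by sending each
    \<open>T x (t i x)\<close> back to \<open>t i x\<close>.\<close>
  define R where "R x w = (\<Sum>i<k. ((w \<bullet> T x (t i x)) / (T x (t i x) \<bullet> T x (t i x))) *\<^sub>R t i x)" for x w
  have linR: "linear (R x)" for x
    by (rule linearI)
      (simp_all add: R_def inner_add_left add_divide_distrib scaleR_add_left sum.distrib scaleR_sum_right)
  show thesis
  proof (rule that[OF U linR])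
    show "R x w \<in> span ((\<lambda>i. s i x) ` {..<k})" if "x \<in> U" for x w
      unfolding sp[OF that, symmetric] R_def by (intro span_sum span_scale span_base) auto
    show "R x (T x v) = v" if x: "x \<in> U" and v: "v \<in> span ((\<lambda>i. s i x) ` {..<k})" for x v
    proof -
      have linT: "linear (T x)" using lin x U by auto
      have "R x (T x (t j x)) = t j x" if j: "j < k" for j
      proof -
        have "R x (T x (t j x)) = (\<Sum>i<k. if i = j then t j x else 0)"
          unfolding R_def by (rule sum.cong) (use orth[OF x j] nz[OF x j] in auto)
        then show ?thesis using j by simp
      qed
      then have b: "(R x \<circ> T x) w = id w" if "w \<in> (\<lambda>i. t i x) ` {..<k}" for w
        using that by auto
      have "(R x \<circ> T x) v = id v"
        by (rule linear_eq_on_span[OF linear_compose[OF linT linR] linear_id b v[folded sp[OF x]]])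
      then show ?thesis by simp
    qed
    show "dim (T x ` span ((\<lambda>i. s i x) ` {..<k})) = k" if x: "x \<in> U" for x
    proof -
      have linT: "linear (T x)" using lin x U by auto
      let ?B = "(\<lambda>i. T x (t i x)) ` {..<k}"
      have "T x ` span ((\<lambda>i. s i x) ` {..<k}) = span ?B"
        unfolding sp[OF x, symmetric] linear_span_image[OF linT, symmetric] image_image ..
      moreover have "independent ?B"
        by (rule pairwise_orthogonal_independent)
          (use orth[OF x] nz[OF x] in \<open>auto simp: pairwise_def orthogonal_def\<close>)
      moreover have "inj_on (\<lambda>i. T x (t i x)) {..<k}"
      proof (rule inj_onI, rule ccontr)
        fix i j assume "i \<in> {..<k}" "j \<in> {..<k}" "T x (t i x) = T x (t j x)" "i \<noteq> j"
        then show False using orth[OF x, of i j] nz[OF x, of j] by simp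
      qed
      then have "card ?B = k" by (simp add: card_image)
      ultimately show ?thesis using dim_span_eq_card_independent by metis
    qed
    show "smooth_on Y (\<lambda>x. R x (w x))" if "open Y" "Y \<subseteq> U" "smooth_on Y w" for Y w
      unfolding R_def using that nz
      by (intro smooth_on_sum smooth_on_scaleR smooth_on_divide smooth_on_inner
          smooth_on_subset[OF t(1)] smooth_on_subset[OF t(2)]) auto
  qed
qed

section \<open>Smooth functions on manifolds\<close>

abbreviation chart_image :: "('a, 'e) chart \<Rightarrow> 'e set" where
  "chart_image c \<equiv> snd c ` fst c"

abbreviation chart_inv :: "('a, 'e) chart \<Rightarrow> 'e \<Rightarrow> 'a" where
  "chart_inv c \<equiv> inv_into (fst c) (snd c)"

lemma is_chartD:
  assumes "is_chart c"
  shows "open (fst c)" "open (chart_image c)" "inj_on (snd c) (fst c)"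
    "continuous_on (fst c) (snd c)" "continuous_on (chart_image c) (chart_inv c)"
  using assms by (auto simp: is_chart_def homeomorphism_def split_beta)

lemma chart_inv_right: "x \<in> chart_image c \<Longrightarrow> snd c (chart_inv c x) = x"
  by (rule f_inv_into_f)

lemma chart_inv_in: "x \<in> chart_image c \<Longrightarrow> chart_inv c x \<in> fst c"
  by (rule inv_into_into)

lemma chart_inv_left: "is_chart c \<Longrightarrow> p \<in> fst c \<Longrightarrow> chart_inv c (snd c p) = p"
  using is_chartD(3) inv_into_f_f by fast

lemma chart_image_open:
  assumes "is_chart c" "open V" "V \<subseteq> fst c"
  shows "open (snd c ` V)"
proof -
  have "snd c ` V = chart_image c \<inter> chart_inv c -` V"
    using assms(3) chart_inv_left[OF assms(1)] chart_inv_right[of _ c] by force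
  also have "open \<dots>"
    by (rule continuous_open_preimage) (use is_chartD[OF assms(1)] assms(2) in auto)
  finally show ?thesis .
qed

lemma chart_preimage_open:
  assumes "is_chart c" "open T"
  shows "open (fst c \<inter> snd c -` T)"
  by (rule continuous_open_preimage) (use is_chartD[OF assms(1)] assms(2) in auto)

lemma smooth_fun_iff:
  "f \<in> smooth_fun A \<longleftrightarrow> (\<forall>c\<in>A. smooth_on (chart_image c) (\<lambda>x. f (chart_inv c x)))"
  by (auto simp: smooth_fun_def o_def split_beta)

locale smooth_manifold =
  fixes A :: "('p::{t2_space,second_countable_topology}, 'e::euclidean_space) chart set"
  assumes smooth_structure: "smooth_structure A"
begin

lemma chart: "c \<in> A \<Longrightarrow> is_chart c"
  using smooth_structure by (simp add: smooth_structure_def)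

lemma ex_chart: obtains c where "c \<in> A" "p \<in> fst c"
  using smooth_structure unfolding smooth_structure_def by blast

lemma smooth_transition:
  assumes "c \<in> A" "c' \<in> A"
  shows "smooth_on (snd c ` (fst c \<inter> fst c')) (\<lambda>x. snd c' (chart_inv c x))"
proof -
  have "compatible c c'" using smooth_structure assms by (simp add: smooth_structure_def)
  then show ?thesis by (simp add: compatible_def split_beta o_def)
qed

lemma smooth_change_chart:
  assumes c: "c \<in> A" "c' \<in> A" and V: "open V" "V \<subseteq> fst c'"
    and f: "smooth_on (snd c' ` V) (\<lambda>x. f (chart_inv c' x))"
  shows "smooth_on (snd c ` (fst c \<inter> V)) (\<lambda>x. f (chart_inv c x))"
proof -
  have o: "open (snd c ` (fst c \<inter> V))"
    using V is_chartD[OF chart[OF c(1)]] by (intro chart_image_open[OF chart[OF c(1)]]) auto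
  have "smooth_on (snd c ` (fst c \<inter> V)) (\<lambda>x. f (chart_inv c' (snd c' (chart_inv c x))))"
    by (rule smooth_on_compose[OF o chart_image_open[OF chart[OF c(2)] V] _ f])
      (use V chart_inv_left[OF chart[OF c(1)]]
        in \<open>auto intro: smooth_on_subset[OF smooth_transition[OF c]]\<close>)
  then show ?thesis
    using V chart_inv_left[OF chart[OF c(1)]] chart_inv_left[OF chart[OF c(2)]]
    by (subst smooth_on_cong[OF o]) auto
qed

text \<open>Smoothness is demanded in every chart of a maximal atlas. Compatibility of charts
  reduces this to one chart near each point.\<close>

lemma smooth_funI:
  assumes "\<And>p. \<exists>c\<in>A. \<exists>V. open V \<and> p \<in> V \<and> V \<subseteq> fst c \<and> smooth_on (snd c ` V) (\<lambda>x. f (chart_inv c x))"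
  shows "f \<in> smooth_fun A"
  unfolding smooth_fun_iff
proof
  fix c assume c: "c \<in> A"
  show "smooth_on (chart_image c) (\<lambda>x. f (chart_inv c x))"
  proof (rule smooth_on_local)
    fix x assume x: "x \<in> chart_image c"
    obtain c' V where V: "c' \<in> A" "open V" "chart_inv c x \<in> V" "V \<subseteq> fst c'"
      "smooth_on (snd c' ` V) (\<lambda>x. f (chart_inv c' x))"
      using assms by blast
    have "open (snd c ` (fst c \<inter> V))"
      using V is_chartD[OF chart[OF c(1)]] by (intro chart_image_open[OF chart[OF c(1)]]) auto
    moreover have "x \<in> snd c ` (fst c \<inter> V)"
      by (rule image_eqI[of _ _ "chart_inv c x"]) (use x V(3) chart_inv_in[OF x] chart_inv_right[OF x] in auto)
    ultimately show "\<exists>T. open T \<and> x \<in> T \<and> smooth_on T (\<lambda>x. f (chart_inv c x))"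
      using smooth_change_chart[OF c V(1,2,4,5)] by blast
  qed
qed

lemma smooth_funD: "f \<in> smooth_fun A \<Longrightarrow> c \<in> A \<Longrightarrow> smooth_on (chart_image c) (\<lambda>x. f (chart_inv c x))"
  by (simp add: smooth_fun_iff)

lemma image_open: "c \<in> A \<Longrightarrow> open (chart_image c)"
  using chart is_chartD(2) by blast

lemma smooth_fun_const: "(\<lambda>_. k) \<in> smooth_fun A"
  by (simp add: smooth_fun_iff smooth_on_const image_open)

lemma smooth_fun_add: "f \<in> smooth_fun A \<Longrightarrow> g \<in> smooth_fun A \<Longrightarrow> (\<lambda>x. f x + g x) \<in> smooth_fun A"
  by (simp add: smooth_fun_iff smooth_on_add image_open)

lemma smooth_fun_diff: "f \<in> smooth_fun A \<Longrightarrow> g \<in> smooth_fun A \<Longrightarrow> (\<lambda>x. f x - g x) \<in> smooth_fun A"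
  by (simp add: smooth_fun_iff smooth_on_diff image_open)

lemma smooth_fun_mult: "f \<in> smooth_fun A \<Longrightarrow> g \<in> smooth_fun A \<Longrightarrow> (\<lambda>x. f x * g x) \<in> smooth_fun A"
  by (simp add: smooth_fun_iff smooth_on_mult image_open)

lemma smooth_fun_sum:
  "(\<And>i. i \<in> I \<Longrightarrow> f i \<in> smooth_fun A) \<Longrightarrow> (\<lambda>x. \<Sum>i\<in>I. f i x) \<in> smooth_fun A"
  by (simp add: smooth_fun_iff smooth_on_sum image_open)

lemma bump_in_chart:
  assumes c: "c \<in> A" and V: "open V" "V \<subseteq> fst c" "p \<in> V"
  obtains \<rho> N where "open N" "p \<in> N" "N \<subseteq> V" "\<rho> \<in> smooth_fun A"
    "\<And>q. q \<in> N \<Longrightarrow> \<rho> q = 1" "\<And>q. q \<notin> V \<Longrightarrow> \<rho> q = 0"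
    "\<And>h. smooth_on (snd c ` V) h \<Longrightarrow> (\<lambda>q. \<rho> q * h (snd c q)) \<in> smooth_fun A"
proof -
  note ch = chart[OF c]
  let ?x0 = "snd c p"
  have oV: "open (snd c ` V)" by (rule chart_image_open[OF ch V(1,2)])
  then obtain e0 where e0: "e0 > 0" "ball ?x0 e0 \<subseteq> snd c ` V"
    using V(3) open_contains_ball by blast
  \<comment> \<open>A third of \<open>e0\<close>, so that the closed ball of radius
    \<open>2 * e\<close>, which carries the bump, still fits inside.\<close>
  define e where "e = e0 / 3"
  have e: "e > 0" "cball ?x0 (2 * e) \<subseteq> snd c ` V" using e0 by (auto simp: e_def)
  obtain r :: "'e \<Rightarrow> real" where r: "smooth_on UNIV r" "\<And>x. dist ?x0 x < e \<Longrightarrow> r x = 1"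
    "\<And>x. dist ?x0 x \<ge> 2 * e \<Longrightarrow> r x = 0"
    using smooth_bump[OF e(1)] by blast
  define K where "K = chart_inv c ` cball ?x0 (2 * e)"
  have eK: "cball ?x0 (2 * e) \<subseteq> chart_image c" using e(2) V(2) by blast
  have "compact K" unfolding K_def
    by (rule compact_continuous_image[OF continuous_on_subset[OF is_chartD(5)[OF ch] eK] compact_cball])
  \<comment> \<open>The Hausdorff property enters here. The complement of \<open>K\<close> is open
    and the extension vanishes on it, so smoothness outside \<open>V\<close> is immediate.\<close>
  then have "closed K" by (rule compact_imp_closed)
  have KV: "K \<subseteq> V"
    unfolding K_def using e(2) V(2) chart_inv_left[OF ch] by fastforce
  define \<rho> where "\<rho> q = (if q \<in> V then r (snd c q) else 0)" for q
  define N where "N = V \<inter> (fst c \<inter> snd c -` ball ?x0 e)"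
  have \<rho>K: "\<rho> q = 0" if "q \<notin> K" for q
  proof -
    have "dist ?x0 (snd c q) > 2 * e" if "q \<in> V"
    proof (rule ccontr)
      assume "\<not> ?thesis"
      then have "chart_inv c (snd c q) \<in> K" unfolding K_def by auto
      then show False using \<open>q \<notin> K\<close> chart_inv_left[OF ch] V(2) that by auto
    qed
    then show ?thesis using r(3) by (auto simp: \<rho>_def)
  qed
  have ext: "(\<lambda>q. \<rho> q * h (snd c q)) \<in> smooth_fun A" if h: "smooth_on (snd c ` V) h" for h
  proof (rule smooth_funI)
    fix q
    show "\<exists>c'\<in>A. \<exists>V. open V \<and> q \<in> V \<and> V \<subseteq> fst c' \<and>
        smooth_on (snd c' ` V) (\<lambda>x. \<rho> (chart_inv c' x) * h (snd c (chart_inv c' x)))"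
    proof (cases "q \<in> V")
      case True
      have "smooth_on (snd c ` V) (\<lambda>x. r x * h x)"
        by (intro smooth_on_mult oV h smooth_on_subset[OF r(1)]) simp
      then have "smooth_on (snd c ` V) (\<lambda>x. \<rho> (chart_inv c x) * h (snd c (chart_inv c x)))"
        by (subst smooth_on_cong[OF oV, of _ "\<lambda>x. r x * h x"])
          (use chart_inv_left[OF ch] V(2) in \<open>auto simp: \<rho>_def\<close>)
      then show ?thesis using True V c by blast
    next
      case False
      obtain d where d: "d \<in> A" "q \<in> fst d" using ex_chart by blast
      have o: "open (snd d ` (fst d - K))"
        using \<open>closed K\<close> is_chartD(1)[OF chart[OF d(1)]]
        by (intro chart_image_open[OF chart[OF d(1)]]) auto
      have "smooth_on (snd d ` (fst d - K)) (\<lambda>x. 0::real)" by (rule smooth_on_const[OF o])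
      then have "smooth_on (snd d ` (fst d - K)) (\<lambda>x. \<rho> (chart_inv d x) * h (snd c (chart_inv d x)))"
        by (subst smooth_on_cong[OF o, of _ "\<lambda>_. 0"])
          (use chart_inv_left[OF chart[OF d(1)]] \<rho>K in auto)
      moreover have "open (fst d - K)"
        using \<open>closed K\<close> is_chartD(1)[OF chart[OF d(1)]] by auto
      ultimately show ?thesis using d False KV by blast
    qed
  qed
  show thesis
  proof (rule that[of N \<rho>])
    show "open N" unfolding N_def
      by (intro open_Int V chart_preimage_open[OF ch]) simp
    show "p \<in> N" using V e by (auto simp: N_def)
    show "N \<subseteq> V" by (auto simp: N_def)
    show "\<rho> \<in> smooth_fun A" using ext[OF smooth_on_const[OF oV, of 1]] by simp
    show "\<rho> q = 1" if "q \<in> N" for q using that r(2) by (auto simp: N_def \<rho>_def)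
    show "\<rho> q = 0" if "q \<notin> V" for q using that by (simp add: \<rho>_def)
  qed (rule ext)
qed

lemma bump:
  assumes "open V" "p \<in> V"
  obtains \<rho> N where "open N" "p \<in> N" "N \<subseteq> V" "\<rho> \<in> smooth_fun A"
    "\<And>q. q \<in> N \<Longrightarrow> \<rho> q = 1" "\<And>q. q \<notin> V \<Longrightarrow> \<rho> q = 0"
proof -
  obtain c where c: "c \<in> A" "p \<in> fst c" using ex_chart by blast
  have o: "open (V \<inter> fst c)" using assms(1) is_chartD(1)[OF chart[OF c(1)]] by auto
  obtain \<rho> N where N: "open N" "p \<in> N" "N \<subseteq> V \<inter> fst c" "\<rho> \<in> smooth_fun A"
    "\<And>q. q \<in> N \<Longrightarrow> \<rho> q = 1" "\<And>q. q \<notin> V \<inter> fst c \<Longrightarrow> \<rho> q = 0"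
    by (rule bump_in_chart[OF c(1) o]) (use assms c in auto)
  show thesis by (rule that[of N \<rho>]) (use N in auto)
qed

section \<open>Tangent vectors\<close>

lemma tangent_add:
  "v \<in> tangent_space A p \<Longrightarrow> f \<in> smooth_fun A \<Longrightarrow> g \<in> smooth_fun A \<Longrightarrow> v (\<lambda>q. f q + g q) = v f + v g"
  by (simp add: tangent_space_def plus_fun_def)

lemma tangent_scale:
  "v \<in> tangent_space A p \<Longrightarrow> f \<in> smooth_fun A \<Longrightarrow> v (\<lambda>q. k * f q) = k * v f"
  by (simp add: tangent_space_def scaleR_fun_def)

lemma tangent_mult:
  "v \<in> tangent_space A p \<Longrightarrow> f \<in> smooth_fun A \<Longrightarrow> g \<in> smooth_fun A \<Longrightarrow>
    v (\<lambda>q. f q * g q) = v f * g p + f p * v g"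
  by (simp add: tangent_space_def times_fun_def)

lemma tangent_non_smooth: "v \<in> tangent_space A p \<Longrightarrow> f \<notin> smooth_fun A \<Longrightarrow> v f = 0"
  by (simp add: tangent_space_def)

lemma tangent_spaceI:
  assumes "\<And>f g. f \<in> smooth_fun A \<Longrightarrow> g \<in> smooth_fun A \<Longrightarrow> v (\<lambda>q. f q + g q) = v f + v g"
    "\<And>k f. f \<in> smooth_fun A \<Longrightarrow> v (\<lambda>q. k * f q) = k * v f"
    "\<And>f g. f \<in> smooth_fun A \<Longrightarrow> g \<in> smooth_fun A \<Longrightarrow> v (\<lambda>q. f q * g q) = v f * g p + f p * v g"
    "\<And>f. f \<notin> smooth_fun A \<Longrightarrow> v f = 0"
  shows "v \<in> tangent_space A p"
  using assms by (simp add: tangent_space_def plus_fun_def times_fun_def scaleR_fun_def)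

lemma tangent_const: "v \<in> tangent_space A p \<Longrightarrow> v (\<lambda>_. k) = 0"
proof -
  assume v: "v \<in> tangent_space A p"
  have "v (\<lambda>_. 1 * 1) = v (\<lambda>_. 1) * 1 + 1 * v (\<lambda>_. 1)"
    by (rule tangent_mult[OF v smooth_fun_const smooth_fun_const])
  then have "v (\<lambda>_. 1) = 0" by simp
  then show ?thesis using tangent_scale[OF v smooth_fun_const, of k 1] by simp
qed

lemma tangent_diff:
  assumes v: "v \<in> tangent_space A p" and "f \<in> smooth_fun A" "g \<in> smooth_fun A"
  shows "v (\<lambda>q. f q - g q) = v f - v g"
  using tangent_add[OF v smooth_fun_diff[OF assms(2,3)] assms(3)] by simp

lemma tangent_sum:
  assumes v: "v \<in> tangent_space A p"
  shows "(\<And>i. i \<in> I \<Longrightarrow> f i \<in> smooth_fun A) \<Longrightarrow> v (\<lambda>q. \<Sum>i\<in>I. f i q) = (\<Sum>i\<in>I. v (f i))"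
  by (induction I rule: infinite_finite_induct)
    (auto simp: tangent_const[OF v] tangent_add[OF v] smooth_fun_sum)

text \<open>Derivations are local: \<open>\<rho> * (f - g)\<close> vanishes identically, and the
  Leibniz rule at \<open>p\<close>, where \<open>\<rho> = 1\<close> and \<open>f = g\<close>, leaves
  \<open>v f - v g\<close>.\<close>

lemma tangent_cong:
  assumes v: "v \<in> tangent_space A p" and f: "f \<in> smooth_fun A" "g \<in> smooth_fun A"
    and V: "open V" "p \<in> V" "\<And>q. q \<in> V \<Longrightarrow> f q = g q"
  shows "v f = v g"
proof -
  obtain \<rho> N where N: "p \<in> N" "\<rho> \<in> smooth_fun A"
    "\<And>q. q \<in> N \<Longrightarrow> \<rho> q = 1" "\<And>q. q \<notin> V \<Longrightarrow> \<rho> q = 0"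
    using bump[OF V(1,2)] by metis
  have "(\<lambda>q. \<rho> q * (f q - g q)) = (\<lambda>_. 0)" using N(4) V(3) by (auto simp: fun_eq_iff)
  then have "0 = v (\<lambda>q. \<rho> q * (f q - g q))" using tangent_const[OF v] by simp
  also have "\<dots> = v \<rho> * (f p - g p) + \<rho> p * v (\<lambda>q. f q - g q)"
    by (rule tangent_mult[OF v N(2) smooth_fun_diff[OF f]])
  also have "\<dots> = v f - v g" using N V tangent_diff[OF v f] by simp
  finally show ?thesis by simp
qed

lemma subspace_tangent_space: "subspace (tangent_space A p)"
  by (rule subspaceI)
    (auto intro!: tangent_spaceI simp: scaleR_fun_def tangent_add tangent_scale tangent_mult
      tangent_non_smooth algebra_simps)

lemma coord_vec_eq:
  "coord_vec A c p u f = (if f \<in> smooth_fun A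
    then frechet_derivative (\<lambda>x. f (chart_inv c x)) (at (snd c p)) u else 0)"
  by (simp add: coord_vec_def split_beta o_def)

lemma coord_vec_in:
  assumes c: "c \<in> A" "p \<in> fst c"
  shows "coord_vec A c p u \<in> tangent_space A p"
proof -
  have d: "((\<lambda>x. f (chart_inv c x)) has_derivative
      frechet_derivative (\<lambda>x. f (chart_inv c x)) (at (snd c p))) (at (snd c p))" if "f \<in> smooth_fun A" for f
    using c by (intro smooth_on_has_derivative[OF smooth_funD[OF that c(1)]]) auto
  have p: "chart_inv c (snd c p) = p" by (rule chart_inv_left[OF chart[OF c(1)] c(2)])
  show ?thesis
  proof (rule tangent_spaceI)
    fix f g assume fg: "f \<in> smooth_fun A" "g \<in> smooth_fun A"
    show "coord_vec A c p u (\<lambda>q. f q + g q) = coord_vec A c p u f + coord_vec A c p u g"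
      using frechet_derivative_at[OF has_derivative_add[OF d[OF fg(1)] d[OF fg(2)]]]
      by (simp add: coord_vec_eq fg smooth_fun_add fun_eq_iff)
    show "coord_vec A c p u (\<lambda>q. f q * g q) = coord_vec A c p u f * g p + f p * coord_vec A c p u g"
      using fun_cong[OF frechet_derivative_at[OF has_derivative_mult[OF d[OF fg(1)] d[OF fg(2)]]], of u]
      by (simp add: coord_vec_eq fg smooth_fun_mult p)
  next
    fix k f assume f: "f \<in> smooth_fun A"
    show "coord_vec A c p u (\<lambda>q. k * f q) = k * coord_vec A c p u f"
      using frechet_derivative_at[OF has_derivative_mult_right[OF d[OF f], of k]]
        smooth_fun_mult[OF smooth_fun_const[of k] f]
      by (simp add: coord_vec_eq f fun_eq_iff)
  qed (simp add: coord_vec_eq)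
qed

lemma coord_vec_linear:
  assumes c: "c \<in> A" "p \<in> fst c"
  shows "linear (coord_vec A c p)"
proof -
  have lin: "linear (frechet_derivative (\<lambda>x. f (chart_inv c x)) (at (snd c p)))" if "f \<in> smooth_fun A" for f
    using c by (intro has_derivative_linear[OF smooth_on_has_derivative[OF smooth_funD[OF that c(1)]]]) auto
  show ?thesis
    by (rule linearI) (auto simp: coord_vec_eq fun_eq_iff linear_add[OF lin] linear_cmul[OF lin] scaleR_fun_def)
qed

text \<open>Every derivation is determined by its values on coordinate functions: apply it to the
  Hadamard expansion.\<close>

definition coordinate_functions :: "('p, 'e) chart \<Rightarrow> 'p set \<Rightarrow> ('e \<Rightarrow> 'p \<Rightarrow> real) \<Rightarrow> bool" where
  "coordinate_functions c N \<xi> \<longleftrightarrow> open N \<and> N \<subseteq> fst c \<and> (\<forall>b. \<xi> b \<in> smooth_fun A) \<and>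
     (\<forall>b. \<forall>q\<in>N. \<xi> b q = snd c q \<bullet> b) \<and>
     (\<forall>q\<in>N. \<forall>v\<in>tangent_space A q. v = coord_vec A c q (\<Sum>b\<in>Basis. v (\<xi> b) *\<^sub>R b))"

lemma coordinate_functionsD:
  assumes "coordinate_functions c N \<xi>"
  shows "open N" "N \<subseteq> fst c" "\<And>b. \<xi> b \<in> smooth_fun A" "\<And>b q. q \<in> N \<Longrightarrow> \<xi> b q = snd c q \<bullet> b"
    "\<And>q v. q \<in> N \<Longrightarrow> v \<in> tangent_space A q \<Longrightarrow> v = coord_vec A c q (\<Sum>b\<in>Basis. v (\<xi> b) *\<^sub>R b)"
  using assms by (simp_all add: coordinate_functions_def)

text \<open>Derivations act on global functions only, so the chart components are cut off and keep
  their meaning on \<open>N\<close>. The same functions work at every \<open>q\<close> in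
  \<open>N\<close>, which makes components of fields smooth.\<close>

lemma local_coordinates:
  assumes c: "c \<in> A" "p \<in> fst c"
  shows "\<exists>N \<xi>. p \<in> N \<and> coordinate_functions c N \<xi>"
proof -
  note ch = chart[OF c(1)]
  obtain \<rho> N where N: "open N" "p \<in> N" "N \<subseteq> fst c" "\<And>q. q \<in> N \<Longrightarrow> \<rho> q = 1"
    and ext: "\<And>h. smooth_on (snd c ` fst c) h \<Longrightarrow> (\<lambda>q. \<rho> q * h (snd c q)) \<in> smooth_fun A"
    using bump_in_chart[OF c(1) is_chartD(1)[OF ch] order_refl c(2)] by metis
  define \<xi> where "\<xi> b q = \<rho> q * (snd c q \<bullet> b)" for b q
  have \<xi>: "\<xi> b \<in> smooth_fun A" for b
    unfolding \<xi>_def[abs_def]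
    by (rule ext) (intro smooth_on_inner smooth_on_id smooth_on_const image_open c)
  have \<xi>N: "\<xi> b q = snd c q \<bullet> b" if "q \<in> N" for b q using N(4) that by (simp add: \<xi>_def)
  have "v = coord_vec A c q (\<Sum>b\<in>Basis. v (\<xi> b) *\<^sub>R b)"
    if q: "q \<in> N" and v: "v \<in> tangent_space A q" for q v
  proof -
    let ?x0 = "snd c q"
    have qc: "q \<in> fst c" using q N by auto
    have "?x0 \<in> chart_image c" using qc by auto
    then obtain e where e: "e > 0" "ball ?x0 e \<subseteq> chart_image c"
      using image_open[OF c(1)] open_contains_ball by blast
    define V where "V = fst c \<inter> snd c -` ball ?x0 e"
    have V: "open V" "V \<subseteq> fst c" "q \<in> V" and Vball: "snd c ` V \<subseteq> ball ?x0 e"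
      using chart_preimage_open[OF ch, of "ball ?x0 e"] qc e by (auto simp: V_def)
    \<comment> \<open>A second cut-off, depending on \<open>q\<close>, makes the Hadamard
      coefficients global; they are defined only on a ball around \<open>snd c q\<close>.\<close>
    obtain \<sigma> N' where N': "open N'" "q \<in> N'" "N' \<subseteq> V" "\<And>q. q \<in> N' \<Longrightarrow> \<sigma> q = 1"
      and ext': "\<And>h. smooth_on (snd c ` V) h \<Longrightarrow> (\<lambda>q. \<sigma> q * h (snd c q)) \<in> smooth_fun A"
      using bump_in_chart[OF c(1) V] by metis
    show "v = coord_vec A c q (\<Sum>b\<in>Basis. v (\<xi> b) *\<^sub>R b)"
    proof
      fix f
      show "v f = coord_vec A c q (\<Sum>b\<in>Basis. v (\<xi> b) *\<^sub>R b) f"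
      proof (cases "f \<in> smooth_fun A")
        case f: True
        let ?f' = "frechet_derivative (\<lambda>x. f (chart_inv c x)) (at ?x0)"
        have sf: "smooth_on (ball ?x0 e) (\<lambda>x. f (chart_inv c x))"
          using smooth_on_subset[OF smooth_funD[OF f c(1)] e(2)] .
        have "\<exists>g. (\<forall>b. smooth_on (ball ?x0 e) (g b)) \<and> (\<forall>b. g b ?x0 = ?f' b) \<and>
          (\<forall>x\<in>ball ?x0 e. f (chart_inv c x) = f (chart_inv c ?x0) + (\<Sum>b\<in>Basis. ((x - ?x0) \<bullet> b) * g b x))"
          by (rule smooth_on_Hadamard[OF open_ball convex_ball centre_in_ball[THEN iffD2, OF e(1)] sf]) blast
        then obtain g where g: "\<And>b. smooth_on (ball ?x0 e) (g b)" "\<And>b. g b ?x0 = ?f' b"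
          "\<And>x. x \<in> ball ?x0 e \<Longrightarrow> f (chart_inv c x) = f (chart_inv c ?x0) + (\<Sum>b\<in>Basis. ((x - ?x0) \<bullet> b) * g b x)"
          by blast
        define G where "G b q' = \<sigma> q' * g b (snd c q')" for b q'
        have G: "G b \<in> smooth_fun A" for b
          unfolding G_def[abs_def] by (rule ext'[OF smooth_on_subset[OF g(1) Vball]])
        have d\<xi>: "(\<lambda>q'. \<xi> b q' - \<xi> b q) \<in> smooth_fun A" for b
          by (intro smooth_fun_diff \<xi> smooth_fun_const)
        have sm: "(\<lambda>q'. (\<xi> b q' - \<xi> b q) * G b q') \<in> smooth_fun A" for b
          by (intro smooth_fun_mult d\<xi> G)
        have "v f = v (\<lambda>q'. f q + (\<Sum>b\<in>Basis. (\<xi> b q' - \<xi> b q) * G b q'))"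
        proof (rule tangent_cong[OF v f, of _ "N \<inter> N'"])
          show "(\<lambda>q'. f q + (\<Sum>b\<in>Basis. (\<xi> b q' - \<xi> b q) * G b q')) \<in> smooth_fun A"
            by (intro smooth_fun_add smooth_fun_const smooth_fun_sum sm)
          fix q' assume q': "q' \<in> N \<inter> N'"
          then have "q' \<in> V" using N' by auto
          then have "q' \<in> fst c" "snd c q' \<in> ball ?x0 e" by (auto simp: V_def)
          then show "f q' = f q + (\<Sum>b\<in>Basis. (\<xi> b q' - \<xi> b q) * G b q')"
            using g(3)[of "snd c q'"] q' q
            by (simp add: chart_inv_left[OF ch] qc \<xi>N G_def N' inner_diff_left)
        qed (use N N' q in auto)
        also have "\<dots> = (\<Sum>b\<in>Basis. v (\<lambda>q'. (\<xi> b q' - \<xi> b q) * G b q'))"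
          by (simp add: tangent_add[OF v smooth_fun_const smooth_fun_sum] sm tangent_sum[OF v] tangent_const[OF v])
        also have "\<dots> = (\<Sum>b\<in>Basis. v (\<xi> b) * ?f' b)"
        proof (rule sum.cong[OF refl])
          fix b :: 'e
          \<comment> \<open>The first factor vanishes at \<open>q\<close>, so the Leibniz rule never
            differentiates the unknown coefficient \<open>G b\<close>.\<close>
          have "v (\<lambda>q'. (\<xi> b q' - \<xi> b q) * G b q') = v (\<lambda>q'. \<xi> b q' - \<xi> b q) * G b q + (\<xi> b q - \<xi> b q) * v (G b)"
            by (rule tangent_mult[OF v d\<xi> G])
          also have "v (\<lambda>q'. \<xi> b q' - \<xi> b q) = v (\<xi> b)"
            using tangent_diff[OF v \<xi> smooth_fun_const] tangent_const[OF v] by simp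
          also have "G b q = ?f' b" using N' q g(2) by (simp add: G_def)
          finally show "v (\<lambda>q'. (\<xi> b q' - \<xi> b q) * G b q') = v (\<xi> b) * ?f' b" by simp
        qed
        also have "\<dots> = ?f' (\<Sum>b\<in>Basis. v (\<xi> b) *\<^sub>R b)"
        proof -
          have lin: "linear ?f'"
            using e by (intro has_derivative_linear[OF smooth_on_has_derivative[OF sf]]) auto
          show ?thesis by (simp add: linear_sum[OF lin] linear_cmul[OF lin])
        qed
        finally show ?thesis by (simp add: coord_vec_eq f)
      qed (simp add: coord_vec_eq tangent_non_smooth[OF v])
    qed
  qed
  then have "coordinate_functions c N \<xi>"
    unfolding coordinate_functions_def using N(1,3) \<xi> \<xi>N by simp
  then show ?thesis using N(2) by blast
qed

lemma coord_vec_coordinate: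
  assumes c: "c \<in> A" and co: "coordinate_functions c N \<xi>" and q: "q \<in> N"
  shows "coord_vec A c q u (\<xi> b) = u \<bullet> b"
proof -
  note ch = chart[OF c(1)]
  note N = coordinate_functionsD[OF co]
  have o: "open (snd c ` (fst c \<inter> N))"
    using is_chartD(1)[OF ch] N(1) by (intro chart_image_open[OF ch]) auto
  have "((\<lambda>x. x \<bullet> b) has_derivative (\<lambda>u. u \<bullet> b)) (at (snd c q))"
    by (auto intro!: derivative_eq_intros)
  then have "((\<lambda>x. \<xi> b (chart_inv c x)) has_derivative (\<lambda>u. u \<bullet> b)) (at (snd c q))"
  proof (rule has_derivative_transform_within_open[OF _ o])
    show "snd c q \<in> snd c ` (fst c \<inter> N)" using q N(2) by auto
    show "x \<bullet> b = \<xi> b (chart_inv c x)" if "x \<in> snd c ` (fst c \<inter> N)" for x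
      using that chart_inv_left[OF ch] by (auto simp: N(4))
  qed
  from fun_cong[OF frechet_derivative_at[OF this], of u] show ?thesis
    by (simp add: coord_vec_eq N(3))
qed

definition coords :: "('p, 'e) chart \<Rightarrow> 'p \<Rightarrow> 'p tvec \<Rightarrow> 'e" where
  "coords c p v = inv (coord_vec A c p) v"

lemma inj_coord_vec:
  assumes c: "c \<in> A" "p \<in> fst c"
  shows "inj (coord_vec A c p)"
proof -
  obtain N \<xi> where N: "p \<in> N" "coordinate_functions c N \<xi>"
    using local_coordinates[OF c] by blast
  show ?thesis
  proof (rule injI, rule euclidean_eqI)
    fix u w b assume "coord_vec A c p u = coord_vec A c p w"
    then show "u \<bullet> b = w \<bullet> b"
      using coord_vec_coordinate[OF c(1) N(2,1)] by metis
  qed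
qed

lemma coords_coord_vec: "c \<in> A \<Longrightarrow> p \<in> fst c \<Longrightarrow> coords c p (coord_vec A c p u) = u"
  unfolding coords_def by (intro inv_f_f inj_coord_vec)

lemma coord_vec_coords:
  assumes c: "c \<in> A" "p \<in> fst c" and v: "v \<in> tangent_space A p"
  shows "coord_vec A c p (coords c p v) = v"
proof -
  have "v \<in> range (coord_vec A c p)"
    using local_coordinates[OF c] coordinate_functionsD(5)[OF _ _ v] by blast
  then show ?thesis unfolding coords_def by (rule f_inv_into_f)
qed

lemma coords_inner:
  assumes c: "c \<in> A" and co: "coordinate_functions c N \<xi>" and q: "q \<in> N"
    and v: "v \<in> tangent_space A q"
  shows "coords c q v \<bullet> b = v (\<xi> b)"
  using coord_vec_coordinate[OF c co q] coord_vec_coords[OF c _ v] coordinate_functionsD(2)[OF co] q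
  by (metis subsetD)

end

section \<open>Vector fields\<close>

context smooth_manifold
begin

lemma smooth_fun_local:
  assumes "\<And>p. \<exists>V g. open V \<and> p \<in> V \<and> g \<in> smooth_fun A \<and> (\<forall>q\<in>V. f q = g q)"
  shows "f \<in> smooth_fun A"
proof (rule smooth_funI)
  fix p
  obtain V g where V: "open V" "p \<in> V" "g \<in> smooth_fun A" "\<And>q. q \<in> V \<Longrightarrow> f q = g q"
    using assms[of p] by blast
  obtain c where c: "c \<in> A" "p \<in> fst c" using ex_chart by blast
  note ch = chart[OF c(1)]
  have o: "open (fst c \<inter> V)" using V is_chartD(1)[OF ch] by auto
  have oi: "open (snd c ` (fst c \<inter> V))" by (rule chart_image_open[OF ch o]) auto
  have "smooth_on (snd c ` (fst c \<inter> V)) (\<lambda>x. g (chart_inv c x))"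
    by (rule smooth_on_subset[OF smooth_funD[OF V(3) c(1)]]) auto
  then have "smooth_on (snd c ` (fst c \<inter> V)) (\<lambda>x. f (chart_inv c x))"
    by (subst smooth_on_cong[OF oi, of _ "\<lambda>x. g (chart_inv c x)"])
      (auto simp: V(4) chart_inv_left[OF ch])
  then show "\<exists>c\<in>A. \<exists>V. open V \<and> p \<in> V \<and> V \<subseteq> fst c \<and> smooth_on (snd c ` V) (\<lambda>x. f (chart_inv c x))"
    using c V(2) o by blast
qed

text \<open>Vector fields are fields along the identity, so this makes the closure properties of
  fields along a map available for them.\<close>

lemma smooth_map_id: "smooth_map A A (\<lambda>p. p)"
  unfolding smooth_map_def using smooth_transition by (auto simp: o_def split_beta)

lemma vector_fieldD: "X \<in> vector_fields A \<Longrightarrow> X p \<in> tangent_space A p"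
  "X \<in> vector_fields A \<Longrightarrow> f \<in> smooth_fun A \<Longrightarrow> (\<lambda>p. X p f) \<in> smooth_fun A"
  by (auto simp: fields_along_def)

lemma lie_bracket_in:
  assumes X: "X \<in> vector_fields A" and Y: "Y \<in> vector_fields A"
  shows "lie_bracket X Y p \<in> tangent_space A p"
proof -
  note t = vector_fieldD(1)[OF X] vector_fieldD(1)[OF Y]
  note s = vector_fieldD(2)[OF X] vector_fieldD(2)[OF Y]
  show ?thesis
  proof (rule tangent_spaceI)
    fix f g assume fg: "f \<in> smooth_fun A" "g \<in> smooth_fun A"
    show "lie_bracket X Y p (\<lambda>q. f q + g q) = lie_bracket X Y p f + lie_bracket X Y p g"
      by (simp add: lie_bracket_def fg s tangent_add[OF t(1)] tangent_add[OF t(2)])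
    show "lie_bracket X Y p (\<lambda>q. f q * g q) = lie_bracket X Y p f * g p + f p * lie_bracket X Y p g"
      by (simp add: lie_bracket_def fg s tangent_mult[OF t(1)] tangent_mult[OF t(2)]
          tangent_add[OF t(1)] tangent_add[OF t(2)] smooth_fun_mult algebra_simps)
  next
    fix k f assume "f \<in> smooth_fun A"
    then show "lie_bracket X Y p (\<lambda>q. k * f q) = k * lie_bracket X Y p f"
      by (simp add: lie_bracket_def s tangent_scale[OF t(1)] tangent_scale[OF t(2)] algebra_simps)
  next
    \<comment> \<open>The convention for non-smooth \<open>f\<close> survives: \<open>X q f\<close>
      and \<open>Y q f\<close> are constantly 0 in \<open>q\<close>, and derivations kill
      constants.\<close>
    fix f assume f: "f \<notin> smooth_fun A"
    show "lie_bracket X Y p f = 0"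
      by (simp add: lie_bracket_def tangent_non_smooth[OF t(1) f] tangent_non_smooth[OF t(2) f]
          tangent_const[OF t(1)] tangent_const[OF t(2)])
  qed
qed

text \<open>Cutting off a coordinate expression makes it global. The last two conclusions record
  that the result is everywhere a multiple of the original or zero, so it stays inside any
  distribution that contained the original.\<close>

lemma local_vector_field:
  assumes c: "c \<in> A" and V: "open V" "V \<subseteq> fst c" "p \<in> V" and w: "smooth_on (snd c ` V) w"
  obtains X N \<rho> where "X \<in> vector_fields A" "open N" "p \<in> N" "N \<subseteq> V"
    "\<And>q. q \<in> N \<Longrightarrow> X q = coord_vec A c q (w (snd c q))"
    "\<And>q. q \<in> V \<Longrightarrow> X q = \<rho> q *\<^sub>R coord_vec A c q (w (snd c q))" "\<And>q. q \<notin> V \<Longrightarrow> X q = 0"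
proof -
  note ch = chart[OF c]
  have oV: "open (snd c ` V)" by (rule chart_image_open[OF ch V(1,2)])
  obtain \<rho> N where N: "open N" "p \<in> N" "N \<subseteq> V" "\<And>q. q \<in> N \<Longrightarrow> \<rho> q = 1" "\<And>q. q \<notin> V \<Longrightarrow> \<rho> q = 0"
    and ext: "\<And>h. smooth_on (snd c ` V) h \<Longrightarrow> (\<lambda>q. \<rho> q * h (snd c q)) \<in> smooth_fun A"
    using bump_in_chart[OF c V] by metis
  define X where "X q = (if q \<in> V then \<rho> q *\<^sub>R coord_vec A c q (w (snd c q)) else 0)" for q
  have XT: "X q \<in> tangent_space A q" for q
    using V(2) by (auto simp: X_def subspace_0[OF subspace_tangent_space]
      intro!: subspace_scale[OF subspace_tangent_space] coord_vec_in[OF c])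
  have "(\<lambda>q. X q f) \<in> smooth_fun A" if f: "f \<in> smooth_fun A" for f
  proof -
    let ?f' = "\<lambda>x. frechet_derivative (\<lambda>x. f (chart_inv c x)) (at x)"
    have sf: "smooth_on (snd c ` V) (\<lambda>x. f (chart_inv c x))"
      by (rule smooth_on_subset[OF smooth_funD[OF f c]]) (use V in auto)
    have "smooth_on (snd c ` V) (\<lambda>x. \<Sum>b\<in>Basis. (w x \<bullet> b) * ?f' x b)"
      by (intro smooth_on_sum smooth_on_mult smooth_on_inner smooth_on_const oV w smooth_on_derivative sf)
    from ext[OF this] have "(\<lambda>q. \<rho> q * (\<Sum>b\<in>Basis. (w (snd c q) \<bullet> b) * ?f' (snd c q) b)) \<in> smooth_fun A" .
    moreover have "X q f = \<rho> q * (\<Sum>b\<in>Basis. (w (snd c q) \<bullet> b) * ?f' (snd c q) b)" for q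
    proof (cases "q \<in> V")
      case True
      then have lin: "linear (?f' (snd c q))"
        by (intro has_derivative_linear[OF smooth_on_has_derivative[OF sf]]) auto
      have "?f' (snd c q) (w (snd c q)) = (\<Sum>b\<in>Basis. (w (snd c q) \<bullet> b) * ?f' (snd c q) b)"
        using linear_sum[OF lin, of "\<lambda>b. (w (snd c q) \<bullet> b) *\<^sub>R b" Basis]
        by (simp add: euclidean_representation linear_cmul[OF lin])
      then show ?thesis using True f by (simp add: X_def scaleR_fun_def coord_vec_eq)
    qed (simp add: X_def N)
    ultimately show ?thesis by simp
  qed
  then have XV: "X \<in> vector_fields A" using XT by (simp add: fields_along_def)
  show thesis
  proof (rule that[OF XV N(1-3)])
    show "X q = coord_vec A c q (w (snd c q))" if "q \<in> N" for q
      using that N(3) N(4)[OF that] by (auto simp: X_def)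
    show "X q = \<rho> q *\<^sub>R coord_vec A c q (w (snd c q))" if "q \<in> V" for q
      using that by (simp add: X_def)
    show "X q = 0" if "q \<notin> V" for q using that by (simp add: X_def)
  qed
qed

text \<open>Near each point the components are \<open>X q (\<xi> b)\<close> for global smooth
  functions \<open>\<xi> b\<close>, to which the definition of a smooth field applies.\<close>

lemma vector_field_coords_smooth:
  assumes X: "X \<in> vector_fields A" and c: "c \<in> A"
  shows "smooth_on (chart_image c) (\<lambda>x. coords c (chart_inv c x) (X (chart_inv c x)))"
proof (rule smooth_on_componentwise[OF image_open[OF c]], rule smooth_on_local)
  note ch = chart[OF c]
  fix b x assume x: "x \<in> chart_image c"
  obtain N \<xi> where Nx: "chart_inv c x \<in> N" and co: "coordinate_functions c N \<xi>"
    using local_coordinates[OF c chart_inv_in[OF x]] by blast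
  note N = coordinate_functionsD[OF co]
  have o: "open (snd c ` N)" by (rule chart_image_open[OF ch N(1,2)])
  have "smooth_on (snd c ` N) (\<lambda>x. X (chart_inv c x) (\<xi> b))"
    by (rule smooth_on_subset[OF smooth_funD[OF vector_fieldD(2)[OF X N(3)] c]]) (use N(2) in auto)
  then have "smooth_on (snd c ` N) (\<lambda>x. coords c (chart_inv c x) (X (chart_inv c x)) \<bullet> b)"
    by (rule iffD1[OF smooth_on_cong[OF o], rotated])
      (use N(2) chart_inv_left[OF ch] coords_inner[OF c co _ vector_fieldD(1)[OF X]] in force)
  moreover have "x \<in> snd c ` N" using Nx chart_inv_right[OF x] by (metis image_eqI)
  ultimately show "\<exists>T. open T \<and> x \<in> T \<and>
      smooth_on T (\<lambda>x. coords c (chart_inv c x) (X (chart_inv c x)) \<bullet> b)"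
    using o by blast
qed

text \<open>A vector is determined by its values on the coordinate functions, and there the bracket
  becomes a difference of directional derivatives of the component maps. Differentiability of
  \<open>v\<close> and \<open>w\<close> at the one point is enough for the computation.\<close>

lemma lie_bracket_coords:
  assumes X: "X \<in> vector_fields A" and Y: "Y \<in> vector_fields A"
    and c: "c \<in> A" "p \<in> fst c" and U: "open U" "p \<in> U" "U \<subseteq> fst c"
    and v: "\<And>q. q \<in> U \<Longrightarrow> X q = coord_vec A c q (v (snd c q))" "(v has_derivative v') (at (snd c p))"
    and w: "\<And>q. q \<in> U \<Longrightarrow> Y q = coord_vec A c q (w (snd c q))" "(w has_derivative w') (at (snd c p))"
  shows "lie_bracket X Y p = coord_vec A c p (w' (v (snd c p)) - v' (w (snd c p)))"
proof -
  note ch = chart[OF c(1)]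
  obtain N \<xi> where pN: "p \<in> N" and co: "coordinate_functions c N \<xi>"
    using local_coordinates[OF c] by blast
  note N = coordinate_functionsD[OF co]
  have der: "Z1 p (\<lambda>q. Z2 q (\<xi> b)) = z' (z1 (snd c p)) \<bullet> b"
    if Z: "Z1 \<in> vector_fields A" "Z2 \<in> vector_fields A" "\<And>q. q \<in> U \<Longrightarrow> Z1 q = coord_vec A c q (z1 (snd c q))"
      "\<And>q. q \<in> U \<Longrightarrow> Z2 q = coord_vec A c q (z2 (snd c q))" "(z2 has_derivative z') (at (snd c p))"
    for Z1 Z2 z1 z2 z' b
  proof -
    have o: "open (snd c ` (N \<inter> U))"
      by (rule chart_image_open[OF ch]) (use N(1,2) U in auto)
    have "((\<lambda>x. z2 x \<bullet> b) has_derivative (\<lambda>u. z' u \<bullet> b)) (at (snd c p))"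
      using Z(5) by (rule has_derivative_inner_left)
    then have "((\<lambda>x. Z2 (chart_inv c x) (\<xi> b)) has_derivative (\<lambda>u. z' u \<bullet> b)) (at (snd c p))"
    proof (rule has_derivative_transform_within_open[OF _ o])
      show "snd c p \<in> snd c ` (N \<inter> U)" using pN U by auto
      fix x assume "x \<in> snd c ` (N \<inter> U)"
      then obtain q where q: "q \<in> N" "q \<in> U" "x = snd c q" by auto
      then have "Z2 q (\<xi> b) = z2 x \<bullet> b"
        using Z(4)[OF q(2)] coord_vec_coordinate[OF c(1) co q(1)] by simp
      then show "z2 x \<bullet> b = Z2 (chart_inv c x) (\<xi> b)"
        using q N(2) chart_inv_left[OF ch, of q] by auto
    qed
    from fun_cong[OF frechet_derivative_at[OF this], of "z1 (snd c p)"] show ?thesis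
      using Z(3)[OF U(2)] vector_fieldD(2)[OF Z(2) N(3)] by (simp add: coord_vec_eq)
  qed
  have "lie_bracket X Y p = coord_vec A c p (\<Sum>b\<in>Basis. lie_bracket X Y p (\<xi> b) *\<^sub>R b)"
    by (rule N(5)[OF pN lie_bracket_in[OF X Y]])
  also have "(\<Sum>b\<in>Basis. lie_bracket X Y p (\<xi> b) *\<^sub>R b) =
      (\<Sum>b\<in>Basis. ((w' (v (snd c p)) - v' (w (snd c p))) \<bullet> b) *\<^sub>R b)"
    using der[OF X Y v(1) w] der[OF Y X w(1) v] by (simp add: lie_bracket_def inner_diff_left)
  finally show ?thesis by (simp add: euclidean_representation)
qed

section \<open>Changing a chart by a diffeomorphism of its image\<close>

text \<open>The new chart is compatible with all charts of the atlas, hence belongs to it by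
  maximality. It is used to recentre a chart and to straighten a leaf.\<close>

lemma chart_diffeo:
  assumes c: "c \<in> A" and V: "open V" "V \<subseteq> fst c"
    and H: "open (H ` snd c ` V)" "smooth_on (snd c ` V) H" "smooth_on (H ` snd c ` V) G"
      "\<And>x. x \<in> snd c ` V \<Longrightarrow> G (H x) = x"
  shows "(V, H \<circ> snd c) \<in> A" "\<And>y. y \<in> H ` snd c ` V \<Longrightarrow> inv_into V (H \<circ> snd c) y = chart_inv c (G y)"
proof -
  note ch = chart[OF c]
  have cl: "chart_inv c (snd c q) = q" if "q \<in> V" for q using chart_inv_left[OF ch] V that by auto
  have inj: "inj_on (H \<circ> snd c) V"
    by (rule inj_on_inverseI[of _ "chart_inv c \<circ> G"]) (simp add: cl H(4))
  have inv: "inv_into V (H \<circ> snd c) y = chart_inv c (G y)" if "y \<in> H ` snd c ` V" for y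
    using that inj by (auto simp: cl H(4) intro!: inv_into_f_eq)
  then show "\<And>y. y \<in> H ` snd c ` V \<Longrightarrow> inv_into V (H \<circ> snd c) y = chart_inv c (G y)" .
  have oV: "open (snd c ` V)" by (rule chart_image_open[OF ch V])
  have GH: "G ` H ` snd c ` V = snd c ` V" using H(4) by (force simp: image_iff)
  have cH: "continuous_on V (H \<circ> snd c)"
    by (intro continuous_on_compose continuous_on_subset[OF is_chartD(4)[OF ch] V(2)] smooth_on_continuous[OF H(2)])
  have cG: "continuous_on (H ` snd c ` V) (\<lambda>y. chart_inv c (G y))"
    by (rule continuous_on_compose2[OF is_chartD(5)[OF ch] smooth_on_continuous[OF H(3)]])
      (use GH V in blast)
  have "homeomorphism V ((H \<circ> snd c) ` V) (H \<circ> snd c) (inv_into V (H \<circ> snd c))"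
  proof (rule homeomorphismI[OF cH])
    show "continuous_on ((H \<circ> snd c) ` V) (inv_into V (H \<circ> snd c))"
      using cG by (rule iffD1[OF continuous_on_cong, rotated 2]) (auto simp: inv image_comp)
  qed (auto simp: inv cl H(4) image_comp)
  then have chart': "is_chart (V, H \<circ> snd c)"
    using V(1) H(1) inj by (simp add: is_chart_def image_comp)
  have "compatible (V, H \<circ> snd c) c'" if c': "c' \<in> A" for c'
  proof -
    note ch' = chart[OF c']
    have o: "open (V \<inter> fst c')" using V is_chartD(1)[OF ch'] by auto
    have o1: "open ((H \<circ> snd c) ` (V \<inter> fst c'))"
      using chart_image_open[OF chart', of "V \<inter> fst c'"] o by auto
    have o2: "open (snd c' ` (V \<inter> fst c'))"
      using chart_image_open[OF ch', of "V \<inter> fst c'"] o by auto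
    have o3: "open (snd c ` (V \<inter> fst c'))"
      using chart_image_open[OF ch, of "V \<inter> fst c'"] o V by auto
    have "smooth_on ((H \<circ> snd c) ` (V \<inter> fst c')) (\<lambda>y. snd c' (chart_inv c (G y)))"
      by (rule smooth_on_compose[OF o1 o3 smooth_on_subset[OF H(3)] smooth_on_subset[OF smooth_transition[OF c c']]])
        (use V H(4) in auto)
    then have 1: "smooth_on ((H \<circ> snd c) ` (V \<inter> fst c')) (\<lambda>y. snd c' (inv_into V (H \<circ> snd c) y))"
      by (rule iffD1[OF smooth_on_cong[OF o1], rotated]) (auto simp: inv)
    have "smooth_on (snd c' ` (V \<inter> fst c')) (\<lambda>y. H (snd c (chart_inv c' y)))"
      by (rule smooth_on_compose[OF o2 oV smooth_on_subset[OF smooth_transition[OF c' c]] H(2)])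
        (use V chart_inv_left[OF ch'] in auto)
    with 1 show ?thesis by (simp add: compatible_def split_beta o_def)
  qed
  then show "(V, H \<circ> snd c) \<in> A"
    using smooth_structure chart' unfolding smooth_structure_def by blast
qed

text \<open>The chain rule for \<open>f\<close> read through \<open>chart_inv c \<circ> G\<close>.
  The inverse \<open>G\<close> appears because coordinate vectors differentiate the inverse of the
  chart.\<close>

lemma coord_vec_diffeo:
  assumes c: "c \<in> A" and V: "open V" "V \<subseteq> fst c"
    and H: "open (H ` snd c ` V)" "smooth_on (snd c ` V) H" "smooth_on (H ` snd c ` V) G"
      "\<And>x. x \<in> snd c ` V \<Longrightarrow> G (H x) = x" and s: "s \<in> V"
  shows "coord_vec A (V, H \<circ> snd c) s u = coord_vec A c s (frechet_derivative G (at (H (snd c s))) u)"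
proof
  fix f
  show "coord_vec A (V, H \<circ> snd c) s u f = coord_vec A c s (frechet_derivative G (at (H (snd c s))) u) f"
  proof (cases "f \<in> smooth_fun A")
    case f: True
    let ?y = "H (snd c s)"
    have y: "?y \<in> H ` snd c ` V" using s by auto
    have "((\<lambda>x. f (chart_inv c x)) has_derivative
        frechet_derivative (\<lambda>x. f (chart_inv c x)) (at (G ?y))) (at (G ?y))"
      by (rule smooth_on_has_derivative[OF smooth_funD[OF f c]]) (use s V H(4) in auto)
    from has_derivative_compose[OF smooth_on_has_derivative[OF H(3) y] this]
    have "((\<lambda>y. f (inv_into V (H \<circ> snd c) y)) has_derivative
        (\<lambda>u. frechet_derivative (\<lambda>x. f (chart_inv c x)) (at (G ?y)) (frechet_derivative G (at ?y) u))) (at ?y)"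
      by (rule has_derivative_transform_within_open[OF _ H(1) y]) (simp add: chart_diffeo(2)[OF c V H])
    then show ?thesis
      using frechet_derivative_at H(4)[of "snd c s"] s f by (fastforce simp: coord_vec_eq)
  qed (simp add: coord_vec_eq)
qed

end

section \<open>Fields along a smooth map\<close>

locale smooth_mapping = A: smooth_manifold A + B: smooth_manifold B
  for A :: "('p::{t2_space,second_countable_topology}, 'e::euclidean_space) chart set"
    and B :: "('a::{t2_space,second_countable_topology}, 'b::euclidean_space) chart set" +
  fixes F :: "'p \<Rightarrow> 'a"
  assumes smooth_map: "smooth_map A B F"
begin

lemma continuous_map: "open V \<Longrightarrow> open (F -` V)"
  using smooth_map by (simp add: smooth_map_def open_vimage)

lemma smooth_local_expression:
  "c \<in> A \<Longrightarrow> d \<in> B \<Longrightarrow>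
    smooth_on (snd c ` (fst c \<inter> F -` fst d)) (\<lambda>x. snd d (F (chart_inv c x)))"
  using smooth_map by (auto simp: smooth_map_def split_beta o_def)

lemma domain_open:
  assumes c: "c \<in> A" "d \<in> B"
  shows "open (fst c \<inter> F -` fst d)" "open (snd c ` (fst c \<inter> F -` fst d))"
proof -
  show *: "open (fst c \<inter> F -` fst d)"
    by (intro open_Int continuous_map is_chartD(1)[OF A.chart[OF c(1)]] is_chartD(1)[OF B.chart[OF c(2)]])
  show "open (snd c ` (fst c \<inter> F -` fst d))"
    by (rule chart_image_open[OF A.chart[OF c(1)] *]) simp
qed

lemma smooth_fun_comp:
  assumes f: "f \<in> smooth_fun B"
  shows "(\<lambda>p. f (F p)) \<in> smooth_fun A"
proof (rule A.smooth_funI)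
  fix p
  obtain c where c: "c \<in> A" "p \<in> fst c" using A.ex_chart by blast
  obtain d where d: "d \<in> B" "F p \<in> fst d" using B.ex_chart by blast
  note o = domain_open[OF c(1) d(1)]
  have "smooth_on (snd c ` (fst c \<inter> F -` fst d)) (\<lambda>x. f (chart_inv d (snd d (F (chart_inv c x)))))"
    by (rule smooth_on_compose[OF o(2) B.image_open[OF d(1)] smooth_local_expression[OF c(1) d(1)]
          B.smooth_funD[OF f d(1)]])
      (auto simp: chart_inv_left[OF A.chart[OF c(1)]])
  then have "smooth_on (snd c ` (fst c \<inter> F -` fst d)) (\<lambda>x. f (F (chart_inv c x)))"
    by (rule iffD1[OF smooth_on_cong[OF o(2)], rotated])
      (auto simp: chart_inv_left[OF A.chart[OF c(1)]] chart_inv_left[OF B.chart[OF d(1)]])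
  then show "\<exists>c\<in>A. \<exists>V. open V \<and> p \<in> V \<and> V \<subseteq> fst c \<and> smooth_on (snd c ` V) (\<lambda>x. f (F (chart_inv c x)))"
    using c d o(1) by blast
qed

lemma field_alongD: "V \<in> fields_along A B F \<Longrightarrow> V p \<in> tangent_space B (F p)"
  "V \<in> fields_along A B F \<Longrightarrow> f \<in> smooth_fun B \<Longrightarrow> (\<lambda>p. V p f) \<in> smooth_fun A"
  by (auto simp: fields_along_def)

lemma field_along_add:
  "V \<in> fields_along A B F \<Longrightarrow> W \<in> fields_along A B F \<Longrightarrow> V + W \<in> fields_along A B F"
  using subspace_add[OF B.subspace_tangent_space] A.smooth_fun_add by (simp add: fields_along_def)

lemma field_along_scale:
  "f \<in> smooth_fun A \<Longrightarrow> V \<in> fields_along A B F \<Longrightarrow> (\<lambda>p. f p *\<^sub>R V p) \<in> fields_along A B F"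
  using subspace_scale[OF B.subspace_tangent_space] A.smooth_fun_mult
  by (simp add: fields_along_def scaleR_fun_def)

lemma field_along_zero: "0 \<in> fields_along A B F"
  using subspace_0[OF B.subspace_tangent_space] A.smooth_fun_const by (simp add: fields_along_def)

lemma field_along_sum:
  "(\<And>i. i \<in> I \<Longrightarrow> V i \<in> fields_along A B F) \<Longrightarrow> (\<Sum>i\<in>I. V i) \<in> fields_along A B F"
  by (induction I rule: infinite_finite_induct) (auto simp: field_along_zero field_along_add)

lemma field_along_local:
  assumes "\<And>p. \<exists>U V'. open U \<and> p \<in> U \<and> V' \<in> fields_along A B F \<and> (\<forall>q\<in>U. V q = V' q)"
  shows "V \<in> fields_along A B F"
proof -
  have "V p \<in> tangent_space B (F p)" for p using assms[of p] field_alongD(1) by metis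
  moreover have "(\<lambda>p. V p f) \<in> smooth_fun A" if f: "f \<in> smooth_fun B" for f
  proof (rule A.smooth_fun_local)
    fix p
    obtain U V' where "open U" "p \<in> U" "V' \<in> fields_along A B F" "\<forall>q\<in>U. V q = V' q" using assms[of p] by blast
    then show "\<exists>U g. open U \<and> p \<in> U \<and> g \<in> smooth_fun A \<and> (\<forall>q\<in>U. V q f = g q)"
      using field_alongD(2)[OF _ f] by (intro exI[of _ U] exI[of _ "\<lambda>p. V' p f"]) auto
  qed
  ultimately show ?thesis by (simp add: fields_along_def)
qed

lemma field_along_comp: "Y \<in> vector_fields B \<Longrightarrow> Y \<circ> F \<in> fields_along A B F"
  using smooth_fun_comp by (auto simp: fields_along_def)

lemma push_in:
  assumes v: "v \<in> tangent_space A p"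
  shows "push A B F v \<in> tangent_space B (F p)"
  by (rule B.tangent_spaceI)
    (simp_all add: push_def B.smooth_fun_add B.smooth_fun_mult B.smooth_fun_mult[OF B.smooth_fun_const]
      A.tangent_add[OF v] A.tangent_mult[OF v] A.tangent_scale[OF v] smooth_fun_comp o_def)

lemma push_linear: "linear (push A B F)"
  by (rule linearI; rule ext; simp add: push_def scaleR_fun_def)

lemma push_field:
  assumes X: "X \<in> vector_fields A"
  shows "(\<lambda>p. push A B F (X p)) \<in> fields_along A B F"
  unfolding fields_along_def
proof (intro CollectI conjI allI ballI)
  show "push A B F (X p) \<in> tangent_space B (F p)" for p
    by (rule push_in[OF A.vector_fieldD(1)[OF X]])
  show "(\<lambda>p. push A B F (X p) f) \<in> smooth_fun A" if "f \<in> smooth_fun B" for f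
    using A.vector_fieldD(2)[OF X smooth_fun_comp[OF that]] that by (simp add: push_def o_def)
qed

lemma push_coord_vec:
  assumes c: "c \<in> A" "p \<in> fst c" and d: "d \<in> B" "F p \<in> fst d"
  shows "push A B F (coord_vec A c p u) =
    coord_vec B d (F p) (frechet_derivative (\<lambda>x. snd d (F (chart_inv c x))) (at (snd c p)) u)"
proof
  fix f
  show "push A B F (coord_vec A c p u) f =
    coord_vec B d (F p) (frechet_derivative (\<lambda>x. snd d (F (chart_inv c x))) (at (snd c p)) u) f"
  proof (cases "f \<in> smooth_fun B")
    case f: True
    let ?h = "\<lambda>x. snd d (F (chart_inv c x))"
    have p: "chart_inv c (snd c p) = p" by (rule chart_inv_left[OF A.chart[OF c(1)] c(2)])
    have x: "snd c p \<in> snd c ` (fst c \<inter> F -` fst d)" using c d by auto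
    have "((\<lambda>y. f (chart_inv d y)) has_derivative
        frechet_derivative (\<lambda>y. f (chart_inv d y)) (at (?h (snd c p)))) (at (?h (snd c p)))"
      by (rule smooth_on_has_derivative[OF B.smooth_funD[OF f d(1)]]) (use d p in auto)
    from has_derivative_compose[OF smooth_on_has_derivative[OF smooth_local_expression[OF c(1) d(1)] x] this]
    have "((\<lambda>x. f (F (chart_inv c x))) has_derivative (\<lambda>u. frechet_derivative (\<lambda>y. f (chart_inv d y))
        (at (?h (snd c p))) (frechet_derivative ?h (at (snd c p)) u))) (at (snd c p))"
      by (rule has_derivative_transform_within_open[OF _ domain_open(2)[OF c(1) d(1)] x])
        (auto simp: chart_inv_left[OF A.chart[OF c(1)]] chart_inv_left[OF B.chart[OF d(1)]])
    from fun_cong[OF frechet_derivative_at[OF this], of u] show ?thesis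
      using f smooth_fun_comp[OF f] p by (simp add: push_def A.coord_vec_eq B.coord_vec_eq o_def)
  qed (simp add: push_def B.coord_vec_eq)
qed

lemma field_along_coords_smooth:
  assumes V: "V \<in> fields_along A B F" and c: "c \<in> A" "d \<in> B"
  shows "smooth_on (snd c ` (fst c \<inter> F -` fst d))
    (\<lambda>x. B.coords d (F (chart_inv c x)) (V (chart_inv c x)))"
proof (rule smooth_on_componentwise[OF domain_open(2)[OF c]], rule smooth_on_local)
  note ch = A.chart[OF c(1)]
  fix b x assume "x \<in> snd c ` (fst c \<inter> F -` fst d)"
  then obtain p where p: "p \<in> fst c" "F p \<in> fst d" "x = snd c p" by auto
  obtain N \<xi> where pN: "F p \<in> N" and co: "B.coordinate_functions d N \<xi>"
    using B.local_coordinates[OF c(2) p(2)] by blast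
  note N = B.coordinate_functionsD[OF co]
  let ?U = "fst c \<inter> F -` N"
  have o: "open (snd c ` ?U)"
    by (rule chart_image_open[OF ch]) (use N(1) is_chartD(1)[OF ch] continuous_map in auto)
  have "smooth_on (snd c ` ?U) (\<lambda>x. V (chart_inv c x) (\<xi> b))"
    by (rule smooth_on_subset[OF A.smooth_funD[OF field_alongD(2)[OF V N(3)] c(1)]]) auto
  then have "smooth_on (snd c ` ?U) (\<lambda>x. B.coords d (F (chart_inv c x)) (V (chart_inv c x)) \<bullet> b)"
    by (rule iffD1[OF smooth_on_cong[OF o], rotated])
      (use chart_inv_left[OF ch] B.coords_inner[OF c(2) co _ field_alongD(1)[OF V]] in auto)
  moreover have "x \<in> snd c ` ?U" using p pN by auto
  ultimately show "\<exists>T. open T \<and> x \<in> T \<and>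
      smooth_on T (\<lambda>x. B.coords d (F (chart_inv c x)) (V (chart_inv c x)) \<bullet> b)"
    using o by blast
qed

end

section \<open>Immersions and the pull-back of tangent fields\<close>

lemma linear_projection_exists:
  fixes E :: "'a::euclidean_space set"
  assumes "subspace E"
  obtains P where "linear P" "range P \<subseteq> E" "\<And>u. u \<in> E \<Longrightarrow> P u = u"
  using linear_exists_left_inverse_on[OF linear_id assms] by auto

text \<open>Frames are independent as sets, whereas Gram-Schmidt asks that each image vector lie
  outside the span of the earlier ones; this translates between the two.\<close>

lemma inj_on_independent_image_notin_span:
  fixes s :: "nat \<Rightarrow> 'a::real_vector" and T :: "'a \<Rightarrow> 'b::real_vector"
  assumes inj: "inj_on s {..<k}" and ind: "independent (s ` {..<k})"
    and lin: "linear T" and T: "inj_on T (span (s ` {..<k}))" and i: "i < k"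
  shows "T (s i) \<notin> span ((\<lambda>j. T (s j)) ` {..<i})"
proof
  have "s j \<in> s ` {..<k} - {s i}" if "j < i" for j
    using that i inj_on_eq_iff[OF inj, of j i] by auto
  then have sub: "s ` {..<i} \<subseteq> s ` {..<k} - {s i}"
    by (intro image_subsetI) (simp only: lessThan_iff)
  assume "T (s i) \<in> span ((\<lambda>j. T (s j)) ` {..<i})"
  also have "(\<lambda>j. T (s j)) ` {..<i} = T ` s ` {..<i}" by (simp add: image_image)
  finally obtain v where v: "v \<in> span (s ` {..<i})" "T (s i) = T v"
    unfolding linear_span_image[OF lin] by (rule imageE)
  moreover have "v \<in> span (s ` {..<k})"
    using v(1) span_mono[of "s ` {..<i}" "s ` {..<k}"] sub by blast
  moreover have "s i \<in> span (s ` {..<k})" using i by (intro span_base) auto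
  ultimately have "s i = v" using T by (auto dest: inj_onD)
  then have "s i \<in> span (s ` {..<k} - {s i})" using v(1) span_mono[OF sub] by auto
  then show False using ind i by (auto simp: dependent_def)
qed

locale smooth_immersion = smooth_mapping A B F
  for A :: "('p::{t2_space,second_countable_topology}, 'e::euclidean_space) chart set"
    and B :: "('a::{t2_space,second_countable_topology}, 'b::euclidean_space) chart set"
    and F :: "'p \<Rightarrow> 'a" +
  assumes immersion: "\<And>p. inj_on (push A B F) (tangent_space A p)"
begin

lemma inj_derivative:
  assumes c: "c \<in> A" "p \<in> fst c" and d: "d \<in> B" "F p \<in> fst d"
  shows "inj (frechet_derivative (\<lambda>x. snd d (F (chart_inv c x))) (at (snd c p)))"
proof (rule injI)
  fix u v assume "frechet_derivative (\<lambda>x. snd d (F (chart_inv c x))) (at (snd c p)) u =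
    frechet_derivative (\<lambda>x. snd d (F (chart_inv c x))) (at (snd c p)) v"
  then have "push A B F (coord_vec A c p u) = push A B F (coord_vec A c p v)"
    by (simp add: push_coord_vec[OF c d])
  then have "coord_vec A c p u = coord_vec A c p v"
    using immersion[of p] A.coord_vec_in[OF c] by (auto dest: inj_onD)
  then show "u = v" using A.inj_coord_vec[OF c] by (auto dest: injD)
qed

text \<open>Injectivity of the differential determines \<open>X\<close> pointwise; the issue is
  smoothness. In charts the differential has a left inverse depending smoothly on the point, which
  expresses the components of \<open>X\<close> through those of \<open>V\<close>.\<close>

lemma pull_back_field:
  assumes V: "V \<in> fields_along A B F" and tan: "\<And>p. V p \<in> tan_bundle A B F p"
  obtains X where "X \<in> vector_fields A" "\<And>p. V p = push A B F (X p)"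
proof -
  define X where "X p = inv_into (tangent_space A p) (push A B F) (V p)" for p
  have XT: "X p \<in> tangent_space A p" and VX: "V p = push A B F (X p)" for p
    using tan[of p] unfolding tan_bundle_def X_def by (auto intro: inv_into_into simp: f_inv_into_f)
  interpret id: smooth_mapping A A "\<lambda>p. p"
    by unfold_locales (rule A.smooth_map_id)
  have "X \<in> vector_fields A"
  proof (rule id.field_along_local)
    fix p
    obtain c where c: "c \<in> A" "p \<in> fst c" using A.ex_chart by blast
    obtain d where d: "d \<in> B" "F p \<in> fst d" using B.ex_chart by blast
    note ch = A.chart[OF c(1)]
    let ?h = "\<lambda>x. snd d (F (chart_inv c x))"
    let ?W = "snd c ` (fst c \<inter> F -` fst d)"
    define T where "T x = frechet_derivative ?h (at x)" for x
    have sh: "smooth_on ?W ?h" by (rule smooth_local_expression[OF c(1) d(1)])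
    have linT: "linear (T x)" if "x \<in> ?W" for x
      unfolding T_def by (rule has_derivative_linear[OF smooth_on_has_derivative[OF sh that]])
    define k where "k = card (Basis :: 'e set)"
    \<comment> \<open>An enumeration of the standard basis, used as a constant frame of the source,
      whose span is the whole model space.\<close>
    obtain s where s: "bij_betw s {..<k} (Basis :: 'e set)"
      using ex_bij_betw_nat_finite[OF finite_Basis] unfolding k_def lessThan_atLeast0 by blast
    have sB: "s ` {..<k} = Basis" using s by (rule bij_betw_imp_surj_on)
    have pW: "snd c p \<in> ?W" using c d by auto
    have ind: "T (snd c p) (s i) \<notin> span ((\<lambda>j. T (snd c p) (s j)) ` {..<i})" if "i < k" for i
      by (rule inj_on_independent_image_notin_span[OF bij_betw_imp_inj_on[OF s] _ linT[OF pW] _ that])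
        (use inj_derivative[OF c d] in \<open>auto simp: sB T_def independent_Basis intro: inj_on_subset\<close>)
    obtain U R where U: "open U" "snd c p \<in> U" "U \<subseteq> ?W"
      and RT: "\<And>x v. x \<in> U \<Longrightarrow> v \<in> span ((\<lambda>i. s i) ` {..<k}) \<Longrightarrow> R x (T x v) = v"
      and sR: "\<And>Y w. open Y \<Longrightarrow> Y \<subseteq> U \<Longrightarrow> smooth_on Y w \<Longrightarrow> smooth_on Y (\<lambda>x. R x (w x))"
    proof (rule smooth_left_inverse[OF domain_open(2)[OF c(1) d(1)] pW, of T k "\<lambda>i x. s i"])
      show "smooth_on ?W (\<lambda>x. s i)" for i
        by (rule smooth_on_const[OF domain_open(2)[OF c(1) d(1)]])
      show "smooth_on ?W (\<lambda>x. T x (s i))" for i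
        unfolding T_def by (rule smooth_on_derivative[OF sh])
    qed (use ind linT in auto)
    \<comment> \<open>The components that \<open>X\<close> must have, obtained by applying the
      smooth left inverse to the components of \<open>V\<close>.\<close>
    define w where "w x = R x (B.coords d (F (chart_inv c x)) (V (chart_inv c x)))" for x
    define O' where "O' = fst c \<inter> snd c -` U"
    have O': "open O'" "O' \<subseteq> fst c" "p \<in> O'" "snd c ` O' = U"
    proof -
      show "open O'" unfolding O'_def by (rule chart_preimage_open[OF ch U(1)])
      show "O' \<subseteq> fst c" "p \<in> O'" using U(2) c by (auto simp: O'_def)
      show "snd c ` O' = U" using U(3) by (auto simp: O'_def)
    qed
    have "smooth_on U w"
      unfolding w_def
      by (intro sR U order_refl smooth_on_subset[OF field_along_coords_smooth[OF V c(1) d(1)] U(3)])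
    then have "smooth_on (snd c ` O') w" by (simp only: O'(4))
    then obtain X' N where X': "X' \<in> vector_fields A" "open N" "p \<in> N" "N \<subseteq> O'"
      "\<And>q. q \<in> N \<Longrightarrow> X' q = coord_vec A c q (w (snd c q))"
      by (rule A.local_vector_field[OF c(1) O'(1-3)]) (rule that; assumption)
    have "X q = X' q" if q: "q \<in> N" for q
    proof -
      have qc: "q \<in> fst c" "snd c q \<in> U" using q X'(4) by (auto simp: O'_def)
      then obtain q' where "q' \<in> fst c" "F q' \<in> fst d" "snd c q = snd c q'" using U(3) by auto
      then have qU: "q \<in> fst c" "F q \<in> fst d" "snd c q \<in> U"
        using qc inj_onD[OF is_chartD(3)[OF ch], of q q'] by simp_all
      have "V q = push A B F (coord_vec A c q (A.coords c q (X q)))"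
        using VX A.coord_vec_coords[OF c(1) qU(1) XT] by simp
      also have "\<dots> = coord_vec B d (F q) (T (snd c q) (A.coords c q (X q)))"
        unfolding T_def by (rule push_coord_vec[OF c(1) qU(1) d(1) qU(2)])
      finally have "B.coords d (F q) (V q) = T (snd c q) (A.coords c q (X q))"
        using B.coords_coord_vec[OF d(1) qU(2)] by simp
      then have "w (snd c q) = A.coords c q (X q)"
        using RT[OF qU(3), of "A.coords c q (X q)"] chart_inv_left[OF ch qU(1)]
        by (simp add: w_def sB)
      then show ?thesis
        using X'(5)[OF q] A.coord_vec_coords[OF c(1) qU(1) XT] by simp
    qed
    then show "\<exists>U V'. open U \<and> p \<in> U \<and> V' \<in> vector_fields A \<and> (\<forall>q\<in>U. X q = V' q)"
      using X' by blast
  qed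
  then show thesis using that VX by blast
qed

end

section \<open>The Frobenius theorem\<close>

context smooth_manifold
begin

text \<open>In a slice chart the component maps of \<open>X\<close> and \<open>Y\<close> have values
  in \<open>E\<close>, but this is known only at points of the slice. It suffices, because the
  bracket differentiates them only in directions that lie in \<open>E\<close> themselves.\<close>

lemma integrable_imp_involutive:
  assumes int: "integrable_distribution A \<Delta>"
    and X: "X \<in> vector_fields A" "\<And>p. X p \<in> \<Delta> p" and Y: "Y \<in> vector_fields A" "\<And>p. Y p \<in> \<Delta> p"
  shows "lie_bracket X Y p \<in> \<Delta> p"
proof -
  obtain S where S: "p \<in> S" "integral_manifold A \<Delta> S"
    using int unfolding integrable_distribution_def by blast
  from bspec[OF S(2)[unfolded integral_manifold_def] S(1)]
  obtain c E where c: "c \<in> A" "p \<in> fst c" and E: "subspace E"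
    "snd c ` (fst c \<inter> S) = chart_image c \<inter> E" "\<forall>s\<in>fst c \<inter> S. \<Delta> s = coord_vec A c s ` E"
    by (elim bexE exE conjE) (rule that)
  have E': "\<Delta> s = coord_vec A c s ` E" if "s \<in> fst c \<inter> S" for s using E(3) that by (rule bspec)
  note ch = chart[OF c(1)]
  let ?x = "snd c p"
  define v where "v Z x = coords c (chart_inv c x) (Z (chart_inv c x))" for Z x
  have vE: "v Z x \<in> E" if Z: "\<And>p. Z p \<in> \<Delta> p" and x: "x \<in> chart_image c" "x \<in> E" for Z x
  proof -
    obtain s where s: "s \<in> fst c \<inter> S" "x = snd c s" using E(2) x by blast
    then obtain u where "u \<in> E" "Z s = coord_vec A c s u" using E'[OF s(1)] Z[of s] by blast
    then show ?thesis
      using s coords_coord_vec[OF c(1)] by (simp add: v_def chart_inv_left[OF ch])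
  qed
  have xE: "?x \<in> chart_image c" "?x \<in> E" using E(2) S(1) c(2) by blast+
  have dv: "(v Z has_derivative frechet_derivative (v Z) (at ?x)) (at ?x)" if "Z \<in> vector_fields A" for Z
    using smooth_on_has_derivative[OF vector_field_coords_smooth[OF that c(1)] xE(1)]
    unfolding v_def[abs_def] .
  obtain P where P: "linear P" "range P \<subseteq> E" "\<And>u. u \<in> E \<Longrightarrow> P u = u"
    using linear_projection_exists[OF E(1)] by blast
  have dvE: "frechet_derivative (v Z) (at ?x) e \<in> E"
    if Z: "Z \<in> vector_fields A" "\<And>p. Z p \<in> \<Delta> p" and e: "e \<in> E" for Z e
  proof -
    let ?D = "frechet_derivative (v Z) (at ?x)"
    \<comment> \<open>The parameters for which the line through \<open>?x\<close> in direction
      \<open>e\<close> stays in the chart image; along it the part of \<open>v Z\<close>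
      complementary to \<open>E\<close> vanishes.\<close>
    define T where "T = (\<lambda>t::real. ?x + t *\<^sub>R e) -` chart_image c"
    have T: "open T" "0 \<in> T"
      unfolding T_def using xE(1)
      by (auto intro!: open_vimage image_open c continuous_intros)
    have "((\<lambda>t::real. ?x + t *\<^sub>R e) has_derivative (\<lambda>t. t *\<^sub>R e)) (at 0)"
      by (auto intro!: derivative_eq_intros)
    moreover have "(v Z has_derivative ?D) (at (?x + 0 *\<^sub>R e))" using dv[OF Z(1)] by simp
    ultimately have d: "((\<lambda>t. v Z (?x + t *\<^sub>R e)) has_derivative (\<lambda>t. ?D (t *\<^sub>R e))) (at 0)"
      by (rule has_derivative_compose)
    have "((\<lambda>t. v Z (?x + t *\<^sub>R e) - P (v Z (?x + t *\<^sub>R e))) has_derivative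
        (\<lambda>t. ?D (t *\<^sub>R e) - P (?D (t *\<^sub>R e)))) (at 0)"
      using P(1) by (intro has_derivative_diff d bounded_linear.has_derivative[OF _ d])
        (simp add: linear_conv_bounded_linear)
    moreover have "((\<lambda>t. v Z (?x + t *\<^sub>R e) - P (v Z (?x + t *\<^sub>R e))) has_derivative (\<lambda>t. 0)) (at 0)"
    proof (rule has_derivative_transform_within_open[OF _ T])
      show "((\<lambda>t::real. 0::'e) has_derivative (\<lambda>t. 0)) (at 0)" by simp
      fix t assume "t \<in> T"
      then have "v Z (?x + t *\<^sub>R e) \<in> E"
        using xE(2) e E(1) by (intro vE Z) (auto simp: T_def subspace_add subspace_scale)
      then show "0 = v Z (?x + t *\<^sub>R e) - P (v Z (?x + t *\<^sub>R e))" using P(3) by simp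
    qed
    ultimately have "(\<lambda>t. ?D (t *\<^sub>R e) - P (?D (t *\<^sub>R e))) = (\<lambda>t::real. 0)"
      by (rule has_derivative_unique)
    from fun_cong[OF this, of 1] have "?D e = P (?D e)" by simp
    then show ?thesis using P(2) by (metis rangeI subsetD)
  qed
  have rep: "Z q = coord_vec A c q (v Z (snd c q))" if "Z \<in> vector_fields A" "q \<in> fst c" for Z q
    using coord_vec_coords[OF c(1) that(2) vector_fieldD(1)[OF that(1)]] that(2)
    by (simp add: v_def chart_inv_left[OF ch])
  have "lie_bracket X Y p = coord_vec A c p
      (frechet_derivative (v Y) (at ?x) (v X ?x) - frechet_derivative (v X) (at ?x) (v Y ?x))"
    by (rule lie_bracket_coords[OF X(1) Y(1) c is_chartD(1)[OF ch] c(2) order_refl])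
      (use rep X(1) Y(1) dv in auto)
  moreover have "frechet_derivative (v Y) (at ?x) (v X ?x) - frechet_derivative (v X) (at ?x) (v Y ?x) \<in> E"
    by (intro subspace_diff[OF E(1)] dvE X Y vE xE)
  ultimately show ?thesis using E'[of p] c(2) S(1) by simp
qed

text \<open>Only the leaf through one point is needed, so no foliated chart is built: with \<open>\<Delta>\<close> given
  near \<open>p\<close> as the graphs of \<open>a x : E \<rightarrow> ker P\<close>, the leaf is the graph of a solution of
  \<open>Dy = a (x + y)\<close> and \<open>x \<mapsto> x - y (P x)\<close> straightens it.\<close>

theorem Frobenius:
  fixes k :: nat
  assumes U: "open U" "p \<in> U"
    and X: "\<And>i. i < k \<Longrightarrow> X i \<in> vector_fields A"
    and frame: "\<And>q. q \<in> U \<Longrightarrow> \<Delta> q = span ((\<lambda>i. X i q) ` {..<k})"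
    and indep: "inj_on (\<lambda>i. X i p) {..<k}" "independent ((\<lambda>i. X i p) ` {..<k})"
    and zero: "\<And>q. 0 \<in> \<Delta> q"
    and inv: "\<And>X Y q. X \<in> vector_fields A \<Longrightarrow> Y \<in> vector_fields A \<Longrightarrow> (\<And>q. X q \<in> \<Delta> q) \<Longrightarrow>
      (\<And>q. Y q \<in> \<Delta> q) \<Longrightarrow> lie_bracket X Y q \<in> \<Delta> q"
  obtains S where "p \<in> S" "integral_manifold A \<Delta> S"
proof -
  obtain c0 where c0: "c0 \<in> A" "p \<in> fst c0" using ex_chart by blast
  \<comment> \<open>The chart is translated so that \<open>p\<close> has coordinate 0, the base
    point of the total differential equation.\<close>
  define c where "c = (fst c0, (\<lambda>x. x - snd c0 p) \<circ> snd c0)"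
  have shift: "(\<lambda>x. x - snd c0 p) ` chart_image c0 = (\<lambda>x. - snd c0 p + x) ` chart_image c0"
    by auto
  have o: "open ((\<lambda>x. x - snd c0 p) ` chart_image c0)"
    unfolding shift using image_open[OF c0(1)] by (rule open_translation)
  have "(fst c0, (\<lambda>x. x - snd c0 p) \<circ> snd c0) \<in> A"
    by (rule chart_diffeo(1)[OF c0(1) is_chartD(1)[OF chart[OF c0(1)]] order_refl o, of "\<lambda>x. x + snd c0 p"])
      (use o image_open[OF c0(1)] in \<open>auto intro!: smooth_on_diff smooth_on_add smooth_on_id smooth_on_const\<close>)
  then have c: "c \<in> A" "p \<in> fst c" "snd c p = 0" using c0 by (auto simp: c_def)
  note ch = chart[OF c(1)]
  define V0 where "V0 = fst c \<inter> U"
  have V0: "open V0" "V0 \<subseteq> fst c" "p \<in> V0"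
    using U c is_chartD(1)[OF ch] by (auto simp: V0_def)
  define W0 where "W0 = snd c ` V0"
  have W0: "open W0" "0 \<in> W0"
    unfolding W0_def using chart_image_open[OF ch V0(1,2)] V0(3) c(3) by (auto simp: image_iff intro: bexI[of _ p])
  define s where "s i x = coords c (chart_inv c x) (X i (chart_inv c x))" for i x
  have ss: "smooth_on W0 (s i)" if "i < k" for i
    unfolding s_def using V0(2)
    by (intro smooth_on_subset[OF vector_field_coords_smooth[OF X[OF that] c(1)]]) (auto simp: W0_def)
  define \<Delta>' where "\<Delta>' x = span ((\<lambda>i. s i x) ` {..<k})" for x
  have Xs: "X i q = coord_vec A c q (s i (snd c q))" if "i < k" "q \<in> fst c" for i q
    using coord_vec_coords[OF c(1) that(2) vector_fieldD(1)[OF X[OF that(1)]]] that(2)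
    by (simp add: s_def chart_inv_left[OF ch])
  have \<Delta>\<Delta>': "\<Delta> q = coord_vec A c q ` \<Delta>' (snd c q)" if q: "q \<in> V0" for q
  proof -
    have "(\<lambda>i. X i q) ` {..<k} = coord_vec A c q ` (\<lambda>i. s i (snd c q)) ` {..<k}"
      unfolding image_image by (rule image_cong) (use Xs q in \<open>auto simp: V0_def\<close>)
    then show ?thesis
      using frame q V0(2) linear_span_image[OF coord_vec_linear[OF c(1), of q]]
      by (auto simp: V0_def \<Delta>'_def)
  qed
  \<comment> \<open>The coordinate plane of the distribution at \<open>p\<close>. Nearby planes are
    compared with it through the projection \<open>P\<close>.\<close>
  define E where "E = \<Delta>' 0"
  have E: "subspace E" by (simp add: E_def \<Delta>'_def)
  obtain P where P: "linear P" "range P \<subseteq> E" "\<And>u. u \<in> E \<Longrightarrow> P u = u"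
    using linear_projection_exists[OF E] by blast
  have PE: "P u \<in> E" for u using P(2) by auto
  have PP: "P (P u) = P u" for u by (rule P(3)[OF PE])

  have ind: "P (s i 0) \<notin> span ((\<lambda>j. P (s j 0)) ` {..<i})" if i: "i < k" for i
  proof -
    have sE: "s j 0 \<in> E" if "j < k" for j
      unfolding E_def \<Delta>'_def using that by (intro span_base) auto
    have "(\<lambda>j. P (s j 0)) ` {..<i} = (\<lambda>j. s j 0) ` {..<i}"
      by (rule image_cong[OF refl], rule P(3)[OF sE]) (use i in auto)
    moreover have "s i 0 \<notin> span ((\<lambda>j. s j 0) ` {..<i})"
    proof
      assume "s i 0 \<in> span ((\<lambda>j. s j 0) ` {..<i})"
      then have "coord_vec A c p (s i 0) \<in> span (coord_vec A c p ` (\<lambda>j. s j 0) ` {..<i})"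
        using linear_span_image[OF coord_vec_linear[OF c(1,2)]] by blast
      moreover have "coord_vec A c p ` (\<lambda>j. s j 0) ` {..<i} = (\<lambda>j. X j p) ` {..<i}"
        unfolding image_image by (rule image_cong) (use Xs c i in auto)
      ultimately have "X i p \<in> span ((\<lambda>j. X j p) ` {..<i})"
        using Xs[OF i c(2)] c(3) by simp
      then show False
        using inj_on_independent_image_notin_span[OF indep linear_id _ i] by simp
    qed
    ultimately show ?thesis using P(3)[OF sE[OF i]] by simp
  qed
  obtain W R where W: "open W" "0 \<in> W" "W \<subseteq> W0" and linR: "\<And>x. x \<in> W \<Longrightarrow> linear (R x)"
    and R\<Delta>: "\<And>x w. x \<in> W \<Longrightarrow> R x w \<in> \<Delta>' x"
    and RP: "\<And>x v. x \<in> W \<Longrightarrow> v \<in> \<Delta>' x \<Longrightarrow> R x (P v) = v"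
    and dimP: "\<And>x. x \<in> W \<Longrightarrow> dim (P ` \<Delta>' x) = k"
    and sR: "\<And>Y w. open Y \<Longrightarrow> Y \<subseteq> W \<Longrightarrow> smooth_on Y w \<Longrightarrow> smooth_on Y (\<lambda>x. R x (w x))"
  proof (rule smooth_left_inverse[OF W0, of "\<lambda>x. P" k s])
    show "smooth_on W0 (\<lambda>x. P (s i x))" if "i < k" for i
      using P(1) by (intro smooth_on_bounded_linear[OF _ W0(1) ss[OF that]])
        (simp add: linear_conv_bounded_linear)
  qed (use P(1) ss ind in \<open>auto simp: \<Delta>'_def\<close>)
  \<comment> \<open>A dimension count: \<open>P\<close> sends each nearby plane into
    \<open>E\<close> with image of dimension \<open>k\<close>, and \<open>E\<close> has dimension at
    most \<open>k\<close>, so the image is all of \<open>E\<close>.\<close>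
  have P\<Delta>: "P ` \<Delta>' x = E" if x: "x \<in> W" for x
  proof (rule subspace_dim_equal[OF _ E])
    show "subspace (P ` \<Delta>' x)" by (intro linear_subspace_image[OF P(1)]) (simp add: \<Delta>'_def)
    show "P ` \<Delta>' x \<subseteq> E" using PE by auto
    have "dim E \<le> card ((\<lambda>i. s i 0) ` {..<k})"
      unfolding E_def \<Delta>'_def dim_span by (rule dim_le_card) (auto intro: span_base)
    also have "\<dots> \<le> k" using card_image_le[of "{..<k}"] by simp
    finally show "dim E \<le> dim (P ` \<Delta>' x)" using dimP[OF x] by simp
  qed
  have PR: "P (R x u) = u" if "x \<in> W" "u \<in> E" for x u
    using P\<Delta>[OF that(1)] RP[OF that(1)] that(2) by (metis imageE)
  have \<Delta>'E: "\<Delta>' x = R x ` E" if "x \<in> W" for x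
    using P\<Delta>[OF that] RP[OF that] R\<Delta>[OF that] by force
  \<comment> \<open>\<open>R x\<close> lifts \<open>E\<close> to the plane at \<open>x\<close>;
    subtracting \<open>P u\<close> leaves the vertical part. Precomposition with \<open>P\<close>
    makes it a linear map on the whole space.\<close>
  define a where "a x u = R x (P u) - P u" for x u
  have sa: "smooth_on W (\<lambda>x. a x u)" for u
    unfolding a_def by (intro smooth_on_diff W sR order_refl smooth_on_const)
  have Pa: "P (a x u) = 0" if "x \<in> W" for x u
    by (simp add: a_def linear_diff[OF P(1)] PR[OF that PE] PP)
  have aR: "u + a x u = R x u" if "P u = u" for x u using that by (simp add: a_def)
  have da: "((\<lambda>z. a z u) has_derivative frechet_derivative (\<lambda>z. a z u) (at x)) (at x)" if "x \<in> W" for x u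
    by (rule smooth_on_has_derivative[OF sa that])
  have inva: "frechet_derivative (\<lambda>z. a z v) (at x) (u + a x u) = frechet_derivative (\<lambda>z. a z u) (at x) (v + a x v)"
    if x: "x \<in> W" and u: "P u = u" and v: "P v = v" for x u v
  proof -
    define q where "q = chart_inv c x"
    define V1 where "V1 = V0 \<inter> (fst c \<inter> snd c -` W)"
    have xc: "x \<in> W0" using x W(3) by auto
    have q: "q \<in> V0" "snd c q = x"
      using xc V0(2) chart_inv_left[OF ch] unfolding q_def W0_def by auto
    have V1: "open V1" "V1 \<subseteq> fst c" "q \<in> V1" "snd c ` V1 \<subseteq> W" "V1 \<subseteq> V0"
      using q x V0 chart_preimage_open[OF ch W(1)] unfolding V1_def by auto
    have oV1: "open (snd c ` V1)" by (rule chart_image_open[OF ch V1(1,2)])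
    \<comment> \<open>The involutivity hypothesis concerns global fields with values in
      \<open>\<Delta>\<close> everywhere. The lifted field is cut off, and off \<open>V1\<close> it
      is 0, which lies in \<open>\<Delta>\<close>.\<close>
    have ext: "\<exists>Y N. Y \<in> vector_fields A \<and> (\<forall>q. Y q \<in> \<Delta> q) \<and> open N \<and> q \<in> N \<and> N \<subseteq> V1 \<and>
        (\<forall>q\<in>N. Y q = coord_vec A c q (R (snd c q) w))" for w
    proof -
      have "smooth_on (snd c ` V1) (\<lambda>x. R x w)"
        by (rule sR[OF oV1 V1(4) smooth_on_const[OF oV1]])
      then obtain Y N and \<rho> :: "'p \<Rightarrow> real"
        where Y: "Y \<in> vector_fields A" "open N" "q \<in> N" "N \<subseteq> V1"
        "\<And>q. q \<in> N \<Longrightarrow> Y q = coord_vec A c q (R (snd c q) w)"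
        "\<And>q. q \<in> V1 \<Longrightarrow> Y q = \<rho> q *\<^sub>R coord_vec A c q (R (snd c q) w)" "\<And>q. q \<notin> V1 \<Longrightarrow> Y q = 0"
        by (rule local_vector_field[OF c(1) V1(1-3)]) (rule that; assumption)
      have "Y q \<in> \<Delta> q" for q
      proof (cases "q \<in> V1")
        case True
        then have "coord_vec A c q (R (snd c q) w) \<in> \<Delta> q"
          using \<Delta>\<Delta>'[of q] R\<Delta>[of "snd c q" w] V1(4,5) by blast
        moreover have "q \<in> U" using True V1(5) by (auto simp: V0_def)
        ultimately show ?thesis using Y(6)[OF True] frame[of q] by (simp add: span_scale)
      qed (simp add: Y(7) zero)
      then show ?thesis using Y by blast
    qed
    obtain Yu Nu where Yu: "Yu \<in> vector_fields A" "\<And>q. Yu q \<in> \<Delta> q" "open Nu" "q \<in> Nu" "Nu \<subseteq> V1"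
      "\<And>q. q \<in> Nu \<Longrightarrow> Yu q = coord_vec A c q (R (snd c q) u)" using ext[of u] by blast
    obtain Yv Nv where Yv: "Yv \<in> vector_fields A" "\<And>q. Yv q \<in> \<Delta> q" "open Nv" "q \<in> Nv" "Nv \<subseteq> V1"
      "\<And>q. q \<in> Nv \<Longrightarrow> Yv q = coord_vec A c q (R (snd c q) v)" using ext[of v] by blast
    have dR: "((\<lambda>z. R z w) has_derivative frechet_derivative (\<lambda>z. a z w) (at (snd c q))) (at (snd c q))"
      if "P w = w" for w
      using has_derivative_add[OF has_derivative_const da[OF x], of w w] aR[OF that] q(2) by simp
    let ?z = "frechet_derivative (\<lambda>z. a z v) (at x) (R x u) - frechet_derivative (\<lambda>z. a z u) (at x) (R x v)"
    have qc: "q \<in> fst c" using q(1) V0(2) by auto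
    have N: "open (Nu \<inter> Nv)" "q \<in> Nu \<inter> Nv" "Nu \<inter> Nv \<subseteq> fst c"
      using Yu(3,4,5) Yv(3,4) V1(2) by auto
    have "lie_bracket Yu Yv q = coord_vec A c q
        (frechet_derivative (\<lambda>z. a z v) (at (snd c q)) (R (snd c q) u) -
         frechet_derivative (\<lambda>z. a z u) (at (snd c q)) (R (snd c q) v))"
      by (rule lie_bracket_coords[OF Yu(1) Yv(1) c(1) qc N _ dR[OF u] _ dR[OF v]])
        (use Yu(6) Yv(6) in simp_all)
    then have "lie_bracket Yu Yv q = coord_vec A c q ?z" by (simp only: q(2))
    then have "coord_vec A c q ?z \<in> coord_vec A c q ` \<Delta>' x"
      using inv[OF Yu(1) Yv(1) Yu(2) Yv(2), of q] \<Delta>\<Delta>'[OF q(1)] q(2) by simp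
    then have z: "?z \<in> \<Delta>' x"
      using inj_coord_vec[OF c(1), of q] q(1) V0(2) by (auto dest: injD)
    \<comment> \<open>The lifts of constant vectors have constant projections, so their bracket
      projects to 0. It also lies in the plane at \<open>x\<close>, on which \<open>P\<close> is
      injective; hence it vanishes.\<close>
    have Pd: "P (frechet_derivative (\<lambda>z. a z w) (at x) e) = 0" for w e
    proof -
      have "((\<lambda>z. P (a z w)) has_derivative (\<lambda>e. P (frechet_derivative (\<lambda>z. a z w) (at x) e))) (at x)"
        using P(1) by (intro bounded_linear.has_derivative[OF _ da[OF x]]) (simp add: linear_conv_bounded_linear)
      moreover have "((\<lambda>z. P (a z w)) has_derivative (\<lambda>e. 0)) (at x)"
        by (rule has_derivative_transform_within_open[OF has_derivative_const W(1) x]) (simp add: Pa)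
      ultimately have "(\<lambda>e. P (frechet_derivative (\<lambda>z. a z w) (at x) e)) = (\<lambda>e. 0)"
        by (rule has_derivative_unique)
      then show ?thesis by (rule fun_cong)
    qed
    have "?z = R x (P ?z)" using RP[OF x z] by simp
    also have "P ?z = 0" by (simp add: linear_diff[OF P(1)] Pd)
    finally have "?z = 0" using linear_0[OF linR[OF x]] by simp
    then show ?thesis by (simp add: aR u v)
  qed
  obtain \<delta> y where \<delta>: "0 < \<delta>" "y 0 = 0" "smooth_on (ball 0 \<delta>) y"
    and Py: "\<And>x. x \<in> ball 0 \<delta> \<Longrightarrow> P (y x) = 0"
    and yW: "\<And>x. x \<in> ball 0 \<delta> \<Longrightarrow> P x + y x \<in> W"
    and dy: "\<And>x. x \<in> ball 0 \<delta> \<Longrightarrow> (y has_derivative a (P x + y x)) (at x)"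
  proof (rule involutive_graph[OF W(1,2) P(1) PP _ sa _ Pa inva])
    show "linear (a x)" if "x \<in> W" for x
      unfolding a_def[abs_def]
      by (intro linear_compose_sub P(1) linear_compose[OF P(1) linR[OF that], unfolded o_def])
    show "a x (P u) = a x u" for x u by (simp add: a_def PP)
  qed (assumption | (rule that; assumption))+
  define Q where "Q = P -` ball 0 \<delta>"
  have Pb: "bounded_linear P" using P(1) by (simp add: linear_conv_bounded_linear)
  have Q: "open Q"
    unfolding Q_def by (intro open_vimage linear_continuous_on[OF Pb]) simp
  \<comment> \<open>The shear taking the part of \<open>E\<close> inside \<open>Q\<close> to the
    graph of \<open>y\<close>. It fixes the projection to \<open>E\<close>, so changing the sign of
    \<open>y\<close> gives the inverse \<open>H\<close>.\<close>
  define G where "G x = x + y (P x)" for x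
  define H where "H x = x - y (P x)" for x
  have PG: "P (G x) = P x" and PH: "P (H x) = P x" if "x \<in> Q" for x
    using that Py by (auto simp: G_def H_def Q_def linear_add[OF P(1)] linear_diff[OF P(1)])
  have GH: "G (H x) = x" and HG: "H (G x) = x" if "x \<in> Q" for x
    using PG[OF that] PH[OF that] unfolding G_def[of "H x"] H_def[of "G x"]
    by (simp_all add: G_def H_def)
  have HQ: "H x \<in> Q" if "x \<in> Q" for x
    using PH[OF that] that by (auto simp: Q_def)
  have sy: "smooth_on Q (\<lambda>x. y (P x))"
    by (rule smooth_on_compose[OF Q open_ball smooth_on_linear[OF Pb Q] \<delta>(3)]) (auto simp: Q_def)
  have sG: "smooth_on Q G" and sH: "smooth_on Q H"
    unfolding G_def H_def by (intro smooth_on_add smooth_on_diff smooth_on_id Q sy)+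
  define V where "V = fst c \<inter> snd c -` Q"
  have V: "open V" "V \<subseteq> fst c" "p \<in> V"
    using chart_preimage_open[OF ch Q] c \<delta>(1) linear_0[OF P(1)] by (auto simp: V_def Q_def)
  have VQ: "snd c ` V \<subseteq> Q" by (auto simp: V_def)
  have HV: "H ` snd c ` V = Q \<inter> G -` (snd c ` V)"
  proof (intro equalityI subsetI)
    fix z assume "z \<in> H ` snd c ` V"
    then show "z \<in> Q \<inter> G -` (snd c ` V)" using VQ HQ GH by auto
  next
    fix z assume z: "z \<in> Q \<inter> G -` (snd c ` V)"
    then have "z = H (G z)" using HG by simp
    then show "z \<in> H ` snd c ` V" using z by blast
  qed
  have oHV: "open (H ` snd c ` V)"
    unfolding HV by (rule continuous_open_preimage[OF smooth_on_continuous[OF sG] Q chart_image_open[OF ch V(1,2)]])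
  note diffeo = V(1,2) oHV smooth_on_subset[OF sH VQ] smooth_on_subset[OF sG, of "H ` snd c ` V"]
  have HVQ: "H ` snd c ` V \<subseteq> Q" using HV by blast
  define d where "d = (V, H \<circ> snd c)"
  have d: "d \<in> A"
    unfolding d_def by (rule chart_diffeo(1)[OF c(1) diffeo(1-5)]) (use HVQ GH VQ in auto)
  \<comment> \<open>The leaf: the points of \<open>V\<close> whose straightened coordinate lies in
    \<open>E\<close>, so it is a slice of \<open>d\<close> by construction.\<close>
  define S where "S = {q \<in> V. H (snd c q) \<in> E}"
  have "\<Delta> q = coord_vec A d q ` E" if q: "q \<in> S" for q
  proof -
    let ?e = "H (snd c q)"
    have qV: "q \<in> V" and e: "?e \<in> E" using q by (auto simp: S_def)
    have eQ: "?e \<in> Q" using qV HQ VQ by auto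
    have eb: "?e \<in> ball 0 \<delta>" "P ?e = ?e" using e eQ P(3)[OF e] by (auto simp: Q_def)
    have Ge: "G ?e = snd c q" using GH qV VQ by auto
    have xW: "snd c q \<in> W" using yW[OF eb(1)] Ge eb(2) by (simp add: G_def)
    \<comment> \<open>\<open>V\<close> was restricted only through the projection and may leave the
      region of the frame. Points of the leaf do not: their coordinate is
      \<open>P ?e + y ?e\<close>, which lies in \<open>W\<close>, and the chart is
      injective.\<close>
    have "q \<in> V0"
    proof -
      obtain q' where "q' \<in> V0" "snd c q = snd c q'" using xW W(3) by (auto simp: W0_def)
      then show ?thesis using is_chartD(3)[OF ch] qV V(2) V0(2) by (metis inj_onD subsetD)
    qed
    have "((\<lambda>x. y (P x)) has_derivative (\<lambda>u. a (P ?e + y ?e) (P u))) (at ?e)"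
      using has_derivative_compose[OF bounded_linear_imp_has_derivative[OF Pb], of y _ ?e] dy[OF eb(1)] eb(2)
      by simp
    then have "(G has_derivative (\<lambda>u. u + a (P ?e + y ?e) (P u))) (at ?e)"
      unfolding G_def by (intro has_derivative_add has_derivative_ident)
    then have dG: "frechet_derivative G (at ?e) = (\<lambda>u. u + a (P ?e + y ?e) (P u))"
      using frechet_derivative_at by metis
    have "P ?e + y ?e = snd c q" using Ge eb(2) by (simp add: G_def)
    then have "frechet_derivative G (at ?e) u = R (snd c q) u" if "u \<in> E" for u
      using that by (simp add: dG a_def PP P(3))
    moreover have "coord_vec A d q u = coord_vec A c q (frechet_derivative G (at ?e) u)" for u
      unfolding d_def
      by (rule coord_vec_diffeo[OF c(1) diffeo(1-5) _ qV]) (use HVQ GH VQ in auto)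
    ultimately have "coord_vec A d q ` E = coord_vec A c q ` R (snd c q) ` E"
      by (auto simp: image_image intro!: image_cong)
    then show ?thesis using \<Delta>\<Delta>'[OF \<open>q \<in> V0\<close>] \<Delta>'E[OF xW] by simp
  qed
  then have "integral_manifold A \<Delta> S"
    unfolding integral_manifold_def
    using d E by (intro ballI bexI[of _ d] exI[of _ E]) (auto simp: d_def S_def)
  moreover have "p \<in> S"
    using V(3) c(3) linear_0[OF P(1)] \<delta>(2) subspace_0[OF E] by (simp add: S_def H_def)
  ultimately show thesis using that by blast
qed

end

section \<open>The induced connection\<close>

lemma sum_fun_eq: "(\<Sum>i\<in>I. f i) = (\<lambda>x. \<Sum>i\<in>I. f i x)"
  by (induction I rule: infinite_finite_induct) (auto simp: fun_eq_iff)

lemma linear_map_onD: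
  assumes "linear_map_on V W L"
  shows "x \<in> V \<Longrightarrow> L x \<in> W" "x \<in> V \<Longrightarrow> y \<in> V \<Longrightarrow> L (x + y) = L x + L y"
    "x \<in> V \<Longrightarrow> L (c *\<^sub>R x) = c *\<^sub>R L x"
  using assms by (auto simp: linear_map_on_def)

lemma linear_map_on_diff:
  assumes L: "linear_map_on V W L" and V: "subspace V" and x: "x \<in> V" "y \<in> V"
  shows "L (x - y) = L x - L y"
  using linear_map_onD(2)[OF L subspace_diff[OF V x] x(2)] by (simp add: eq_diff_eq)

lemma linear_map_on_sum:
  assumes L: "linear_map_on V W L" and V: "subspace V"
  shows "(\<And>i. i \<in> I \<Longrightarrow> x i \<in> V) \<Longrightarrow> L (\<Sum>i\<in>I. x i) = (\<Sum>i\<in>I. L (x i))"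
proof (induction I rule: infinite_finite_induct)
  case (insert i I)
  then show ?case
    using linear_map_onD(2)[OF L, of "x i" "sum x I"] subspace_sum[OF V, of I x] by simp
qed (use linear_map_onD(3)[OF L subspace_0[OF V], of 0] in simp_all)

section \<open>Coordinate frames by global fields\<close>

context smooth_manifold
begin

text \<open>Coordinate functions and coordinate fields, cut off to global objects that are mutually
  dual on \<open>N\<close>. Indexing by every vector \<open>b\<close>, and not by
  \<open>Basis\<close> alone, removes side conditions from the later statements.\<close>

definition coordinate_frame :: "'p set \<Rightarrow> ('e \<Rightarrow> 'p \<Rightarrow> real) \<Rightarrow> ('e \<Rightarrow> 'p \<Rightarrow> 'p tvec) \<Rightarrow> bool" where
  "coordinate_frame N \<xi> W \<longleftrightarrow> open N \<and> (\<forall>b. \<xi> b \<in> smooth_fun A) \<and> (\<forall>b. W b \<in> vector_fields A) \<and>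
     (\<forall>q\<in>N. \<forall>v\<in>tangent_space A q. v = (\<Sum>b\<in>Basis. v (\<xi> b) *\<^sub>R W b q)) \<and>
     (\<forall>q\<in>N. \<forall>b c. W b q (\<xi> c) = b \<bullet> c)"

lemma coordinate_frameD:
  assumes "coordinate_frame N \<xi> W"
  shows "open N" "\<And>b. \<xi> b \<in> smooth_fun A" "\<And>b. W b \<in> vector_fields A"
    "\<And>q v. q \<in> N \<Longrightarrow> v \<in> tangent_space A q \<Longrightarrow> v = (\<Sum>b\<in>Basis. v (\<xi> b) *\<^sub>R W b q)"
    "\<And>q b c. q \<in> N \<Longrightarrow> W b q (\<xi> c) = b \<bullet> c"
  using assms by (simp_all add: coordinate_frame_def)

lemma coordinate_frame_exists: "\<exists>N \<xi> W. p \<in> N \<and> coordinate_frame N \<xi> W"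
proof -
  obtain c where c: "c \<in> A" "p \<in> fst c" using ex_chart by blast
  note ch = chart[OF c(1)]
  obtain N \<xi> where pN: "p \<in> N" and co: "coordinate_functions c N \<xi>"
    using local_coordinates[OF c] by blast
  note N = coordinate_functionsD[OF co]
  have "\<exists>W N'. W \<in> vector_fields A \<and> open N' \<and> p \<in> N' \<and> (\<forall>q\<in>N'. W q = coord_vec A c q b)" for b
  proof -
    have "smooth_on (snd c ` fst c) (\<lambda>x. b)" by (rule smooth_on_const[OF image_open[OF c(1)]])
    then obtain W N' where W: "W \<in> vector_fields A" "open N'" "p \<in> N'" "N' \<subseteq> fst c"
      "\<And>q. q \<in> N' \<Longrightarrow> W q = coord_vec A c q b"
      by (rule local_vector_field[OF c(1) is_chartD(1)[OF ch] order_refl c(2)]) (rule that; assumption)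
    then show ?thesis by blast
  qed
  then obtain W N' where W: "\<And>b. W b \<in> vector_fields A" "\<And>b. open (N' b)" "\<And>b. p \<in> N' b"
    and WN: "\<And>b. \<forall>q\<in>N' b. W b q = coord_vec A c q b"
    by metis
  \<comment> \<open>The neighbourhood \<open>N' b\<close> depends on \<open>b\<close>, and only
    finitely many of them may be intersected. For directions outside \<open>Basis\<close> the field
    is therefore rebuilt from the basis fields.\<close>
  define W' where "W' b = (if b \<in> Basis then W b else (\<Sum>b'\<in>Basis. (b \<bullet> b') *\<^sub>R W b'))" for b :: 'e
  define M where "M = N \<inter> (\<Inter>b\<in>Basis. N' b)"
  have M: "open M" "p \<in> M" "M \<subseteq> N"
    unfolding M_def using W(3) pN by (auto intro!: open_Int open_INT N(1) W(2))
  interpret id: smooth_mapping A A "\<lambda>p. p"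
    by unfold_locales (rule smooth_map_id)
  have sc: "(b \<bullet> b') *\<^sub>R W b' \<in> vector_fields A" for b b'
    using id.field_along_scale[OF smooth_fun_const W(1)] by (simp add: scaleR_fun_def)
  have W'v: "W' b \<in> vector_fields A" for b
    unfolding W'_def using W(1) sc by (auto intro: id.field_along_sum)
  have W'c: "W' b q = coord_vec A c q b" if q: "q \<in> M" for b q
  proof (cases "b \<in> Basis")
    case True
    then show ?thesis using q WN by (auto simp: W'_def M_def)
  next
    case False
    have qc: "q \<in> fst c" using q M(3) N(2) by auto
    note lin = coord_vec_linear[OF c(1) qc]
    have "W' b q = (\<Sum>b'\<in>Basis. (b \<bullet> b') *\<^sub>R W b' q)"
      using False by (simp add: W'_def sum_fun_eq scaleR_fun_def)
    also have "\<dots> = (\<Sum>b'\<in>Basis. (b \<bullet> b') *\<^sub>R coord_vec A c q b')"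
      by (rule sum.cong[OF refl]) (use q WN in \<open>auto simp: M_def\<close>)
    also have "\<dots> = coord_vec A c q (\<Sum>b'\<in>Basis. (b \<bullet> b') *\<^sub>R b')"
      by (simp add: linear_sum[OF lin] linear_cmul[OF lin])
    finally show ?thesis by (simp add: euclidean_representation)
  qed
  have "v = (\<Sum>b\<in>Basis. v (\<xi> b) *\<^sub>R W' b q)" if q: "q \<in> M" and v: "v \<in> tangent_space A q" for q v
  proof -
    have qc: "q \<in> fst c" "q \<in> N" using q M(3) N(2) by auto
    note lin = coord_vec_linear[OF c(1) qc(1)]
    have "v = coord_vec A c q (\<Sum>b\<in>Basis. v (\<xi> b) *\<^sub>R b)" by (rule N(5)[OF qc(2) v])
    also have "\<dots> = (\<Sum>b\<in>Basis. v (\<xi> b) *\<^sub>R coord_vec A c q b)"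
      by (simp add: linear_sum[OF lin] linear_cmul[OF lin])
    finally show ?thesis by (simp add: W'c[OF q])
  qed
  moreover have "W' b q (\<xi> b') = b \<bullet> b'" if "q \<in> M" for q b b'
    using coord_vec_coordinate[OF c(1) co] M(3) that by (auto simp: W'c[OF that])
  ultimately have "coordinate_frame M \<xi> W'"
    unfolding coordinate_frame_def using M(1) N(3) W'v by simp
  then show ?thesis using M(2) by blast
qed

text \<open>Each \<open>W c q (\<xi> d)\<close> is constant on \<open>N\<close>, and derivations
  kill local constants.\<close>

lemma coordinate_frame_commutes:
  assumes co: "coordinate_frame N \<xi> W" and q: "q \<in> N"
  shows "lie_bracket (W b) (W c) q = 0"
proof -
  note N = coordinate_frameD[OF co]
  have z: "W b q (\<lambda>q. W c q (\<xi> d)) = 0" for b c d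
  proof -
    have "W b q (\<lambda>q. W c q (\<xi> d)) = W b q (\<lambda>_. c \<bullet> d)"
      by (rule tangent_cong[OF vector_fieldD(1)[OF N(3)] vector_fieldD(2)[OF N(3) N(2)] smooth_fun_const N(1) q])
        (simp add: N(5))
    then show ?thesis using tangent_const[OF vector_fieldD(1)[OF N(3)]] by simp
  qed
  have "lie_bracket (W b) (W c) q = (\<Sum>d\<in>Basis. lie_bracket (W b) (W c) q (\<xi> d) *\<^sub>R W d q)"
    by (rule N(4)[OF q lie_bracket_in[OF N(3) N(3)]])
  also have "\<dots> = 0" by (simp add: lie_bracket_def z)
  finally show ?thesis .
qed

end

context smooth_mapping
begin

lemma field_along_frame:
  assumes co: "B.coordinate_frame N \<xi> W" and V: "V \<in> fields_along A B F" and q: "F q \<in> N"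
  shows "V q = (\<Sum>b\<in>Basis. (\<lambda>q. V q (\<xi> b) *\<^sub>R (W b \<circ> F) q)) q"
  using B.coordinate_frameD(4)[OF co q field_alongD(1)[OF V]] by (simp add: sum_fun_eq)

text \<open>Smoothness of \<open>K\<close> is given only on ambient vector fields. A field along
  \<open>F\<close> is locally a combination of restrictions \<open>W b \<circ> F\<close> with smooth
  coefficients, and \<open>K\<close> passes to the \<open>W b\<close> by linearity.\<close>

lemma tensor_field_along:
  assumes K: "\<And>p. linear_map_on (tangent_space B p) (tangent_space B p) (K p)"
    and KY: "\<And>Y. Y \<in> vector_fields B \<Longrightarrow> (\<lambda>p. K p (Y p)) \<in> vector_fields B"
    and V: "V \<in> fields_along A B F"
  shows "(\<lambda>p. K (F p) (V p)) \<in> fields_along A B F"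
    "B.coordinate_frame N \<xi> W \<Longrightarrow> F q \<in> N \<Longrightarrow>
      K (F q) (V q) = (\<Sum>b\<in>Basis. (\<lambda>q. V q (\<xi> b) *\<^sub>R ((\<lambda>p. K p (W b p)) \<circ> F) q)) q"
proof -
  show rep: "K (F q) (V q) = (\<Sum>b\<in>Basis. (\<lambda>q. V q (\<xi> b) *\<^sub>R ((\<lambda>p. K p (W b p)) \<circ> F) q)) q"
    if co: "B.coordinate_frame N \<xi> W" and q: "F q \<in> N" for N \<xi> W q
  proof -
    note WT = B.vector_fieldD(1)[OF B.coordinate_frameD(3)[OF co]]
    have "K (F q) (V q) = K (F q) (\<Sum>b\<in>Basis. V q (\<xi> b) *\<^sub>R W b (F q))"
      using B.coordinate_frameD(4)[OF co q field_alongD(1)[OF V]] by simp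
    also have "\<dots> = (\<Sum>b\<in>Basis. K (F q) (V q (\<xi> b) *\<^sub>R W b (F q)))"
      by (rule linear_map_on_sum[OF K B.subspace_tangent_space])
        (rule subspace_scale[OF B.subspace_tangent_space WT])
    also have "\<dots> = (\<Sum>b\<in>Basis. V q (\<xi> b) *\<^sub>R K (F q) (W b (F q)))"
      by (simp add: linear_map_onD(3)[OF K WT])
    finally show ?thesis by (simp add: sum_fun_eq)
  qed
  show "(\<lambda>p. K (F p) (V p)) \<in> fields_along A B F"
  proof (rule field_along_local)
    fix p
    obtain N \<xi> W where N: "F p \<in> N" "B.coordinate_frame N \<xi> W"
      using B.coordinate_frame_exists by blast
    note D = B.coordinate_frameD[OF N(2)]
    have "(\<Sum>b\<in>Basis. (\<lambda>q. V q (\<xi> b) *\<^sub>R ((\<lambda>p. K p (W b p)) \<circ> F) q)) \<in> fields_along A B F"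
      by (intro field_along_sum field_along_scale field_alongD(2)[OF V D(2)] field_along_comp KY D(3))
    moreover have "open (F -` N)" using continuous_map D(1) by blast
    ultimately show "\<exists>U V'. open U \<and> p \<in> U \<and> V' \<in> fields_along A B F \<and> (\<forall>q\<in>U. K (F q) (V q) = V' q)"
      using rep[OF N(2)] N(1) by (intro exI conjI) (assumption | auto)+
  qed
qed

end

section \<open>The connection along the map, computed in ambient frames\<close>

locale pulled_back_connection = smooth_mapping A B F
  for A :: "('p::{t2_space,second_countable_topology}, 'e::euclidean_space) chart set"
    and B :: "('a::{t2_space,second_countable_topology}, 'b::euclidean_space) chart set"
    and F :: "'p \<Rightarrow> 'a" +
  fixes nab :: "'a \<Rightarrow> 'a tvec \<Rightarrow> ('a \<Rightarrow> 'a tvec) \<Rightarrow> 'a tvec"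
    and nabF :: "'p \<Rightarrow> 'a tvec \<Rightarrow> ('p \<Rightarrow> 'a tvec) \<Rightarrow> 'a tvec"
  assumes nabF: "induced_connection A B F nab nabF"
begin

lemma nabF_linear:
  "V \<in> fields_along A B F \<Longrightarrow>
    linear_map_on (tan_bundle A B F p) (tangent_space B (F p)) (\<lambda>v. nabF p v V)"
  using nabF unfolding induced_connection_def by blast

lemma nabF_add:
  "v \<in> tan_bundle A B F p \<Longrightarrow> V \<in> fields_along A B F \<Longrightarrow> W \<in> fields_along A B F \<Longrightarrow>
    nabF p v (V + W) = nabF p v V + nabF p v W"
  using nabF unfolding induced_connection_def by blast

lemma nabF_scale:
  "x \<in> tangent_space A p \<Longrightarrow> f \<in> smooth_fun A \<Longrightarrow> V \<in> fields_along A B F \<Longrightarrow>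
    nabF p (push A B F x) (\<lambda>q. f q *\<^sub>R V q) = x f *\<^sub>R V p + f p *\<^sub>R nabF p (push A B F x) V"
  using nabF unfolding induced_connection_def by blast

lemma nabF_comp:
  "v \<in> tan_bundle A B F p \<Longrightarrow> Y \<in> vector_fields B \<Longrightarrow> nabF p v (Y \<circ> F) = nab (F p) v Y"
  using nabF unfolding induced_connection_def by blast

lemma push_in_tan_bundle: "x \<in> tangent_space A p \<Longrightarrow> push A B F x \<in> tan_bundle A B F p"
  by (simp add: tan_bundle_def)

lemma nabF_sum:
  assumes v: "v \<in> tan_bundle A B F p"
  shows "(\<And>i. i \<in> I \<Longrightarrow> V i \<in> fields_along A B F) \<Longrightarrow> nabF p v (\<Sum>i\<in>I. V i) = (\<Sum>i\<in>I. nabF p v (V i))"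
proof (induction I rule: infinite_finite_induct)
  case (insert i I)
  have "nabF p v (V i + sum V I) = nabF p v (V i) + nabF p v (sum V I)"
    by (rule nabF_add[OF v insert.prems field_along_sum[OF insert.prems]]) auto
  also have "nabF p v (sum V I) = (\<Sum>i\<in>I. nabF p v (V i))"
    by (rule insert.IH[OF insert.prems]) auto
  finally show ?case by (simp only: sum.insert[OF insert.hyps])
qed (use nabF_add[OF v field_along_zero field_along_zero] in simp_all)

text \<open>The axioms speak of global fields. Multiplying both by a cut-off \<open>\<rho>\<close>
  makes them equal everywhere, and the Leibniz term drops out since \<open>\<rho>\<close> is
  constant near \<open>p\<close>.\<close>

lemma nabF_local:
  assumes x: "x \<in> tangent_space A p" and V: "V \<in> fields_along A B F" "W \<in> fields_along A B F"
    and U: "open U" "p \<in> U" "\<And>q. q \<in> U \<Longrightarrow> V q = W q"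
  shows "nabF p (push A B F x) V = nabF p (push A B F x) W"
proof -
  obtain \<rho> N where \<rho>: "open N" "p \<in> N" "N \<subseteq> U" "\<rho> \<in> smooth_fun A" "\<And>q. q \<in> N \<Longrightarrow> \<rho> q = 1"
    "\<And>q. q \<notin> U \<Longrightarrow> \<rho> q = 0"
    by (rule A.bump[OF U(1,2)]) (rule that; assumption)
  have "x \<rho> = x (\<lambda>_. 1)"
    by (rule A.tangent_cong[OF x \<rho>(4) A.smooth_fun_const \<rho>(1,2,5)])
  then have x\<rho>: "x \<rho> = 0" using A.tangent_const[OF x] by simp
  have "(\<lambda>q. \<rho> q *\<^sub>R V q) = (\<lambda>q. \<rho> q *\<^sub>R W q)"
  proof
    show "\<rho> q *\<^sub>R V q = \<rho> q *\<^sub>R W q" for q using U(3)[of q] \<rho>(6)[of q] by (cases "q \<in> U") simp_all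
  qed
  then have "nabF p (push A B F x) (\<lambda>q. \<rho> q *\<^sub>R V q) = nabF p (push A B F x) (\<lambda>q. \<rho> q *\<^sub>R W q)" by simp
  then show ?thesis
    by (simp add: nabF_scale[OF x \<rho>(4)] V x\<rho> \<rho>(5)[OF \<rho>(2)])
qed

text \<open>Locality, additivity and the Leibniz rule reduce \<open>nabF\<close> to restrictions
  \<open>Y b \<circ> F\<close>, where it is given by \<open>nab\<close>. The fields
  \<open>Y b\<close> are left open so that both \<open>W b\<close> and its image under a tensor can
  be inserted.\<close>

lemma nabF_frame:
  assumes co: "B.coordinate_frame N \<xi> W" and p: "F p \<in> N" and x: "x \<in> tangent_space A p"
    and V: "V \<in> fields_along A B F" and Y: "\<And>b. Y b \<in> vector_fields B" and f: "\<And>b. f b \<in> smooth_fun A"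
    and rep: "\<And>q. F q \<in> N \<Longrightarrow> V q = (\<Sum>b\<in>Basis. (\<lambda>q. f b q *\<^sub>R (Y b \<circ> F) q)) q"
  shows "nabF p (push A B F x) V =
    (\<Sum>b\<in>Basis. x (f b) *\<^sub>R Y b (F p) + f b p *\<^sub>R nab (F p) (push A B F x) (Y b))"
proof -
  have Yf: "(\<lambda>q. f b q *\<^sub>R (Y b \<circ> F) q) \<in> fields_along A B F" for b
    by (rule field_along_scale[OF f field_along_comp[OF Y]])
  have "nabF p (push A B F x) V = nabF p (push A B F x) (\<Sum>b\<in>Basis. (\<lambda>q. f b q *\<^sub>R (Y b \<circ> F) q))"
    by (rule nabF_local[OF x V field_along_sum[OF Yf] continuous_map[OF B.coordinate_frameD(1)[OF co]]])
      (use p rep in auto)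
  also have "\<dots> = (\<Sum>b\<in>Basis. nabF p (push A B F x) (\<lambda>q. f b q *\<^sub>R (Y b \<circ> F) q))"
    by (rule nabF_sum[OF push_in_tan_bundle[OF x] Yf])
  also have "\<dots> = (\<Sum>b\<in>Basis. x (f b) *\<^sub>R Y b (F p) + f b p *\<^sub>R nab (F p) (push A B F x) (Y b))"
    by (rule sum.cong[OF refl], subst nabF_scale[OF x f field_along_comp[OF Y]])
      (simp add: nabF_comp[OF push_in_tan_bundle[OF x] Y])
  finally show ?thesis .
qed

text \<open>Both sides expand with the same coefficients, once over the fields \<open>W b\<close>
  and once over their images under \<open>K\<close>. The hypothesis \<open>par\<close> matches the
  terms one by one.\<close>

lemma nabF_parallel:
  assumes aff: "affine_connection B nab"
    and K: "\<And>p. linear_map_on (tangent_space B p) (tangent_space B p) (K p)"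
    and KY: "\<And>Y. Y \<in> vector_fields B \<Longrightarrow> (\<lambda>p. K p (Y p)) \<in> vector_fields B"
    and par: "\<And>p v Y. v \<in> tangent_space B p \<Longrightarrow> Y \<in> vector_fields B \<Longrightarrow> nab p v (\<lambda>q. K q (Y q)) = K p (nab p v Y)"
    and V: "V \<in> fields_along A B F" and v: "v \<in> tan_bundle A B F p"
  shows "nabF p v (\<lambda>q. K (F q) (V q)) = K (F p) (nabF p v V)"
proof -
  obtain x where x: "x \<in> tangent_space A p" "v = push A B F x" using v by (auto simp: tan_bundle_def)
  obtain N \<xi> W where N: "F p \<in> N" "B.coordinate_frame N \<xi> W"
    using B.coordinate_frame_exists by blast
  note D = B.coordinate_frameD[OF N(2)]
  note sT = B.subspace_tangent_space
  have vT: "v \<in> tangent_space B (F p)" using push_in[OF x(1)] x(2) by simp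
  have nT: "nab (F p) v Y \<in> tangent_space B (F p)" if "Y \<in> vector_fields B" for Y
    using aff vT that unfolding affine_connection_def by (auto dest: linear_map_onD(1))
  have f: "(\<lambda>q. V q (\<xi> b)) \<in> smooth_fun A" for b by (rule field_alongD(2)[OF V D(2)])
  have WT: "W b (F p) \<in> tangent_space B (F p)" for b by (rule B.vector_fieldD(1)[OF D(3)])
  have t: "x (\<lambda>q. V q (\<xi> b)) *\<^sub>R W b (F p) + V p (\<xi> b) *\<^sub>R nab (F p) v (W b) \<in> tangent_space B (F p)" for b
    by (intro subspace_add[OF sT] subspace_scale[OF sT] WT nT D(3))
  have "K (F p) (nabF p v V) = K (F p)
      (\<Sum>b\<in>Basis. x (\<lambda>q. V q (\<xi> b)) *\<^sub>R W b (F p) + V p (\<xi> b) *\<^sub>R nab (F p) v (W b))"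
    unfolding x(2) using nabF_frame[OF N(2,1) x(1) V D(3) f field_along_frame[OF N(2) V]] by simp
  also have "\<dots> = (\<Sum>b\<in>Basis. K (F p) (x (\<lambda>q. V q (\<xi> b)) *\<^sub>R W b (F p) + V p (\<xi> b) *\<^sub>R nab (F p) v (W b)))"
    by (rule linear_map_on_sum[OF K sT t])
  also have "\<dots> = (\<Sum>b\<in>Basis. x (\<lambda>q. V q (\<xi> b)) *\<^sub>R K (F p) (W b (F p)) +
      V p (\<xi> b) *\<^sub>R nab (F p) v (\<lambda>q. K q (W b q)))"
    by (rule sum.cong[OF refl])
      (simp add: linear_map_onD(2,3)[OF K] subspace_scale[OF sT] WT nT D(3) par[OF vT])
  also have "\<dots> = nabF p v (\<lambda>q. K (F q) (V q))"
    unfolding x(2)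
    using nabF_frame[OF N(2,1) x(1) tensor_field_along(1)[OF K KY V] KY[OF D(3)] f
        tensor_field_along(2)[OF K KY V N(2)]] by simp
  finally show ?thesis by simp
qed

text \<open>In a coordinate frame the torsion-freeness of \<open>nab\<close> cancels all terms but those
  differentiating the components.\<close>

lemma nabF_torsion_free:
  assumes aff: "affine_connection B nab"
    and tor: "\<And>X Y p. X \<in> vector_fields B \<Longrightarrow> Y \<in> vector_fields B \<Longrightarrow>
      nab p (X p) Y - nab p (Y p) X = lie_bracket X Y p"
    and X: "X \<in> vector_fields A" and Y: "Y \<in> vector_fields A"
  shows "nabF p (push A B F (X p)) (\<lambda>q. push A B F (Y q)) - nabF p (push A B F (Y p)) (\<lambda>q. push A B F (X q)) =
    push A B F (lie_bracket X Y p)"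
proof -
  obtain N \<xi> W where N: "F p \<in> N" "B.coordinate_frame N \<xi> W"
    using B.coordinate_frame_exists by blast
  note D = B.coordinate_frameD[OF N(2)]
  note sT = B.subspace_tangent_space

  have push\<xi>: "push A B F v (\<xi> b) = v (\<lambda>q. \<xi> b (F q))" for v b
    using D(2) by (simp add: push_def o_def)
  have WT: "W b (F p) \<in> tangent_space B (F p)" for b by (rule B.vector_fieldD(1)[OF D(3)])
  \<comment> \<open>The Christoffel terms of \<open>nab\<close> at \<open>F p\<close>, symmetric
    because coordinate fields commute and \<open>nab\<close> is torsion-free.\<close>
  define G where "G b c = nab (F p) (W b (F p)) (W c)" for b c
  have sym: "G b c = G c b" for b c
    using tor[OF D(3) D(3), of "F p" b c] B.coordinate_frame_commutes[OF N(2,1), of b c]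
    by (simp add: G_def)
  have expand: "nabF p (push A B F (Z p)) (\<lambda>q. push A B F (Z' q)) =
      (\<Sum>b\<in>Basis. Z p (\<lambda>q. Z' q (\<lambda>q. \<xi> b (F q))) *\<^sub>R W b (F p)) +
      (\<Sum>b\<in>Basis. \<Sum>c\<in>Basis. (Z' p (\<lambda>q. \<xi> b (F q)) * Z p (\<lambda>q. \<xi> c (F q))) *\<^sub>R G c b)"
    if Z: "Z \<in> vector_fields A" "Z' \<in> vector_fields A" for Z Z'
  proof -
    let ?v = "push A B F (Z p)"
    have vT: "?v \<in> tangent_space B (F p)" by (rule push_in[OF A.vector_fieldD(1)[OF Z(1)]])
    have v: "?v = (\<Sum>c\<in>Basis. Z p (\<lambda>q. \<xi> c (F q)) *\<^sub>R W c (F p))"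
      using D(4)[OF N(1) vT] by (simp add: push\<xi>)
    have "nab (F p) ?v (W b) = (\<Sum>c\<in>Basis. Z p (\<lambda>q. \<xi> c (F q)) *\<^sub>R G c b)" for b
    proof -
      have L: "linear_map_on (tangent_space B (F p)) (tangent_space B (F p)) (\<lambda>v. nab (F p) v (W b))"
        using aff D(3) unfolding affine_connection_def by blast
      have "nab (F p) ?v (W b) = (\<Sum>c\<in>Basis. nab (F p) (Z p (\<lambda>q. \<xi> c (F q)) *\<^sub>R W c (F p)) (W b))"
        unfolding v by (rule linear_map_on_sum[OF L sT subspace_scale[OF sT WT]])
      also have "\<dots> = (\<Sum>c\<in>Basis. Z p (\<lambda>q. \<xi> c (F q)) *\<^sub>R G c b)"
        by (simp add: linear_map_onD(3)[OF L WT] G_def)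
      finally show ?thesis .
    qed
    then show ?thesis
      using nabF_frame[OF N(2,1) A.vector_fieldD(1)[OF Z(1)] push_field[OF Z(2)] D(3)
          field_alongD(2)[OF push_field[OF Z(2)] D(2)] field_along_frame[OF N(2) push_field[OF Z(2)]]]
      by (simp add: push\<xi> sum.distrib scaleR_sum_right)
  qed
  \<comment> \<open>Exchanging the summation indices and using the symmetry of \<open>G\<close>
    shows that the two Christoffel sums coincide, so they cancel in the difference.\<close>
  have swap: "(\<Sum>b\<in>Basis. \<Sum>c\<in>Basis. (Y p (\<lambda>q. \<xi> b (F q)) * X p (\<lambda>q. \<xi> c (F q))) *\<^sub>R G c b) =
      (\<Sum>b\<in>Basis. \<Sum>c\<in>Basis. (X p (\<lambda>q. \<xi> b (F q)) * Y p (\<lambda>q. \<xi> c (F q))) *\<^sub>R G c b)"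
    by (subst sum.swap) (simp add: sym mult.commute)
  have bT: "push A B F (lie_bracket X Y p) \<in> tangent_space B (F p)"
    by (rule push_in[OF A.lie_bracket_in[OF X Y]])
  have "push A B F (lie_bracket X Y p) = (\<Sum>b\<in>Basis. lie_bracket X Y p (\<lambda>q. \<xi> b (F q)) *\<^sub>R W b (F p))"
    using D(4)[OF N(1) bT] by (simp add: push\<xi>)
  then show ?thesis
    unfolding expand[OF X Y] expand[OF Y X] swap
    by (simp add: lie_bracket_def scaleR_diff_left sum_subtractf)
qed

end

section \<open>Subbundles\<close>

lemma independent_imageD:
  assumes f: "linear f" and S: "inj_on f S" "independent (f ` S)"
  shows "independent S"
  unfolding dependent_def
proof
  assume "\<exists>a\<in>S. a \<in> span (S - {a})"
  then obtain a where a: "a \<in> S" "a \<in> span (S - {a})" by blast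
  have "f ` (S - {a}) = f ` S - {f a}"
    using inj_on_image_set_diff[OF S(1), of S "{a}"] a(1) by simp
  then have "f a \<in> span (f ` S - {f a})"
    using a(2) linear_span_image[OF f, of "S - {a}"] by auto
  then show False using S(2) a(1) unfolding dependent_def by blast
qed

text \<open>If a new vector of \<open>T\<close> depended on \<open>S\<close> and the earlier part of
  \<open>T\<close>, its part in \<open>span S\<close> would lie in both spans and vanish,
  contradicting independence of \<open>T\<close>.\<close>

lemma independent_Un:
  assumes "finite T"
  shows "independent S \<Longrightarrow> independent T \<Longrightarrow> span S \<inter> span T = {0} \<Longrightarrow> independent (S \<union> T) \<and> S \<inter> T = {}"
  using assms
proof (induction T rule: finite_induct)
  case (insert t T)
  have "independent T" "t \<notin> span T"
    using insert.prems(2) insert.hyps(2) by (auto simp: independent_insert)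
  have 0: "span S \<inter> span T = {0}"
    using insert.prems(3) span_mono[of T "insert t T"] by (auto simp: span_zero)
  have IH: "independent (S \<union> T)" "S \<inter> T = {}"
    using insert.IH[OF insert.prems(1) \<open>independent T\<close> 0] by auto
  have "t \<notin> span (S \<union> T)"
  proof
    assume "t \<in> span (S \<union> T)"
    then obtain x y where xy: "t = x + y" "x \<in> span S" "y \<in> span T" unfolding span_Un by auto
    have "x = t - y" using xy(1) by simp
    then have "x \<in> span (insert t T)"
      using xy(3) span_mono[of T "insert t T"] by (auto intro!: span_diff intro: span_base)
    then have "x = 0" using xy(2) insert.prems(3) by blast
    then show False using xy \<open>t \<notin> span T\<close> by simp
  qed
  moreover have "t \<notin> S"
    using \<open>t \<notin> span (S \<union> T)\<close> span_base[of t "S \<union> T"] by auto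
  ultimately show ?case using IH independent_insertI[of t "S \<union> T"] by simp
qed simp

lemma span_plus: "span (S \<union> T) = span S + span (T :: 'a::real_vector set)"
  unfolding span_Un set_plus_def by auto

lemma subspace_plus:
  fixes V W :: "'a::real_vector set"
  assumes "subspace V" "subspace W"
  shows "subspace (V + W)"
proof -
  have "V + W = {x + y |x y. x \<in> V \<and> y \<in> W}" by (auto simp: set_plus_def)
  then show ?thesis using subspace_sums[OF assms] by simp
qed

definition append_frame :: "nat \<Rightarrow> (nat \<Rightarrow> 'a) \<Rightarrow> (nat \<Rightarrow> 'a) \<Rightarrow> nat \<Rightarrow> 'a" where
  "append_frame k s t i = (if i < k then s i else t (i - k))"

lemma append_frame_image: "append_frame k s t ` {..<k + l} = s ` {..<k} \<union> t ` {..<l}"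
proof (intro equalityI subsetI)
  fix x assume "x \<in> append_frame k s t ` {..<k + l}"
  then show "x \<in> s ` {..<k} \<union> t ` {..<l}" by (auto simp: append_frame_def)
next
  fix x assume "x \<in> s ` {..<k} \<union> t ` {..<l}"
  then consider i where "i < k" "x = append_frame k s t i"
    | i where "i < l" "x = append_frame k s t (k + i)"
    by (auto simp: append_frame_def)
  then show "x \<in> append_frame k s t ` {..<k + l}" by cases auto
qed

lemma append_frame_inj:
  assumes "inj_on s {..<k}" "inj_on t {..<l}" "s ` {..<k} \<inter> t ` {..<l} = {}"
  shows "inj_on (append_frame k s t) {..<k + l}"
proof (rule inj_onI)
  fix i j assume ij: "i \<in> {..<k + l}" "j \<in> {..<k + l}" "append_frame k s t i = append_frame k s t j"
  have ne: "s a \<noteq> t b" if "a < k" "b < l" for a b using assms(3) that by blast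
  show "i = j"
  proof (cases "i < k"; cases "j < k")
    assume "i < k" "j < k"
    then show ?thesis using ij(3) inj_onD[OF assms(1), of i j] by (simp add: append_frame_def)
  next
    assume n: "\<not> i < k" "\<not> j < k"
    then have "i - k < l" "j - k < l" using ij(1,2) by auto
    then have "i - k = j - k" using n ij inj_onD[OF assms(2), of "i - k" "j - k"] by (auto simp: append_frame_def)
    then show ?thesis using n by linarith
  next
    assume n: "i < k" "\<not> j < k"
    then have "j - k < l" using ij(2) by auto
    then show ?thesis using n ij(3) ne[of i "j - k"] by (simp add: append_frame_def)
  next
    assume n: "\<not> i < k" "j < k"
    then have "i - k < l" using ij(1) by auto
    then show ?thesis using n ij(3) ne[of j "i - k"] by (simp add: append_frame_def)
  qed
qed

lemma local_frame_append:
  assumes s: "local_frame A B F k E U s" and t: "local_frame A B F l E' U' t"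
    and disj: "\<And>p. E p \<inter> E' p = {0}"
  shows "local_frame A B F (k + l) (\<lambda>p. E p + E' p) (U \<inter> U') (append_frame k s t)"
  unfolding local_frame_def
proof (intro conjI allI impI ballI)
  show "open (U \<inter> U')" using s t by (auto simp: local_frame_def)
  show "append_frame k s t i \<in> fields_along A B F" if "i < k + l" for i
    using s t that by (auto simp: local_frame_def append_frame_def)
  fix p assume p: "p \<in> U \<inter> U'"
  have s': "inj_on (\<lambda>i. s i p) {..<k}" "independent ((\<lambda>i. s i p) ` {..<k})" "span ((\<lambda>i. s i p) ` {..<k}) = E p"
    using s p by (auto simp: local_frame_def)
  have t': "inj_on (\<lambda>i. t i p) {..<l}" "independent ((\<lambda>i. t i p) ` {..<l})" "span ((\<lambda>i. t i p) ` {..<l}) = E' p"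
    using t p by (auto simp: local_frame_def)
  have e: "(\<lambda>i. append_frame k s t i p) = append_frame k (\<lambda>i. s i p) (\<lambda>i. t i p)"
    by (auto simp: append_frame_def)
  have U: "independent ((\<lambda>i. s i p) ` {..<k} \<union> (\<lambda>i. t i p) ` {..<l})"
    "(\<lambda>i. s i p) ` {..<k} \<inter> (\<lambda>i. t i p) ` {..<l} = {}"
    using independent_Un[OF _ s'(2) t'(2)] s'(3) t'(3) disj[of p] by auto
  show "inj_on (\<lambda>i. append_frame k s t i p) {..<k + l}"
    unfolding e by (rule append_frame_inj[OF s'(1) t'(1) U(2)])
  show "independent ((\<lambda>i. append_frame k s t i p) ` {..<k + l})"
    unfolding e append_frame_image by (rule U(1))
  show "span ((\<lambda>i. append_frame k s t i p) ` {..<k + l}) = E p + E' p"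
    unfolding e append_frame_image span_plus s'(3) t'(3) ..
qed

text \<open>Concatenated local frames form a frame because the fibres meet in 0. This also keeps the
  rank constant, namely \<open>k + l\<close>.\<close>

lemma vector_subbundle_plus:
  assumes E: "vector_subbundle A B F E" and E': "vector_subbundle A B F E'"
    and disj: "\<And>p. E p \<inter> E' p = {0}"
  shows "vector_subbundle A B F (\<lambda>p. E p + E' p)"
proof -
  obtain k where k: "\<And>p. \<exists>U s. p \<in> U \<and> local_frame A B F k E U s"
    using E unfolding vector_subbundle_def by blast
  obtain l where l: "\<And>p. \<exists>U s. p \<in> U \<and> local_frame A B F l E' U s"
    using E' unfolding vector_subbundle_def by blast
  show ?thesis
    unfolding vector_subbundle_def
  proof (intro exI[of _ "k + l"] allI)
    fix p
    obtain U s where s: "p \<in> U" "local_frame A B F k E U s" using k by blast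
    obtain U' t where t: "p \<in> U'" "local_frame A B F l E' U' t" using l by blast
    show "\<exists>U s. p \<in> U \<and> local_frame A B F (k + l) (\<lambda>p. E p + E' p) U s"
      using local_frame_append[OF s(2) t(2) disj] s(1) t(1) by blast
  qed
qed

lemma vector_subbundle_subspace: "vector_subbundle A B F E \<Longrightarrow> subspace (E p)"
  unfolding vector_subbundle_def local_frame_def by (metis subspace_span)

context smooth_mapping
begin

lemma vector_subbundle_in:
  assumes "vector_subbundle A B F E"
  shows "E p \<subseteq> tangent_space B (F p)"
proof -
  obtain k U s where s: "p \<in> U" "local_frame A B F k E U s"
    using assms unfolding vector_subbundle_def by blast
  then have "(\<lambda>i. s i p) ` {..<k} \<subseteq> tangent_space B (F p)"
    using field_alongD(1) unfolding local_frame_def by blast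
  then have "span ((\<lambda>i. s i p) ` {..<k}) \<subseteq> tangent_space B (F p)"
    by (rule span_minimal[OF _ B.subspace_tangent_space])
  then show ?thesis using s unfolding local_frame_def by blast
qed

lemma vector_subbundle_image:
  assumes K: "\<And>p. linear_map_on (tangent_space B p) (tangent_space B p) (K p)"
    and KY: "\<And>Y. Y \<in> vector_fields B \<Longrightarrow> (\<lambda>p. K p (Y p)) \<in> vector_fields B"
    and inj: "\<And>p. inj_on (K p) (tangent_space B p)"
    and E: "vector_subbundle A B F E"
  shows "vector_subbundle A B F (\<lambda>p. K (F p) ` E p)"
proof -
  \<comment> \<open>\<open>K p\<close> is linear on the tangent space only, while the facts about
    independence and spans of images concern maps linear on the whole type. On the span of an
    independent set it is replaced by such a map.\<close>
  have "\<exists>L. linear L \<and> (\<forall>x\<in>span S. L x = K p x)" if S: "S \<subseteq> tangent_space B p" "independent S" for S p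
  proof -
    obtain L where L: "linear L" "\<And>x. x \<in> S \<Longrightarrow> L x = K p x"
      using linear_independent_extend[OF S(2), of "K p"] by blast
    have "x \<in> tangent_space B p \<and> L x = K p x" if "x \<in> span S" for x
      using that
    proof (induction rule: span_induct_alt)
      case base
      have "K p 0 = 0"
        using linear_map_onD(3)[OF K subspace_0[OF B.subspace_tangent_space], of p 0] by (simp only: scaleR_zero_left)
      then show ?case
        using subspace_0[OF B.subspace_tangent_space] linear_0[OF L(1)] by (simp only:)
    next
      case (step c x y)
      then have x: "x \<in> tangent_space B p" using S(1) by blast
      have cx: "c *\<^sub>R x \<in> tangent_space B p" by (rule subspace_scale[OF B.subspace_tangent_space x])
      have "L (c *\<^sub>R x + y) = c *\<^sub>R K p x + K p y"
        using step by (simp only: linear_add[OF L(1)] linear_cmul[OF L(1)] L(2))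
      also have "\<dots> = K p (c *\<^sub>R x + y)"
        using step by (simp only: linear_map_onD(2)[OF K cx] linear_map_onD(3)[OF K x])
      finally show ?case using subspace_add[OF B.subspace_tangent_space cx] step by (simp only:)
    qed
    then show ?thesis using L(1) by blast
  qed note ext = this
  obtain k where k: "\<And>p. \<exists>U s. p \<in> U \<and> local_frame A B F k E U s"
    using E unfolding vector_subbundle_def by blast
  show ?thesis
    unfolding vector_subbundle_def
  proof (intro exI[of _ k] allI)
    fix p
    obtain U s where p: "p \<in> U" and s: "local_frame A B F k E U s" using k by blast
    have "local_frame A B F k (\<lambda>p. K (F p) ` E p) U (\<lambda>i p. K (F p) (s i p))"
      unfolding local_frame_def
    proof (intro conjI allI impI ballI)
      show "open U" using s by (simp add: local_frame_def)
      show "(\<lambda>p. K (F p) (s i p)) \<in> fields_along A B F" if "i < k" for i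
        by (rule tensor_field_along(1)[OF K KY]) (use s that in \<open>simp_all add: local_frame_def\<close>)
      fix q assume q: "q \<in> U"
      let ?S = "(\<lambda>i. s i q) ` {..<k}"
      have S: "inj_on (\<lambda>i. s i q) {..<k}" "independent ?S" "span ?S = E q"
        using s q by (auto simp: local_frame_def)
      have ST: "?S \<subseteq> tangent_space B (F q)"
        using vector_subbundle_in[OF E, of q] S(3) span_superset[of ?S] by simp
      have EqT: "span ?S \<subseteq> tangent_space B (F q)" using vector_subbundle_in[OF E, of q] S(3) by simp
      obtain L where L: "linear L" "\<And>x. x \<in> span ?S \<Longrightarrow> L x = K (F q) x"
        using ext[OF ST S(2)] by blast
      have img: "(\<lambda>i. K (F q) (s i q)) ` {..<k} = L ` ?S"
        unfolding image_image by (rule image_cong[OF refl], rule L(2)[symmetric], rule span_base) auto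
      have injL: "inj_on L (span ?S)"
        using inj_on_subset[OF inj EqT] L(2) by (simp add: inj_on_def)
      show "inj_on (\<lambda>i. K (F q) (s i q)) {..<k}"
        using comp_inj_on[OF S(1) inj_on_subset[OF inj ST]] by (simp add: o_def)
      show "independent ((\<lambda>i. K (F q) (s i q)) ` {..<k})"
        unfolding img by (rule linear_independent_injective_image[OF L(1) S(2) injL])
      have "span (L ` ?S) = L ` span ?S" by (rule linear_span_image[OF L(1)])
      also have "\<dots> = K (F q) ` E q" unfolding S(3)[symmetric] by (rule image_cong) (use L(2) in auto)
      finally show "span ((\<lambda>i. K (F q) (s i q)) ` {..<k}) = K (F q) ` E q" unfolding img .
    qed
    then show "\<exists>U s. p \<in> U \<and> local_frame A B F k (\<lambda>p. K (F p) ` E p) U s" using p by blast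
  qed
qed

end

section \<open>Subbundles of the tangent bundle as distributions on the submanifold\<close>

context smooth_immersion
begin

lemma push_inj: "x \<in> tangent_space A p \<Longrightarrow> y \<in> tangent_space A p \<Longrightarrow> push A B F x = push A B F y \<Longrightarrow> x = y"
  using immersion[of p] by (auto dest: inj_onD)

text \<open>Supplies the Frobenius hypotheses: a local frame of \<open>E\<close> along
  \<open>F\<close> becomes a local frame of fields on \<open>M\<close> itself.\<close>

lemma on_source_frame:
  assumes E: "vector_subbundle A B F E" and sub: "\<And>p. E p \<subseteq> tan_bundle A B F p"
  obtains k U X where "open U" "p \<in> U" "\<And>i. i < k \<Longrightarrow> X i \<in> vector_fields A"
    "\<And>q. q \<in> U \<Longrightarrow> on_source A B F E q = span ((\<lambda>i. X i q) ` {..<k})"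
    "inj_on (\<lambda>i. X i p) {..<k::nat}" "independent ((\<lambda>i. X i p) ` {..<k})"
proof -
  obtain k U0 s where p0: "p \<in> U0" and s: "local_frame A B F k E U0 s"
    using E unfolding vector_subbundle_def by blast
  have U0: "open U0" and sf: "\<And>i. i < k \<Longrightarrow> s i \<in> fields_along A B F"
    and fr: "\<And>q. q \<in> U0 \<Longrightarrow> inj_on (\<lambda>i. s i q) {..<k} \<and> independent ((\<lambda>i. s i q) ` {..<k}) \<and>
      span ((\<lambda>i. s i q) ` {..<k}) = E q"
    using s by (simp_all add: local_frame_def)
  obtain \<rho> U where \<rho>: "open U" "p \<in> U" "U \<subseteq> U0" "\<rho> \<in> smooth_fun A" "\<And>q. q \<in> U \<Longrightarrow> \<rho> q = 1"
    "\<And>q. q \<notin> U0 \<Longrightarrow> \<rho> q = 0"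
    by (rule A.bump[OF U0 p0]) (rule that; assumption)
  have sE: "s i q \<in> E q" if "q \<in> U0" "i < k" for i q
    using fr[OF that(1)] that(2) span_base[of "s i q" "(\<lambda>i. s i q) ` {..<k}"] by auto
  \<comment> \<open>The frame fields may leave \<open>E\<close> away from \<open>U0\<close>, hence
    may fail to be tangent. After multiplication by \<open>\<rho>\<close> they are tangent
    everywhere and can be pulled back.\<close>
  have ex: "\<exists>X. X \<in> vector_fields A \<and> (\<forall>q. \<rho> q *\<^sub>R s i q = push A B F (X q))" if i: "i < k" for i
  proof -
    have "\<rho> q *\<^sub>R s i q \<in> E q" for q
      using sE[OF _ i, of q] vector_subbundle_subspace[OF E, of q] \<rho>(6)[of q]
      by (cases "q \<in> U0") (auto intro: subspace_scale subspace_0)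
    then have "\<rho> q *\<^sub>R s i q \<in> tan_bundle A B F q" for q using sub by blast
    then obtain X where "X \<in> vector_fields A" "\<And>q. \<rho> q *\<^sub>R s i q = push A B F (X q)"
      using pull_back_field[OF field_along_scale[OF \<rho>(4) sf[OF i]]] by metis
    then show ?thesis by blast
  qed
  define X where "X i = (SOME X. X \<in> vector_fields A \<and> (\<forall>q. \<rho> q *\<^sub>R s i q = push A B F (X q)))" for i
  have X: "X i \<in> vector_fields A" "\<And>q. \<rho> q *\<^sub>R s i q = push A B F (X i q)" if "i < k" for i
    using someI_ex[OF ex[OF that]] unfolding X_def[symmetric] by auto
  have pX: "push A B F (X i q) = s i q" if "i < k" "q \<in> U" for i q
    using X(2)[OF that(1), of q] \<rho>(5)[OF that(2)] by simp
  have img: "push A B F ` (\<lambda>i. X i q) ` {..<k} = (\<lambda>i. s i q) ` {..<k}" if "q \<in> U" for q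
    unfolding image_image by (rule image_cong) (use pX that in auto)
  have span: "on_source A B F E q = span ((\<lambda>i. X i q) ` {..<k})" if q: "q \<in> U" for q
  proof -
    let ?S = "(\<lambda>i. X i q) ` {..<k}"
    have Eq: "E q = push A B F ` span ?S"
      unfolding linear_span_image[OF push_linear, symmetric] img[OF q]
      using fr[OF subsetD[OF \<rho>(3) q]] by simp
    have ST: "span ?S \<subseteq> tangent_space A q"
      by (rule span_minimal[OF _ A.subspace_tangent_space]) (use X(1) A.vector_fieldD(1) in auto)
    show ?thesis
    proof (intro equalityI subsetI)
      fix x assume x: "x \<in> on_source A B F E q"
      then obtain y where "y \<in> span ?S" "push A B F x = push A B F y" unfolding on_source_def Eq by auto
      then show "x \<in> span ?S" using push_inj[of x q y] x ST by (auto simp: on_source_def)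
    next
      fix x assume "x \<in> span ?S"
      then show "x \<in> on_source A B F E q" using ST unfolding on_source_def Eq by auto
    qed
  qed
  have frp: "inj_on (\<lambda>i. s i p) {..<k}" "independent ((\<lambda>i. s i p) ` {..<k})" using fr[OF p0] by auto
  have inj: "inj_on (\<lambda>i. X i p) {..<k}"
  proof (rule inj_onI)
    fix i j assume ij: "i \<in> {..<k}" "j \<in> {..<k}" "X i p = X j p"
    then have "s i p = s j p" using pX[of i p] pX[of j p] \<rho>(2) by simp
    then show "i = j" using frp(1) ij by (auto dest: inj_onD)
  qed
  have injp: "inj_on (push A B F) ((\<lambda>i. X i p) ` {..<k})"
    by (rule inj_on_subset[OF immersion[of p]]) (use X(1) A.vector_fieldD(1) in auto)
  have "independent ((\<lambda>i. X i p) ` {..<k})"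
    by (rule independent_imageD[OF push_linear injp]) (unfold img[OF \<rho>(2)], rule frp(2))
  with that[OF \<rho>(1,2) X(1) span inj] show thesis by blast
qed

text \<open>The two directions of the Frobenius theorem, stated for fields on \<open>M\<close> but
  with membership tested after \<open>push\<close>, where the algebra of the subbundles takes
  place.\<close>

lemma integrable_iff_involutive:
  assumes E: "vector_subbundle A B F E" and sub: "\<And>p. E p \<subseteq> tan_bundle A B F p"
  shows "integrable_distribution A (on_source A B F E) \<longleftrightarrow>
    (\<forall>X\<in>vector_fields A. \<forall>Y\<in>vector_fields A. (\<forall>p. push A B F (X p) \<in> E p) \<longrightarrow>
      (\<forall>p. push A B F (Y p) \<in> E p) \<longrightarrow> (\<forall>p. push A B F (lie_bracket X Y p) \<in> E p))" (is "?L \<longleftrightarrow> ?R")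
proof
  assume L: ?L
  show ?R
  proof (intro ballI impI allI)
    fix X Y p assume X: "X \<in> vector_fields A" "\<forall>p. push A B F (X p) \<in> E p"
      and Y: "Y \<in> vector_fields A" "\<forall>p. push A B F (Y p) \<in> E p"
    have "X q \<in> on_source A B F E q" "Y q \<in> on_source A B F E q" for q
      using X Y A.vector_fieldD(1) by (auto simp: on_source_def)
    then have "lie_bracket X Y p \<in> on_source A B F E p"
      by (rule A.integrable_imp_involutive[OF L X(1) _ Y(1)])
    then show "push A B F (lie_bracket X Y p) \<in> E p" by (simp add: on_source_def)
  qed
next
  assume R: ?R
  have inv: "lie_bracket X Y q \<in> on_source A B F E q"
    if "X \<in> vector_fields A" "Y \<in> vector_fields A" "\<And>q. X q \<in> on_source A B F E q" "\<And>q. Y q \<in> on_source A B F E q"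
    for X Y q
    using bspec[OF bspec[OF R that(1)] that(2)] that(3,4) A.lie_bracket_in[OF that(1,2)]
    by (simp add: on_source_def)
  have zero: "0 \<in> on_source A B F E q" for q
    using subspace_0[OF A.subspace_tangent_space] subspace_0[OF vector_subbundle_subspace[OF E]]
      linear_0[OF push_linear] by (simp add: on_source_def)
  show ?L
    unfolding integrable_distribution_def
  proof
    fix p
    show "\<exists>S. p \<in> S \<and> integral_manifold A (on_source A B F E) S"
    proof (rule on_source_frame[OF E sub, of p])
      fix k U X
      assume f: "open U" "p \<in> U" "\<And>i. i < k \<Longrightarrow> X i \<in> vector_fields A"
        "\<And>q. q \<in> U \<Longrightarrow> on_source A B F E q = span ((\<lambda>i. X i q) ` {..<k})"
        "inj_on (\<lambda>i. X i p) {..<k::nat}" "independent ((\<lambda>i. X i p) ` {..<k})"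
      show ?thesis
        by (rule A.Frobenius[OF f zero inv]) blast+
    qed
  qed
qed

lemma section_push:
  assumes sub: "\<And>p. E p \<subseteq> tan_bundle A B F p"
  shows "V \<in> sections A B F E \<longleftrightarrow>
    (\<exists>X\<in>vector_fields A. V = (\<lambda>p. push A B F (X p)) \<and> (\<forall>p. push A B F (X p) \<in> E p))"
proof
  assume V: "V \<in> sections A B F E"
  then have "V \<in> fields_along A B F" "\<And>p. V p \<in> tan_bundle A B F p" using sub by (auto simp: sections_def)
  then obtain X where "X \<in> vector_fields A" "\<And>p. V p = push A B F (X p)"
    by (rule pull_back_field) (rule that; assumption)
  then show "\<exists>X\<in>vector_fields A. V = (\<lambda>p. push A B F (X p)) \<and> (\<forall>p. push A B F (X p) \<in> E p)"
    using V by (intro bexI[of _ X]) (auto simp: sections_def)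
qed (auto simp: sections_def push_field)

text \<open>Common frame for both parts of the theorem: with \<open>\<Phi>\<close> and
  \<open>\<Psi>\<close> standing for the two sides of either condition, only a pointwise equivalence
  for brackets remains to be checked.\<close>

lemma integrable_iff_bracket:
  assumes E: "vector_subbundle A B F E" and sub: "\<And>p. E p \<subseteq> tan_bundle A B F p"
    and bracket: "\<And>X Y p. X \<in> vector_fields A \<Longrightarrow> Y \<in> vector_fields A \<Longrightarrow>
      (\<lambda>p. push A B F (X p)) \<in> sections A B F E \<Longrightarrow> (\<lambda>p. push A B F (Y p)) \<in> sections A B F E \<Longrightarrow>
      push A B F (lie_bracket X Y p) \<in> E p \<longleftrightarrow>
        \<Phi> (\<lambda>p. push A B F (X p)) (\<lambda>p. push A B F (Y p)) p = \<Psi> (\<lambda>p. push A B F (X p)) (\<lambda>p. push A B F (Y p)) p"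
  shows "integrable_distribution A (on_source A B F E) \<longleftrightarrow>
    (\<forall>X\<in>sections A B F E. \<forall>Y\<in>sections A B F E. \<Phi> X Y = \<Psi> X Y)"
proof -
  have sec: "(\<lambda>p. push A B F (X p)) \<in> sections A B F E" if "X \<in> vector_fields A" "\<forall>p. push A B F (X p) \<in> E p" for X
    using that by (auto simp: sections_def push_field)
  show ?thesis
    unfolding integrable_iff_involutive[OF E sub]
  proof (intro iffI ballI impI allI)
    fix V W assume inv: "\<forall>X\<in>vector_fields A. \<forall>Y\<in>vector_fields A. (\<forall>p. push A B F (X p) \<in> E p) \<longrightarrow>
      (\<forall>p. push A B F (Y p) \<in> E p) \<longrightarrow> (\<forall>p. push A B F (lie_bracket X Y p) \<in> E p)"
      and V: "V \<in> sections A B F E" and W: "W \<in> sections A B F E"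
    obtain X where X: "X \<in> vector_fields A" "V = (\<lambda>p. push A B F (X p))" "\<forall>p. push A B F (X p) \<in> E p"
      using V section_push[OF sub] by blast
    obtain Y where Y: "Y \<in> vector_fields A" "W = (\<lambda>p. push A B F (Y p))" "\<forall>p. push A B F (Y p) \<in> E p"
      using W section_push[OF sub] by blast
    show "\<Phi> V W = \<Psi> V W"
    proof
      fix p
      have "push A B F (lie_bracket X Y p) \<in> E p"
        using bspec[OF bspec[OF inv X(1)] Y(1)] X(3) Y(3) by blast
      then show "\<Phi> V W p = \<Psi> V W p"
        using bracket[OF X(1) Y(1) sec[OF X(1,3)] sec[OF Y(1,3)]] X(2) Y(2) by simp
    qed
  next
    fix X Y p assume eq: "\<forall>X\<in>sections A B F E. \<forall>Y\<in>sections A B F E. \<Phi> X Y = \<Psi> X Y"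
      and X: "X \<in> vector_fields A" "\<forall>p. push A B F (X p) \<in> E p"
      and Y: "Y \<in> vector_fields A" "\<forall>p. push A B F (Y p) \<in> E p"
    show "push A B F (lie_bracket X Y p) \<in> E p"
      using bracket[OF X(1) Y(1) sec[OF X] sec[OF Y]] bspec[OF bspec[OF eq sec[OF X]] sec[OF Y]] by simp
  qed
qed

end

section \<open>The algebra of STCR submanifolds\<close>

lemma symmetric_bilinear_onD:
  assumes "symmetric_bilinear_on T b"
  shows "x \<in> T \<Longrightarrow> y \<in> T \<Longrightarrow> b x y = b y x"
    "x \<in> T \<Longrightarrow> y \<in> T \<Longrightarrow> z \<in> T \<Longrightarrow> b x (y + z) = b x y + b x z"
    "x \<in> T \<Longrightarrow> y \<in> T \<Longrightarrow> b x (c *\<^sub>R y) = c * b x y"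
  using assms unfolding symmetric_bilinear_on_def linear_map_on_def by auto

lemma symmetric_bilinear_on_add_left:
  assumes b: "symmetric_bilinear_on T b" and T: "subspace T" and x: "x \<in> T" "y \<in> T" "z \<in> T"
  shows "b (x + y) z = b x z + b y z" "b (x - y) z = b x z - b y z" "b (c *\<^sub>R x) z = c * b x z" "b 0 z = 0"
proof -
  note D = symmetric_bilinear_onD[OF b]
  have *: "b (x + y) z = b x z + b y z" if "x \<in> T" for x
    using D(1)[OF subspace_add[OF T that x(2)] x(3)] D(2)[OF x(3) that x(2)] D(1)[OF that x(3)] D(1)[OF x(2,3)]
    by simp
  show "b (x - y) z = b x z - b y z"
    using *[OF subspace_diff[OF T x(1,2)]] by simp
  have s: "b (c *\<^sub>R x) z = c * b x z" for c
    using D(1)[OF subspace_scale[OF T x(1)] x(3)] D(3)[OF x(3,1)] D(1)[OF x(1,3)] by simp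
  show "b (x + y) z = b x z + b y z" "b (c *\<^sub>R x) z = c * b x z" "b 0 z = 0"
    using *[OF x(1)] s[of c] s[of 0] by simp_all
qed

lemma bilinear_zero_on_span:
  assumes b: "symmetric_bilinear_on T b" and T: "subspace T" and S: "S \<subseteq> T" and x: "x \<in> T"
    and z: "\<And>y. y \<in> S \<Longrightarrow> b x y = 0" and y: "y \<in> span S"
  shows "b x y = 0"
proof -
  have "y \<in> T \<and> b x y = 0"
    using y
  proof (induction rule: span_induct_alt)
    case base
    show ?case using subspace_0[OF T] symmetric_bilinear_onD(3)[OF b x subspace_0[OF T], of 0] by simp
  next
    case (step c u v)
    then have u: "u \<in> T" using S by blast
    then show ?case
      using step z[of u] symmetric_bilinear_onD(2,3)[OF b x] subspace_scale[OF T u, of c] subspace_add[OF T]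
      by simp
  qed
  then show ?thesis ..
qed

text \<open>With a basis \<open>\<beta>\<close> of \<open>W\<close>, non-degeneracy says that the endomorphism \<open>u \<mapsto> \<Sum>e\<in>\<beta>. b u e *\<^sub>R e\<close>
  of \<open>W\<close> is injective, hence onto.\<close>

lemma nondegenerate_projection:
  assumes b: "symmetric_bilinear_on T b" and T: "subspace T"
    and S: "finite S" "S \<subseteq> T" "W = span S" and nd: "nondegenerate_on W b" and w: "w \<in> T"
  obtains u where "u \<in> W" "\<And>y. y \<in> W \<Longrightarrow> b (w - u) y = 0"
proof -
  obtain \<beta> where \<beta>: "\<beta> \<subseteq> S" "independent \<beta>" "S \<subseteq> span \<beta>"
    using maximal_independent_subset by blast
  have fin: "finite \<beta>" using \<beta>(1) S(1) finite_subset by blast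
  have W: "W = span \<beta>"
    using span_mono[OF \<beta>(1)] span_minimal[OF \<beta>(3) subspace_span] S(3) by auto
  have \<beta>T: "\<beta> \<subseteq> T" using \<beta>(1) S(2) by auto
  have WT: "W \<subseteq> T" unfolding W by (rule span_minimal[OF \<beta>T T])
  obtain \<phi> where \<phi>: "linear \<phi>" "\<And>x. x \<in> \<beta> \<Longrightarrow> \<phi> x = (\<Sum>e\<in>\<beta>. b x e *\<^sub>R e)"
    using linear_independent_extend[OF \<beta>(2), of "\<lambda>x. \<Sum>e\<in>\<beta>. b x e *\<^sub>R e"] by blast
  have "u \<in> T \<and> \<phi> u = (\<Sum>e\<in>\<beta>. b u e *\<^sub>R e)" if "u \<in> span \<beta>" for u
    using that
  proof (induction rule: span_induct_alt)
    case base
    have "(\<Sum>e\<in>\<beta>. b 0 e *\<^sub>R e) = 0"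
      using symmetric_bilinear_on_add_left(4)[OF b T subspace_0[OF T] subspace_0[OF T]] \<beta>T
      by (intro sum.neutral) auto
    then show ?case using linear_0[OF \<phi>(1)] subspace_0[OF T] by simp
  next
    case (step c x y)
    have x: "x \<in> T" "y \<in> T" using step \<beta>T by auto
    have "b (c *\<^sub>R x + y) e = c * b x e + b y e" if "e \<in> \<beta>" for e
      using symmetric_bilinear_on_add_left[OF b T] x that \<beta>T subspace_scale[OF T x(1)] by auto
    then have "(\<Sum>e\<in>\<beta>. b (c *\<^sub>R x + y) e *\<^sub>R e) = c *\<^sub>R (\<Sum>e\<in>\<beta>. b x e *\<^sub>R e) + (\<Sum>e\<in>\<beta>. b y e *\<^sub>R e)"
      by (simp add: scaleR_add_left sum.distrib scaleR_sum_right)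
    then show ?case
      using step \<phi> x subspace_add[OF T subspace_scale[OF T x(1)] x(2)] by (simp add: linear_add linear_cmul)
  qed
  then have \<phi>W: "\<phi> u = (\<Sum>e\<in>\<beta>. b u e *\<^sub>R e)" if "u \<in> span \<beta>" for u using that by blast
  have coeff: "u e = v e" if "(\<Sum>e\<in>\<beta>. u e *\<^sub>R e) = (\<Sum>e\<in>\<beta>. v e *\<^sub>R e)" "e \<in> \<beta>" for u v e
  proof -
    have "(\<Sum>e\<in>\<beta>. (u e - v e) *\<^sub>R e) = 0" using that(1) by (simp add: scaleR_diff_left sum_subtractf)
    from independentD[OF \<beta>(2) fin order_refl this that(2)] show ?thesis by simp
  qed
  have inj: "inj_on \<phi> (span \<beta>)"
  proof (rule linear_inj_on_iff_eq_0[OF \<phi>(1) subspace_span, THEN iffD2], intro ballI impI)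
    fix u assume u: "u \<in> span \<beta>" "\<phi> u = 0"
    have "b u e = 0" if "e \<in> \<beta>" for e
      using coeff[of "b u" "\<lambda>_. 0" e] \<phi>W[OF u(1)] u(2) that by simp
    then have "b u y = 0" if "y \<in> W" for y
      using bilinear_zero_on_span[OF b T \<beta>T, of u y] u WT W that by blast
    then show "u = 0" using nd u(1) W unfolding nondegenerate_on_def by blast
  qed
  have ind: "independent (\<phi> ` \<beta>)" by (rule linear_independent_injective_image[OF \<phi>(1) \<beta>(2) inj])
  have card: "card (\<phi> ` \<beta>) = card \<beta>"
    by (rule card_image[OF inj_on_subset[OF inj span_superset]])
  have sub: "\<phi> ` \<beta> \<subseteq> span \<beta>"
  proof (rule image_subsetI)
    show "\<phi> x \<in> span \<beta>" if "x \<in> \<beta>" for x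
      unfolding \<phi>(2)[OF that] by (intro span_sum span_scale) (rule span_base)
  qed
  \<comment> \<open>The vector whose coefficients are the pairings of \<open>w\<close> with the
    basis. A preimage of \<open>z\<close> under \<open>\<phi>\<close> has the same pairings as
    \<open>w\<close> and is the wanted projection.\<close>
  define z where "z = (\<Sum>e\<in>\<beta>. b w e *\<^sub>R e)"
  have z: "z \<in> span \<beta>" unfolding z_def by (intro span_sum span_scale span_base)
  have "z \<in> span (\<phi> ` \<beta>)"
  proof (rule ccontr)
    assume n: "z \<notin> span (\<phi> ` \<beta>)"
    then have "z \<notin> \<phi> ` \<beta>" by (rule contrapos_nn) (rule span_base)
    then have "card (insert z (\<phi> ` \<beta>)) = Suc (card \<beta>)" using fin card by simp
    moreover have "card (insert z (\<phi> ` \<beta>)) \<le> card \<beta>"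
      using independent_span_bound[OF fin independent_insertI[OF n ind]] sub z by auto
    ultimately show False by simp
  qed
  then obtain u where u: "u \<in> span \<beta>" "\<phi> u = z" unfolding linear_span_image[OF \<phi>(1)] by auto
  have uT: "u \<in> T" using u(1) WT W by auto
  have "b (w - u) e = 0" if "e \<in> \<beta>" for e
    using coeff[of "b u" "b w" e] u \<phi>W[OF u(1)] that symmetric_bilinear_on_add_left(2)[OF b T w uT, of e] \<beta>T
    by (auto simp: z_def)
  then have "b (w - u) y = 0" if "y \<in> W" for y
    using bilinear_zero_on_span[OF b T \<beta>T subspace_diff[OF T w uT], of y] that W by blast
  then show thesis using that u(1) W by blast
qed

lemma component_eq:
  assumes W: "subspace W1" "subspace W2" "W1 \<inter> W2 = {0}" and w: "w \<in> W1" "v - w \<in> W2"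
  shows "component W1 W2 v = w"
  unfolding component_def
proof (rule the_equality)
  fix w' assume w': "w' \<in> W1 \<and> v - w' \<in> W2"
  have "w' - w \<in> W1" using w w' W(1) by (simp add: subspace_diff)
  moreover have eq: "w' - w = (v - w) - (v - w')" by simp
  have "w' - w \<in> W2"
    unfolding eq by (rule subspace_diff[OF W(2)]) (use w w' in auto)
  ultimately have "w' - w \<in> {0}" unfolding W(3)[symmetric] by (rule IntI)
  then show "w' = w" by simp
qed (use w in simp)

text \<open>Taking components is additive, so equal components mean that the difference has no part
  in \<open>W1\<close>.\<close>

lemma component_eq_iff:
  assumes W: "subspace W1" "subspace W2" "W1 \<inter> W2 = {0}" and v: "v \<in> W1 + W2" "v' \<in> W1 + W2"
  shows "component W1 W2 v = component W1 W2 v' \<longleftrightarrow> v - v' \<in> W2"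
proof -
  obtain a b where a: "v = a + b" "a \<in> W1" "b \<in> W2" using v(1) by (auto simp: set_plus_def)
  obtain a' b' where a': "v' = a' + b'" "a' \<in> W1" "b' \<in> W2" using v(2) by (auto simp: set_plus_def)
  have c: "component W1 W2 v = a" "component W1 W2 v' = a'"
    using a a' by (auto intro!: component_eq[OF W])
  have e: "v - v' = (a - a') + (b - b')" using a a' by simp
  have "v - v' \<in> W2 \<longleftrightarrow> a = a'"
  proof
    assume "v - v' \<in> W2"
    moreover have "b - b' \<in> W2" using a(3) a'(3) W(2) by (rule subspace_diff[rotated])
    ultimately have "(v - v') - (b - b') \<in> W2" by (rule subspace_diff[OF W(2)])
    then have "a - a' \<in> W1 \<inter> W2" using e a a' W(1) by (simp add: subspace_diff)
    then show "a = a'" using W(3) by simp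
  qed (use e a a' W(2) in \<open>simp add: subspace_diff\<close>)
  then show ?thesis using c by simp
qed

section \<open>Linear algebra in the fibre over one point\<close>

text \<open>One fibre, with \<open>T\<close> the ambient tangent space. The non-degeneracy of the
  screens appears through its consequence \<open>projections\<close>, and the dual frames of the
  radical and \<open>ltr\<close> through the second clause of \<open>ltr\<close>, so no frames occur
  in the algebra.\<close>

locale stcr_algebra =
  fixes T TM Rad N ST SN ltr D0 D1 D2 D' L1 S :: "'v::real_vector set"
    and g :: "'v \<Rightarrow> 'v \<Rightarrow> real" and J :: "'v \<Rightarrow> 'v"
  assumes T: "subspace T" and TM: "subspace TM" "TM \<subseteq> T"
    and g: "symmetric_bilinear_on T g"
    and J: "linear_map_on T T J" "\<And>x. x \<in> T \<Longrightarrow> J (J x) = - x"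
    and N: "N = {w \<in> T. \<forall>x\<in>TM. g w x = 0}" and Rad: "Rad = TM \<inter> N"
    and sub: "subspace ST" "subspace SN" "subspace ltr" "subspace D0" "subspace D1" "subspace D2"
      "subspace D'" "subspace L1" "subspace S"
    and inT: "ltr \<subseteq> T" "D' \<subseteq> T" "L1 \<subseteq> T" "S \<subseteq> T" "D0 \<subseteq> T"
    and screen: "orthogonal_sum g TM ST Rad" "orthogonal_sum g N SN Rad"
    and projections: "\<And>w. w \<in> T \<Longrightarrow> \<exists>u\<in>ST. \<forall>y\<in>ST. g (w - u) y = 0"
      "\<And>w. w \<in> T \<Longrightarrow> \<exists>u\<in>SN. \<forall>y\<in>SN. g (w - u) y = 0"
    and ltr: "direct_sum {w \<in> T. \<forall>x\<in>ST + SN. g w x = 0} Rad ltr"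
      "\<And>l. l \<in> ltr \<Longrightarrow> (\<And>\<xi>. \<xi> \<in> Rad \<Longrightarrow> g l \<xi> = 0) \<Longrightarrow> l = 0"
    and rad: "direct_sum Rad D1 D2" "J ` D1 \<subseteq> ST" "J ` D2 \<subseteq> SN"
    and decST: "orthogonal_sum g ST (J ` D1 + D') D0" "J ` D1 \<inter> D' = {0}" "J ` D0 = D0"
    and JD': "orthogonal_sum g (J ` D') L1 S" "L1 \<subseteq> ltr" "S \<subseteq> SN" "J ` L1 \<subseteq> ST"
begin

lemma J_simps:
  "x \<in> T \<Longrightarrow> J x \<in> T" "x \<in> T \<Longrightarrow> y \<in> T \<Longrightarrow> J (x + y) = J x + J y"
  "x \<in> T \<Longrightarrow> y \<in> T \<Longrightarrow> J (x - y) = J x - J y" "x \<in> T \<Longrightarrow> J (- x) = - J x"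
  using linear_map_onD[OF J(1)] linear_map_on_diff[OF J(1) T] linear_map_onD(3)[OF J(1), of x "-1"] by auto

lemma J_zero: "J 0 = 0"
  using J_simps(3)[of 0 0] subspace_0[OF T] by simp

lemma zero_J: "subspace E \<Longrightarrow> 0 \<in> J ` E"
  by (rule image_eqI[of _ _ 0]) (simp_all add: J_zero subspace_0)

lemma J_eq_zero: "x \<in> T \<Longrightarrow> J x = 0 \<Longrightarrow> x = 0"
  using J(2)[of x] J_zero by simp

lemma ST_TM: "ST \<subseteq> TM" and Rad_TM: "Rad \<subseteq> TM" and SN_N: "SN \<subseteq> N" and Rad_ST: "Rad \<inter> ST = {0}"
  and N_T: "N \<subseteq> T" and Rad_SN: "SN \<inter> Rad = {0}"
proof -
  have R0: "0 \<in> Rad"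
    using screen(1) by (auto simp: orthogonal_sum_def direct_sum_def)
  show "N \<subseteq> T" using N by auto
  show "Rad \<subseteq> TM" using Rad by auto
  show "ST \<subseteq> TM" using screen(1) R0 set_zero_plus2[OF R0, of ST] unfolding orthogonal_sum_def direct_sum_def
    by (metis add.commute)
  show "SN \<subseteq> N" using screen(2) R0 set_zero_plus2[OF R0, of SN] unfolding orthogonal_sum_def direct_sum_def
    by (metis add.commute)
  show "Rad \<inter> ST = {0}" "SN \<inter> Rad = {0}" using screen by (auto simp: orthogonal_sum_def direct_sum_def)
qed

lemma D_in: "D1 \<subseteq> Rad" "D2 \<subseteq> Rad" "D0 \<subseteq> ST" "D' \<subseteq> ST" "J ` D' = L1 + S" "L1 \<subseteq> J ` D'" "S \<subseteq> J ` D'"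
proof -
  have z: "0 \<in> D1" "0 \<in> D2" "0 \<in> D0" "0 \<in> D'" "0 \<in> J ` D1" "0 \<in> L1" "0 \<in> S"
    using sub subspace_0 zero_J by auto
  have eq: "Rad = D1 + D2" "ST = (J ` D1 + D') + D0" "J ` D' = L1 + S"
    using rad(1) decST(1) JD'(1) by (auto simp: orthogonal_sum_def direct_sum_def)
  show "J ` D' = L1 + S" by (rule eq)
  show "D1 \<subseteq> Rad" "S \<subseteq> J ` D'" "L1 \<subseteq> J ` D'" "D2 \<subseteq> Rad"
    unfolding eq using set_zero_plus2[OF z(1)] set_zero_plus2[OF z(2)] set_zero_plus2[OF z(6)] set_zero_plus2[OF z(7)]
    by (metis add.commute)+
  have "0 \<in> J ` D1 + D'" using set_plus_intro[OF z(5,4)] by simp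
  then show "D0 \<subseteq> ST" unfolding eq by (rule set_zero_plus2)
  have "D' \<subseteq> J ` D1 + D'" by (rule set_zero_plus2[OF z(5)])
  also have "\<dots> \<subseteq> (J ` D1 + D') + D0" using set_zero_plus2[OF z(3), of "J ` D1 + D'"] by (metis add.commute)
  finally show "D' \<subseteq> ST" unfolding eq .
qed

abbreviation "D \<equiv> D0 + D1 + J ` D1"
abbreviation "Dt \<equiv> D2 + J ` L1 + J ` S"
abbreviation "tr \<equiv> ltr + SN"

lemma DT: "D1 \<subseteq> T" "D2 \<subseteq> T" "TM \<subseteq> T" "SN \<subseteq> T" "ST \<subseteq> T" "tr \<subseteq> T"
proof -
  show "D1 \<subseteq> T" "D2 \<subseteq> T" "TM \<subseteq> T" "SN \<subseteq> T" "ST \<subseteq> T"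
    using D_in Rad_TM TM(2) SN_N N_T ST_TM by auto
  then show "tr \<subseteq> T" using inT(1) subspace_add[OF T] by (force simp: set_plus_def)
qed

lemma sum3: "x \<in> U + V + W \<longleftrightarrow> (\<exists>a\<in>U. \<exists>b\<in>V. \<exists>c\<in>W. x = a + b + c)"
  by (force simp: set_plus_def)

lemma JS_ST: "J ` S \<subseteq> ST"
proof
  fix x assume "x \<in> J ` S"
  then obtain d where d: "d \<in> D'" "x = J (J d)" using D_in(7) by blast
  then have "x = - d" using J(2) inT by auto
  then show "x \<in> ST" using d D_in(4) subspace_neg[OF sub(1)] by auto
qed

lemma D_TM: "D \<subseteq> TM"
proof
  fix x assume "x \<in> D"
  then obtain a b c where x: "a \<in> D0" "b \<in> D1" "c \<in> J ` D1" "x = a + b + c" unfolding sum3 by blast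
  then have "a \<in> TM" "b \<in> TM" "c \<in> TM" using D_in rad(2) ST_TM Rad_TM by blast+
  then show "x \<in> TM" using x(4) subspace_add[OF TM(1)] by simp
qed

lemma Dt_TM: "Dt \<subseteq> TM"
proof
  fix x assume "x \<in> Dt"
  then obtain a b c where x: "a \<in> D2" "b \<in> J ` L1" "c \<in> J ` S" "x = a + b + c" unfolding sum3 by blast
  then have "a \<in> TM" "b \<in> TM" "c \<in> TM" using D_in JD'(4) JS_ST ST_TM Rad_TM by blast+
  then show "x \<in> TM" using x(4) subspace_add[OF TM(1)] by simp
qed

text \<open>\<open>J\<close> preserves \<open>D0\<close> and exchanges \<open>D1\<close> with its
  image, up to sign.\<close>

lemma J_D: "J ` D \<subseteq> D"
proof
  fix y assume "y \<in> J ` D"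
  then obtain x where "x \<in> D" "y = J x" by blast
  then obtain a b c where x: "a \<in> D0" "b \<in> D1" "c \<in> D1" "y = J (a + b + J c)" unfolding sum3 by blast
  have "a \<in> T" "b \<in> T" "c \<in> T" using x DT inT by auto
  then have m: "a \<in> T" "b \<in> T" "c \<in> T" "J c \<in> T" "a + b \<in> T" using J_simps(1) subspace_add[OF T] by auto
  have "y = J a + (- c) + J b" using x(4) J_simps(2)[OF m(5,4)] J_simps(2)[OF m(1,2)] J(2)[OF m(3)] by simp
  moreover have "J a \<in> D0" using x(1) decST(3) by blast
  moreover have "- c \<in> D1" using x(3) subspace_neg[OF sub(5)] by blast
  ultimately show "y \<in> D" unfolding sum3 using x(2) by blast
qed

text \<open>\<open>J\<close> sends \<open>D2\<close> into \<open>SN\<close> and returns the other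
  two summands, up to sign, to \<open>L1\<close> inside \<open>ltr\<close> and \<open>S\<close>
  inside \<open>SN\<close>.\<close>

lemma J_Dt: "J ` Dt \<subseteq> tr"
proof
  fix y assume "y \<in> J ` Dt"
  then obtain x where "x \<in> Dt" "y = J x" by blast
  then obtain a b c where x: "a \<in> D2" "b \<in> L1" "c \<in> S" "y = J (a + J b + J c)" unfolding sum3 by blast
  have "a \<in> T" "b \<in> T" "c \<in> T" using x DT inT by auto
  then have m: "a \<in> T" "b \<in> T" "c \<in> T" "J b \<in> T" "J c \<in> T" "a + J b \<in> T"
    using J_simps(1) subspace_add[OF T] by auto
  have "y = (- b) + (J a - c)"
    using x(4) J_simps(2)[OF m(6,5)] J_simps(2)[OF m(1,4)] J(2)[OF m(3)] J(2)[OF m(2)] by simp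
  moreover have "- b \<in> ltr" using x(2) JD'(2) subspace_neg[OF sub(3)] by blast
  moreover have "J a - c \<in> SN" using x(1,3) rad(3) JD'(3) by (intro subspace_diff[OF sub(2)]) auto
  ultimately show "y \<in> tr" using set_plus_intro[of "- b" ltr "J a - c" SN] by simp
qed

lemma TM_split:
  assumes "v \<in> TM"
  obtains d e where "d \<in> D" "e \<in> Dt" "v = d + e"
proof -
  have "v \<in> ST + Rad" using assms screen(1) by (simp add: orthogonal_sum_def direct_sum_def)
  then obtain s r where s: "s \<in> ST" "r \<in> Rad" "v = s + r" by (auto simp: set_plus_def)
  have "s \<in> J ` D1 + D' + D0" using s(1) decST(1) by (simp add: orthogonal_sum_def direct_sum_def)
  then obtain a d' d0 where a: "a \<in> J ` D1" "d' \<in> D'" "d0 \<in> D0" "s = a + d' + d0" unfolding sum3 by blast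
  have "r \<in> D1 + D2" using s(2) rad(1) by (simp add: direct_sum_def)
  then obtain d1 d2 where r: "d1 \<in> D1" "d2 \<in> D2" "r = d1 + d2" by (auto simp: set_plus_def)
  have "J d' \<in> L1 + S" using a(2) D_in(5) by blast
  then obtain l \<sigma> where l: "l \<in> L1" "\<sigma> \<in> S" "J d' = l + \<sigma>" by (auto simp: set_plus_def)
  have m: "l \<in> T" "\<sigma> \<in> T" "d' \<in> T" using l a(2) inT by auto
  have "d' = - J (J d')" using J(2)[OF m(3)] by simp
  also have "\<dots> = J (- l) + J (- \<sigma>)" using m J_simps(2,4) by (simp add: l(3))
  finally have d': "d' = J (- l) + J (- \<sigma>)" .
  have "J (- l) \<in> J ` L1" "J (- \<sigma>) \<in> J ` S"
    using l(1,2) subspace_neg[OF sub(8)] subspace_neg[OF sub(9)] by blast+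
  then have "d2 + J (- l) + J (- \<sigma>) \<in> Dt" unfolding sum3 using r(2) by blast
  moreover have "d0 + d1 + a \<in> D" unfolding sum3 using a(1,3) r(1) by blast
  moreover have "v = (d0 + d1 + a) + (d2 + J (- l) + J (- \<sigma>))"
    unfolding s(3) a(4) r(3) d' by (simp add: algebra_simps)
  ultimately show thesis using that by blast
qed

text \<open>Pair with the radical: it annihilates \<open>TM\<close> and \<open>SN\<close>, so the
  \<open>ltr\<close> part of a common vector pairs to 0 with it and vanishes by duality. What is
  left is in \<open>SN\<close> and in the radical, whose intersection is 0.\<close>

lemma TM_tr: "TM \<inter> tr = {0}"
proof
  show "{0} \<subseteq> TM \<inter> tr"
    using subspace_0[OF TM(1)] subspace_0[OF subspace_plus[OF sub(3,2)]] by blast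
  show "TM \<inter> tr \<subseteq> {0}"
  proof
    fix x assume x: "x \<in> TM \<inter> tr"
    then obtain l \<sigma> where l: "l \<in> ltr" "\<sigma> \<in> SN" "x = l + \<sigma>" by (auto simp: set_plus_def)
    have m: "l \<in> T" "\<sigma> \<in> T" "x \<in> T" using l inT DT x by auto
    have "g l \<xi> = 0" if \<xi>: "\<xi> \<in> Rad" for \<xi>
    proof -
      have \<xi>T: "\<xi> \<in> T" "\<xi> \<in> TM" "\<xi> \<in> N" using \<xi> Rad TM(2) by auto
      have "g \<xi> x = 0" using \<xi>T(3) x N by auto
      then have "g x \<xi> = 0" using symmetric_bilinear_onD(1)[OF g m(3) \<xi>T(1)] by simp
      moreover have "g \<sigma> \<xi> = 0" using l(2) SN_N \<xi>T(2) N by blast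
      ultimately show ?thesis using symmetric_bilinear_on_add_left(1)[OF g T m(1,2) \<xi>T(1)] l(3) by simp
    qed
    then have "l = 0" by (rule ltr(2)[OF l(1)])
    then have "x \<in> SN" using l by simp
    then have "x \<in> SN \<inter> Rad" using x SN_N Rad by blast
    then show "x \<in> {0}" unfolding Rad_SN .
  qed
qed

text \<open>Subtracting the projections to the mutually orthogonal screens leaves a vector
  orthogonal to both, which by the defining property of \<open>ltr\<close> is a sum from the radical
  and \<open>ltr\<close>.\<close>

lemma T_split: "T = TM + tr"
proof
  show "TM + tr \<subseteq> T"
  proof
    fix x assume "x \<in> TM + tr"
    then obtain a b where "x = a + b" "a \<in> TM" "b \<in> tr" by (rule set_plus_elim)
    then show "x \<in> T" using DT(3,6) subspace_add[OF T, of a b] by blast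
  qed
  show "T \<subseteq> TM + tr"
  proof
    fix w assume w: "w \<in> T"
    obtain u where u: "u \<in> ST" "\<And>y. y \<in> ST \<Longrightarrow> g (w - u) y = 0" using projections(1)[OF w] by blast
    obtain v where v: "v \<in> SN" "\<And>y. y \<in> SN \<Longrightarrow> g (w - v) y = 0" using projections(2)[OF w] by blast
    have m0: "u \<in> T" "v \<in> T" using u(1) v(1) DT by auto
    note m = m0 subspace_diff[OF T w m0(1)] subspace_diff[OF T w m0(2)]
      subspace_diff[OF T subspace_diff[OF T w m0(1)] m0(2)]
    have vST: "g v y = 0" if "y \<in> ST" for y using v(1) SN_N that ST_TM N by blast
    have uSN: "g u y = 0" if "y \<in> SN" for y
    proof -
      have "g y u = 0" using that SN_N N u(1) ST_TM by blast
      then show ?thesis using symmetric_bilinear_onD(1)[OF g m(1), of y] that DT(4) by auto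
    qed
    have 1: "g (w - u - v) y = 0" if y: "y \<in> ST" for y
      using symmetric_bilinear_on_add_left(2)[OF g T m(3,2)] y DT(5) u(2)[OF y] vST[OF y] by auto
    have e: "w - u - v = w - v - u" by simp
    have 2: "g (w - u - v) y = 0" if y: "y \<in> SN" for y
      unfolding e using symmetric_bilinear_on_add_left(2)[OF g T m(4,1)] y DT(4) v(2)[OF y] uSN[OF y] by auto
    have "g (w - u - v) x = 0" if x: "x \<in> ST + SN" for x
    proof -
      obtain a b where "a \<in> ST" "b \<in> SN" "x = a + b" using x by (auto simp: set_plus_def)
      then show ?thesis using 1[of a] 2[of b] symmetric_bilinear_onD(2)[OF g m(5), of a b] DT(4,5) by auto
    qed
    then have "w - u - v \<in> Rad + ltr" using ltr(1) m(5) by (auto simp: direct_sum_def)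
    then obtain r l where r: "r \<in> Rad" "l \<in> ltr" "w - u - v = r + l" by (auto simp: set_plus_def)
    have "w = (u + r) + (l + v)" using r(3) by (simp add: algebra_simps)
    moreover have "u + r \<in> TM" using u(1) r(1) ST_TM Rad_TM subspace_add[OF TM(1)] by blast
    moreover have "l + v \<in> tr" by (rule set_plus_intro[OF r(2) v(1)])
    ultimately show "w \<in> TM + tr" by (metis set_plus_intro)
  qed
qed

text \<open>Write \<open>v = d + e\<close> by \<open>TM_split\<close>. Then \<open>J d\<close> is
  tangent and \<open>J e\<close> transversal, so membership of \<open>J v\<close> on one side forces
  the other part into the zero intersection, and \<open>J\<close> is injective.\<close>

lemma J_mem_iff:
  assumes v: "v \<in> TM"
  shows "J v \<in> TM \<longleftrightarrow> v \<in> D" "J v \<in> tr \<longleftrightarrow> v \<in> Dt"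
proof -
  obtain d e where de: "d \<in> D" "e \<in> Dt" "v = d + e" using TM_split[OF v] by blast
  have m: "d \<in> T" "e \<in> T" using de D_TM Dt_TM TM(2) by auto
  have Jv: "J v = J d + J e" using J_simps(2)[OF m] de(3) by simp
  have Jd: "J d \<in> TM" using de(1) J_D D_TM by blast
  have Je: "J e \<in> tr" using de(2) J_Dt by blast
  have str: "subspace tr" by (rule subspace_plus[OF sub(3,2)])
  show "J v \<in> TM \<longleftrightarrow> v \<in> D"
  proof
    assume "J v \<in> TM"
    then have "J e \<in> TM" using Jv Jd subspace_diff[OF TM(1), of "J v" "J d"] by simp
    then have "e = 0" using Je TM_tr J_eq_zero[OF m(2)] by blast
    then show "v \<in> D" using de by simp
  qed (use J_D D_TM in blast)
  show "J v \<in> tr \<longleftrightarrow> v \<in> Dt"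
  proof
    assume "J v \<in> tr"
    then have "J d \<in> tr" using Jv Je subspace_diff[OF str, of "J v" "J e"] by simp
    then have "d = 0" using Jd TM_tr J_eq_zero[OF m(1)] by blast
    then show "v \<in> Dt" using de by simp
  qed (use J_Dt in blast)
qed

lemma disjoint:
  "D0 \<inter> D1 = {0}" "(D0 + D1) \<inter> J ` D1 = {0}" "D2 \<inter> J ` L1 = {0}" "(D2 + J ` L1) \<inter> J ` S = {0}"
proof -
  have z: "0 \<in> D1" "0 \<in> D2" "0 \<in> D0" "0 \<in> J ` D1" "0 \<in> J ` L1" "0 \<in> J ` S" "0 \<in> D'"
    using sub subspace_0 zero_J by auto
  show "D0 \<inter> D1 = {0}" using z D_in Rad_ST by blast
  show "D2 \<inter> J ` L1 = {0}" using z D_in JD'(4) Rad_ST by blast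
  have z2: "0 \<in> D0 + D1" "0 \<in> D2 + J ` L1"
    using set_plus_intro[OF z(3,1)] set_plus_intro[OF z(2,5)] by simp_all
  have "x = 0" if x: "x \<in> D0 + D1" "x \<in> J ` D1" for x
  proof -
    obtain a b where ab: "a \<in> D0" "b \<in> D1" "x = a + b" using x(1) by (auto simp: set_plus_def)
    have "b = x - a" using ab by simp
    also have "x - a \<in> ST" using x(2) rad(2) ab(1) D_in(3) by (intro subspace_diff[OF sub(1)]) auto
    finally have "b = 0" using ab(2) D_in(1) Rad_ST by blast
    then have "x \<in> D0" using ab by simp
    moreover have "x \<in> J ` D1 + D'" using x(2) set_plus_intro[OF x(2) z(7)] by simp
    ultimately show ?thesis using decST(1) by (auto simp: orthogonal_sum_def direct_sum_def)
  qed
  then show "(D0 + D1) \<inter> J ` D1 = {0}" using z(4) z2(1) by blast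
  have "x = 0" if x: "x \<in> D2 + J ` L1" "x \<in> J ` S" for x
  proof -
    obtain a l where al: "a \<in> D2" "l \<in> L1" "x = a + J l" using x(1) by (auto simp: set_plus_def)
    obtain \<sigma> where \<sigma>: "\<sigma> \<in> S" "x = J \<sigma>" using x(2) by blast
    have "a = x - J l" using al by simp
    also have "x - J l \<in> ST" using x(2) JS_ST al(2) JD'(4) by (intro subspace_diff[OF sub(1)]) auto
    finally have "a = 0" using al(1) D_in(2) Rad_ST by blast
    then have "J (l - \<sigma>) = 0" using al \<sigma> J_simps(3)[of l \<sigma>] inT by auto
    moreover have "l - \<sigma> \<in> T" using al(2) \<sigma>(1) inT by (intro subspace_diff[OF T]) auto
    ultimately have "l = \<sigma>" using J_eq_zero[of "l - \<sigma>"] by simp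
    then have "\<sigma> = 0" using al(2) \<sigma>(1) JD'(1) by (auto simp: orthogonal_sum_def direct_sum_def)
    then show ?thesis using \<sigma>(2) J_zero by simp
  qed
  then show "(D2 + J ` L1) \<inter> J ` S = {0}" using z(6) z2(2) by blast
qed

end

text \<open>Pairing with \<open>\<xi> i p\<close> reads off the coefficient of \<open>N i p\<close>,
  so a vector of \<open>ltr\<close> orthogonal to the radical has all coefficients 0.\<close>

lemma lightlike_transversal_dual:
  assumes ltr: "lightlike_transversal_bundle A B g F r ST SN ltr"
    and g: "symmetric_bilinear_on (tangent_space B (F p)) (g (F p))"
    and T: "subspace (tangent_space B (F p))" and rad: "rad_bundle A B g F p \<subseteq> tangent_space B (F p)"
    and lT: "ltr p \<subseteq> tangent_space B (F p)"
    and l: "l \<in> ltr p" "\<And>\<xi>. \<xi> \<in> rad_bundle A B g F p \<Longrightarrow> g (F p) l \<xi> = 0"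
  shows "l = 0"
proof -
  obtain U \<xi> N where p: "p \<in> U" and fr: "local_frame A B F r (rad_bundle A B g F) U \<xi>" "local_frame A B F r ltr U N"
    and dual: "\<forall>x\<in>U. \<forall>i<r. \<forall>j<r. g (F x) (\<xi> i x) (N j x) = (if i = j then 1 else 0) \<and> g (F x) (N i x) (N j x) = 0"
    using ltr unfolding lightlike_transversal_bundle_def by blast
  let ?T = "tangent_space B (F p)"
  have N: "inj_on (\<lambda>i. N i p) {..<r}" "span ((\<lambda>i. N i p) ` {..<r}) = ltr p"
    and \<xi>: "span ((\<lambda>i. \<xi> i p) ` {..<r}) = rad_bundle A B g F p"
    using fr p by (auto simp: local_frame_def)
  have NT: "N i p \<in> ?T" and \<xi>R: "\<xi> i p \<in> rad_bundle A B g F p" if "i < r" for i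
    using that N(2) \<xi> lT span_base[of "N i p" "(\<lambda>i. N i p) ` {..<r}"] span_base[of "\<xi> i p" "(\<lambda>i. \<xi> i p) ` {..<r}"]
    by auto
  obtain a where a: "l = (\<Sum>v\<in>(\<lambda>i. N i p) ` {..<r}. a v *\<^sub>R v)"
    using l(1) span_finite[of "(\<lambda>i. N i p) ` {..<r}"] N(2) by auto
  then have lsum: "l = (\<Sum>j<r. a (N j p) *\<^sub>R N j p)"
    by (simp add: sum.reindex[OF N(1)])
  have "a (N i p) = 0" if i: "i < r" for i
  proof -
    have \<xi>T: "\<xi> i p \<in> ?T" using \<xi>R[OF i] rad by blast
    have L: "linear_map_on ?T UNIV (g (F p) (\<xi> i p))" using g \<xi>T by (simp add: symmetric_bilinear_on_def)
    have "0 = g (F p) (\<xi> i p) l"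
      using l(2)[OF \<xi>R[OF i]] symmetric_bilinear_onD(1)[OF g \<xi>T, of l] l(1) lT by auto
    also have "\<dots> = (\<Sum>j<r. g (F p) (\<xi> i p) (a (N j p) *\<^sub>R N j p))"
      unfolding lsum by (rule linear_map_on_sum[OF L T]) (use NT in \<open>auto intro: subspace_scale[OF T]\<close>)
    also have "\<dots> = (\<Sum>j<r. if j = i then a (N i p) else 0)"
      by (rule sum.cong[OF refl]) (use dual p i NT in \<open>auto simp: linear_map_onD(3)[OF L]\<close>)
    also have "\<dots> = a (N i p)" using i by simp
    finally show ?thesis by simp
  qed
  then show "l = 0" unfolding lsum by (intro sum.neutral) auto
qed

theorem theorem3p3:
  fixes B :: "('a::{t2_space,second_countable_topology}, 'b::euclidean_space) chart set"
    and g :: "'a \<Rightarrow> 'a tvec \<Rightarrow> 'a tvec \<Rightarrow> real"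
    and J :: "'a \<Rightarrow> 'a tvec \<Rightarrow> 'a tvec"
    and nab :: "'a \<Rightarrow> 'a tvec \<Rightarrow> ('a \<Rightarrow> 'a tvec) \<Rightarrow> 'a tvec"
    and q r :: nat
    and A :: "('p::{t2_space,second_countable_topology}, 'e::euclidean_space) chart set"
    and F :: "'p \<Rightarrow> 'a"
    and nabF :: "'p \<Rightarrow> 'a tvec \<Rightarrow> ('p \<Rightarrow> 'a tvec) \<Rightarrow> 'a tvec"
    and ST SN ltr D0 D1 D2 D' L1 L2 S :: "'p \<Rightarrow> 'a tvec set"
  defines "TM \<equiv> tan_bundle A B F"
    and "tr \<equiv> tr_bundle ltr SN"
    and "D \<equiv> D_dist J F D0 D1"
    and "Dt \<equiv> Dt_dist J F D2 L1 S"
    and "JF \<equiv> (\<lambda>X p. J (F p) (X p))"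
  assumes "indefinite_kaehler B q g J nab"
    and "lightlike_submanifold A B g F r"
    and "screen_distribution A B g F ST"
    and "screen_transversal_bundle A B g F SN"
    and "lightlike_transversal_bundle A B g F r ST SN ltr"
    and "stcr A B g J F ST SN ltr D0 D1 D2 D' L1 L2 S"
    and "induced_connection A B F nab nabF"
  shows
    "(integrable_distribution A (on_source A B F D) \<longleftrightarrow>
       (\<forall>X\<in>sections A B F D. \<forall>Y\<in>sections A B F D.
          second_ff TM tr nabF X (JF Y) = second_ff TM tr nabF (JF X) Y)) \<and>
     (integrable_distribution A (on_source A B F Dt) \<longleftrightarrow>
       (\<forall>Z\<in>sections A B F Dt. \<forall>V\<in>sections A B F Dt.
          shape TM tr nabF (JF Z) V = shape TM tr nabF (JF V) Z))"
proof -
  note kaehler = assms(6)[unfolded indefinite_kaehler_def]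
  note submanifold = assms(7)[unfolded lightlike_submanifold_def immersion_def]
  have sB: "smooth_structure B" and metric: "semi_riemannian_metric B q g"
    and acs: "almost_complex_structure B J" and lc: "levi_civita B g nab"
    and par: "\<And>p v Y. v \<in> tangent_space B p \<Longrightarrow> Y \<in> vector_fields B \<Longrightarrow>
      nab p v (\<lambda>q. J q (Y q)) = J p (nab p v Y)"
    using kaehler by blast+
  interpret smooth_immersion A B F
    by unfold_locales (use sB submanifold in auto)
  interpret conn: pulled_back_connection A B F nab nabF
    by unfold_locales (rule assms(12))
  have gb: "symmetric_bilinear_on (tangent_space B p) (g p)" for p
    using metric unfolding semi_riemannian_metric_def by blast
  have Jl: "linear_map_on (tangent_space B p) (tangent_space B p) (J p)" for p
    using acs unfolding almost_complex_structure_def by blast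
  have JJ: "J p (J p x) = - x" if "x \<in> tangent_space B p" for p x
    using acs that unfolding almost_complex_structure_def by blast
  have JY: "(\<lambda>p. J p (Y p)) \<in> vector_fields B" if "Y \<in> vector_fields B" for Y
    using acs that unfolding almost_complex_structure_def by blast
  have Jinj: "inj_on (J p) (tangent_space B p)" for p
  proof (rule inj_onI)
    fix x y assume xy: "x \<in> tangent_space B p" "y \<in> tangent_space B p" "J p x = J p y"
    then have "- x = - y" using JJ[OF xy(1)] JJ[OF xy(2)] by (simp only:)
    then show "x = y" by (rule neg_equal_iff_equal[THEN iffD1])
  qed
  have aff: "affine_connection B nab"
    and tor: "\<And>X Y p. X \<in> vector_fields B \<Longrightarrow> Y \<in> vector_fields B \<Longrightarrow>
      nab p (X p) Y - nab p (Y p) X = lie_bracket X Y p"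
    using lc unfolding levi_civita_def by blast+
  note stcr = conjunct1[OF conjunct2[OF assms(11)[unfolded stcr_def]]]
    conjunct1[OF conjunct2[OF conjunct2[OF assms(11)[unfolded stcr_def]]]]
    conjunct2[OF conjunct2[OF conjunct2[OF assms(11)[unfolded stcr_def]]]]
  have bundles: "vector_subbundle A B F D0" "vector_subbundle A B F D1" "vector_subbundle A B F D2"
    "vector_subbundle A B F D'" "vector_subbundle A B F L1" "vector_subbundle A B F L2"
    "vector_subbundle A B F S"
    using assms(11) unfolding stcr_def by simp_all
  have ST: "vector_subbundle A B F ST" and SN: "vector_subbundle A B F SN"
    using assms(8,9) unfolding screen_distribution_def screen_transversal_bundle_def by blast+
  have ltr_frame: "\<exists>U N. p \<in> U \<and> local_frame A B F r ltr U N" for p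
    using assms(10) unfolding lightlike_transversal_bundle_def by blast
  have ltr_bundle: "vector_subbundle A B F ltr"
    unfolding vector_subbundle_def using ltr_frame by blast
  have sTM: "subspace (TM p)" and TMT: "TM p \<subseteq> tangent_space B (F p)" for p
    unfolding TM_def tan_bundle_def
    using linear_subspace_image[OF push_linear A.subspace_tangent_space] push_in by auto
  \<comment> \<open>Local frames provide the finite spanning set from which non-degeneracy yields
    projections.\<close>
  have proj: "\<exists>u\<in>E p. \<forall>y\<in>E p. g (F p) (w - u) y = 0"
    if E: "vector_subbundle A B F E" and nd: "nondegenerate_on (E p) (g (F p))"
      and w: "w \<in> tangent_space B (F p)" for E p w
  proof -
    obtain k U s where s: "p \<in> U" "local_frame A B F k E U s"
      using E unfolding vector_subbundle_def by blast
    let ?S = "(\<lambda>i. s i p) ` {..<k}"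
    have span: "E p = span ?S" using s by (auto simp: local_frame_def)
    have ST: "?S \<subseteq> tangent_space B (F p)"
      using span_superset[of ?S] span vector_subbundle_in[OF E, of p] by (simp only:)
    show ?thesis
    proof (rule nondegenerate_projection[OF gb B.subspace_tangent_space _ ST span nd w])
      show "finite ?S" by simp
      fix u assume "u \<in> E p" "\<And>y. y \<in> E p \<Longrightarrow> g (F p) (w - u) y = 0"
      then show ?thesis by (intro bexI[of _ u] ballI)
    qed
  qed
  have alg: "stcr_algebra (tangent_space B (F p)) (TM p) (rad_bundle A B g F p) (normal_bundle A B g F p)
    (ST p) (SN p) (ltr p) (D0 p) (D1 p) (D2 p) (D' p) (L1 p) (S p) (g (F p)) (J (F p))" for p
  proof
    show "rad_bundle A B g F p = TM p \<inter> normal_bundle A B g F p"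
      by (simp add: rad_bundle_def TM_def)
    show "normal_bundle A B g F p = {w \<in> tangent_space B (F p). \<forall>x\<in>TM p. g (F p) w x = 0}"
      by (simp add: normal_bundle_def TM_def)
    have radT: "rad_bundle A B g F p \<subseteq> tangent_space B (F p)"
      using TMT[of p] by (auto simp: rad_bundle_def TM_def)
    show "l = 0" if "l \<in> ltr p" "\<And>\<xi>. \<xi> \<in> rad_bundle A B g F p \<Longrightarrow> g (F p) l \<xi> = 0" for l
      using lightlike_transversal_dual[OF assms(10) gb B.subspace_tangent_space radT
            vector_subbundle_in[OF ltr_bundle] that(1)] that(2) .
    show "\<exists>u\<in>ST p. \<forall>y\<in>ST p. g (F p) (w - u) y = 0" if "w \<in> tangent_space B (F p)" for w
      by (rule proj[OF ST _ that]) (use assms(8) in \<open>simp add: screen_distribution_def\<close>)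
    show "\<exists>u\<in>SN p. \<forall>y\<in>SN p. g (F p) (w - u) y = 0" if "w \<in> tangent_space B (F p)" for w
      by (rule proj[OF SN _ that]) (use assms(9) in \<open>simp add: screen_transversal_bundle_def\<close>)
    show "orthogonal_sum (g (F p)) (TM p) (ST p) (rad_bundle A B g F p)"
      using assms(8) unfolding screen_distribution_def TM_def by blast
    show "orthogonal_sum (g (F p)) (normal_bundle A B g F p) (SN p) (rad_bundle A B g F p)"
      using assms(9) unfolding screen_transversal_bundle_def by blast
    show "direct_sum {w \<in> tangent_space B (F p). \<forall>x\<in>ST p + SN p. g (F p) w x = 0} (rad_bundle A B g F p) (ltr p)"
      using assms(10) unfolding lightlike_transversal_bundle_def by blast
    show "direct_sum (rad_bundle A B g F p) (D1 p) (D2 p)" "J (F p) ` D1 p \<subseteq> ST p" "J (F p) ` D2 p \<subseteq> SN p"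
      "orthogonal_sum (g (F p)) (ST p) (J (F p) ` D1 p + D' p) (D0 p)" "J (F p) ` D1 p \<inter> D' p = {0}"
      "J (F p) ` D0 p = D0 p" "orthogonal_sum (g (F p)) (J (F p) ` D' p) (L1 p) (S p)" "L1 p \<subseteq> ltr p"
      "S p \<subseteq> SN p" "J (F p) ` L1 p \<subseteq> ST p"
      by (insert spec[OF stcr(1), of p] spec[OF stcr(2), of p] spec[OF stcr(3), of p])
        (elim conjE, assumption)+
  qed (rule gb Jl sTM TMT B.subspace_tangent_space vector_subbundle_subspace[OF ST]
      vector_subbundle_subspace[OF SN] vector_subbundle_subspace[OF ltr_bundle]
      bundles[THEN vector_subbundle_subspace] vector_subbundle_in[OF ltr_bundle]
      bundles[THEN vector_subbundle_in] JJ | assumption)+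
  have D_eq: "D p = D0 p + D1 p + J (F p) ` D1 p" and Dt_eq: "Dt p = D2 p + J (F p) ` L1 p + J (F p) ` S p"
    and tr_eq: "tr p = ltr p + SN p" for p
    by (simp_all add: D_def D_dist_def Dt_def Dt_dist_def tr_def tr_bundle_def)
  have JE: "vector_subbundle A B F (\<lambda>p. J (F p) ` E p)" if "vector_subbundle A B F E" for E
    by (rule vector_subbundle_image[OF Jl JY Jinj that])
  note disj = stcr_algebra.disjoint[OF alg]
  have Db: "vector_subbundle A B F D"
    using vector_subbundle_plus[OF vector_subbundle_plus[OF bundles(1,2) disj(1)] JE[OF bundles(2)] disj(2)]
    unfolding D_eq[abs_def] .
  have Dtb: "vector_subbundle A B F Dt"
    using vector_subbundle_plus[OF vector_subbundle_plus[OF bundles(3) JE[OF bundles(5)] disj(3)] JE[OF bundles(7)] disj(4)]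
    unfolding Dt_eq[abs_def] .
  have DTM: "D p \<subseteq> tan_bundle A B F p" and DtTM: "Dt p \<subseteq> tan_bundle A B F p" for p
    using stcr_algebra.D_TM[OF alg, of p] stcr_algebra.Dt_TM[OF alg, of p]
    unfolding D_eq Dt_eq TM_def by auto
  have str: "subspace (tr p)" for p
    unfolding tr_eq using subspace_plus vector_subbundle_subspace[OF ltr_bundle] vector_subbundle_subspace[OF SN] by blast
  have split: "tangent_space B (F p) = TM p + tr p" "TM p \<inter> tr p = {0}" for p
    using stcr_algebra.T_split[OF alg, of p] stcr_algebra.TM_tr[OF alg, of p] unfolding tr_eq by auto
  have comp_tr: "component (tr p) (TM p) v = component (tr p) (TM p) v' \<longleftrightarrow> v - v' \<in> TM p"
    and comp_TM: "component (TM p) (tr p) v = component (TM p) (tr p) v' \<longleftrightarrow> v - v' \<in> tr p"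
    if "v \<in> tangent_space B (F p)" "v' \<in> tangent_space B (F p)" for p v v'
    using component_eq_iff[OF str sTM, of p p v v'] component_eq_iff[OF sTM str, of p p v v'] that split[of p]
    by (simp_all add: add.commute Int_commute)
  have Jmem: "J (F p) v \<in> TM p \<longleftrightarrow> v \<in> D p" "J (F p) v \<in> tr p \<longleftrightarrow> v \<in> Dt p" if "v \<in> TM p" for p v
    using stcr_algebra.J_mem_iff[OF alg that] unfolding D_eq Dt_eq tr_eq .

  have nabT: "nabF p v V \<in> tangent_space B (F p)"
    if "v \<in> tan_bundle A B F p" "V \<in> fields_along A B F" for p v V
    using linear_map_onD(1)[OF conn.nabF_linear[OF that(2)] that(1)] .
  have JnabF: "nabF p v (JF V) = J (F p) (nabF p v V)"
    if "v \<in> tan_bundle A B F p" "V \<in> fields_along A B F" for p v V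
    unfolding JF_def by (rule conn.nabF_parallel[OF aff Jl JY par that(2,1)])
  have JT: "J (F p) v \<in> tangent_space B (F p)" if "v \<in> tangent_space B (F p)" for p v
    by (rule linear_map_onD(1)[OF Jl that])
  \<comment> \<open>Torsion-freeness and linearity of \<open>J\<close>. Both parts compare
    components of the two terms on the left, the transversal ones in (i) and the tangential ones in
    (ii).\<close>
  have bracket: "J (F p) (nabF p (push A B F (X p)) (\<lambda>p. push A B F (Y p))) -
      J (F p) (nabF p (push A B F (Y p)) (\<lambda>p. push A B F (X p))) = J (F p) (push A B F (lie_bracket X Y p))"
    if X: "X \<in> vector_fields A" and Y: "Y \<in> vector_fields A" for X Y p
  proof -
    have "nabF p (push A B F (X p)) (\<lambda>p. push A B F (Y p)) \<in> tangent_space B (F p)"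
      "nabF p (push A B F (Y p)) (\<lambda>p. push A B F (X p)) \<in> tangent_space B (F p)"
      by (rule nabT[OF conn.push_in_tan_bundle[OF A.vector_fieldD(1)[OF X]] push_field[OF Y]]
          nabT[OF conn.push_in_tan_bundle[OF A.vector_fieldD(1)[OF Y]] push_field[OF X]])+
    note diff = linear_map_on_diff[OF Jl B.subspace_tangent_space this]
    show ?thesis
      by (rule trans[OF diff[symmetric] arg_cong[where f = "J (F p)", OF conn.nabF_torsion_free[OF aff tor X Y]]])
  qed
  have bracketTM: "push A B F (lie_bracket X Y p) \<in> TM p"
    if "X \<in> vector_fields A" "Y \<in> vector_fields A" for X Y p
    unfolding TM_def by (rule conn.push_in_tan_bundle[OF A.lie_bracket_in[OF that]])
  have pT: "push A B F (X p) \<in> tan_bundle A B F p" if "X \<in> vector_fields A" for X p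
    by (rule conn.push_in_tan_bundle[OF A.vector_fieldD(1)[OF that]])
  have "integrable_distribution A (on_source A B F D) \<longleftrightarrow>
       (\<forall>X\<in>sections A B F D. \<forall>Y\<in>sections A B F D.
          second_ff TM tr nabF X (JF Y) = second_ff TM tr nabF (JF X) Y)"
  proof (rule integrable_iff_bracket[OF Db DTM])
    fix X Y p assume X: "X \<in> vector_fields A" and Y: "Y \<in> vector_fields A"
      and XD: "(\<lambda>p. push A B F (X p)) \<in> sections A B F D" and YD: "(\<lambda>p. push A B F (Y p)) \<in> sections A B F D"
    let ?X = "\<lambda>p. push A B F (X p)" and ?Y = "\<lambda>p. push A B F (Y p)"
    note fX = push_field[OF X] and fY = push_field[OF Y]
    have JXf: "JF ?X \<in> fields_along A B F"
      unfolding JF_def by (rule tensor_field_along(1)[OF Jl JY fX])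
    have JXT: "JF ?X p \<in> tan_bundle A B F p" for p
    proof -
      have "?X p \<in> D p" using XD by (simp add: sections_def)
      then have "J (F p) (?X p) \<in> TM p" using Jmem(1)[of "?X p" p] DTM[of p] by (auto simp: TM_def)
      then show ?thesis by (simp add: JF_def TM_def)
    qed
    \<comment> \<open>For \<open>X\<close> in \<open>D\<close> the field \<open>J X\<close> is
      tangent again, hence comes from a field on \<open>M\<close>, and torsion-freeness applies to
      it.\<close>
    obtain X' where X': "X' \<in> vector_fields A" "\<And>p. JF ?X p = push A B F (X' p)"
      by (rule pull_back_field[OF JXf JXT]) (rule that; assumption)
    have JX: "JF ?X = (\<lambda>p. push A B F (X' p))" using X'(2) by blast
    note n1 = nabT[OF pT[OF X] fY, of p] and n2 = nabT[OF pT[OF Y] fX, of p]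
      and n3 = nabT[OF pT[OF X'(1)] fY, of p] and n4 = nabT[OF pT[OF Y] push_field[OF X'(1)], of p]
    \<comment> \<open>This is the symmetry of \<open>h\<close>: the two covariant derivatives differ
      by a bracket, which is tangent. So \<open>h (J X, Y)\<close> is the transversal part of the
      derivative of \<open>J X\<close> along \<open>Y\<close>, and \<open>J\<close> can be moved
      outside.\<close>
    have "nabF p (push A B F (X' p)) ?Y - nabF p (?Y p) (JF ?X) \<in> TM p"
      unfolding JX
      by (rule ssubst[where P = "\<lambda>v. v \<in> TM p", OF conn.nabF_torsion_free[OF aff tor X'(1) Y] bracketTM[OF X'(1) Y]])
    then have "second_ff TM tr nabF (JF ?X) ?Y p = component (tr p) (TM p) (nabF p (?Y p) (JF ?X))"
      unfolding second_ff_def X'(2) JX by (rule iffD2[OF comp_tr[OF n3 n4]])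
    also have "nabF p (?Y p) (JF ?X) = J (F p) (nabF p (?Y p) ?X)" by (rule JnabF[OF pT[OF Y] fX])
    finally have 1: "second_ff TM tr nabF (JF ?X) ?Y p = component (tr p) (TM p) (J (F p) (nabF p (?Y p) ?X))" .
    have 2: "second_ff TM tr nabF ?X (JF ?Y) p = component (tr p) (TM p) (J (F p) (nabF p (?X p) ?Y))"
      unfolding second_ff_def JnabF[OF pT[OF X] fY] ..
    show "push A B F (lie_bracket X Y p) \<in> D p \<longleftrightarrow>
        second_ff TM tr nabF ?X (JF ?Y) p = second_ff TM tr nabF (JF ?X) ?Y p"
      unfolding 1 2 comp_tr[OF JT[OF n1] JT[OF n2]] bracket[OF X Y] Jmem(1)[OF bracketTM[OF X Y]] ..
  qed
  moreover have "integrable_distribution A (on_source A B F Dt) \<longleftrightarrow>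
       (\<forall>Z\<in>sections A B F Dt. \<forall>V\<in>sections A B F Dt.
          shape TM tr nabF (JF Z) V = shape TM tr nabF (JF V) Z)"
  proof (rule integrable_iff_bracket[OF Dtb DtTM])
    fix X Y p assume X: "X \<in> vector_fields A" and Y: "Y \<in> vector_fields A"
    let ?X = "\<lambda>p. push A B F (X p)" and ?Y = "\<lambda>p. push A B F (Y p)"
    note fX = push_field[OF X] and fY = push_field[OF Y]
    note n1 = nabT[OF pT[OF X] fY, of p] and n2 = nabT[OF pT[OF Y] fX, of p]
    \<comment> \<open>\<open>A\<close> of \<open>J X\<close> at \<open>Y\<close> differentiates
      along \<open>Y\<close>, so the two sides appear in the opposite order; the minus signs
      cancel.\<close>
    have "shape TM tr nabF (JF ?X) ?Y p = shape TM tr nabF (JF ?Y) ?X p \<longleftrightarrow>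
        component (TM p) (tr p) (J (F p) (nabF p (?X p) ?Y)) = component (TM p) (tr p) (J (F p) (nabF p (?Y p) ?X))"
      unfolding shape_def JnabF[OF pT[OF X] fY] JnabF[OF pT[OF Y] fX] neg_equal_iff_equal by (rule eq_commute)
    then show "push A B F (lie_bracket X Y p) \<in> Dt p \<longleftrightarrow>
        shape TM tr nabF (JF ?X) ?Y p = shape TM tr nabF (JF ?Y) ?X p"
      unfolding comp_TM[OF JT[OF n1] JT[OF n2]] bracket[OF X Y] Jmem(2)[OF bracketTM[OF X Y]] by (rule sym)
  qed
  ultimately show ?thesis ..
qed

end
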